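(* Let $\xi_0,\xi_1,\ldots$ be non-degenerate i.i.d. complex-valued random variables with $\mathbb{E}\log(1+|\xi_0|)<\infty$. Let $f_{k,n}\in\mathbb{C}$ ($k\in\{0,1,2,\ldots\}$, $n\in\mathbb{N}$) be deterministic coefficients and consider the random Taylor series $$G_n(z)=\sum_{k=0}^{\infty}\xi_k f_{k,n}z^k .$$ Assume that there are a function $f:[0,\infty)\to[0,\infty)$ and a number $T_0\in(0,\infty]$ such that: (A1) $f(t)>0$ for $t<T_0$ and $f(t)=0$ for $t>T_0$; (A2) $f$ is continuous on $[0,T_0)$ and, in the case $T_0<\infty$, left continuous at $T_0$; (A3) for every $A>0$, $\lim_{n\to\infty}\sup_{k\in[0,An]}\left||f_{k,n}|^{1/n}-f(k/n)\right|=0$, where the supremum is over integers $k\in[0,An]$; (A4) $R_0:=\liminf_{t\to\infty}f(t)^{-1/t}\in(0,\infty]$ and $\liminf_{n,\,k/n\to\infty}|f_{k,n}|^{-1/k}\geq R_0$. Define $I:\mathbb{R}\to\mathbb{R}\cup\{+\infty\}$ by $I(s)=\sup_{t\geq0}(st+\log f(t))$. Then, as $n\to\infty$, the sequence of random measures $\frac1n\mu_{G_n}$ converges in probability to a deterministic locally finite measure $\mu$ on the disk $\mathbb{D}_{R_0}$. The measure $\mu$ is rotationally invariant and is characterized by $$\mu(\mathbb{D}_r)=I'(\log r),\qquad 0<r<R_0,$$ where $I'$ denotes the left derivative of the convex function $I$ (which is finite on $(-\infty,\log R_0)$).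
   Context: Notation and conventions. A random variable is non-degenerate if it is not almost surely equal to a constant. $\mathbb{D}_r=\{z\in\mathbb{C}:|z|<r\}$ (and $\mathbb{D}_\infty=\mathbb{C}$). Conventions: $\log 0=-\infty$, $0^{-1/t}=+\infty$. The condition $\liminf_{n,\,k/n\to\infty}|f_{k,n}|^{-1/k}\ge R_0$ means: for every real $c<R_0$ there is $A>0$ such that $|f_{k,n}|^{-1/k}\geq c$ for all $n\geq A$ and all $k\geq An$. Zero-counting measure: for an analytic function $G\not\equiv0$, $\mu_G=\sum_{z:G(z)=0}n_G(z)\,\delta_z$, where $n_G(z)$ is the multiplicity of the zero $z$ and $\delta_z$ is the unit point mass at $z$. Under (A4), for every $r<R_0$ the series $G_n$ almost surely converges on $\mathbb{D}_r$ for all sufficiently large $n$; $\mu_{G_n}$ counts the zeros of $G_n$ in $\mathbb{D}_{R_0}$ intersected with its disk of convergence. On the event $G_n\equiv0$ (whose probability tends to $0$) the measure may be given any value, e.g. $0$. Convergence: a sequence of random locally finite measures $\mu_n$ on $X$ converges in probability to $\mu$ if $\int_X\varphi\,d\mu_n\to\int_X\varphi\,d\mu$ in probability for every continuous compactly supported $\varphi:X\to\mathbb{R}$ (here $X=\mathbb{D}_{R_0}$). *)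

theory Defs
  imports "HOL-Probability.Probability" "HOL-Complex_Analysis.Complex_Analysis"
begin

definition ext_ln :: "real \<Rightarrow> ereal" where
  "ext_ln x = (if x = 0 then -\<infinity> else ereal (ln x))"

text \<open>\<open>x\<close> to the power \<open>-1/t\<close> for \<open>x \<ge> 0\<close>, with value \<open>\<infinity>\<close> at \<open>x = 0\<close>
  (whereas \<open>0 powr a = 0\<close> in the library).\<close>

definition inv_root :: "real \<Rightarrow> real \<Rightarrow> ereal" where
  "inv_root t x = (if x = 0 then \<infinity> else ereal (x powr (- 1 / t)))"

definition conjugate :: "(real \<Rightarrow> real) \<Rightarrow> real \<Rightarrow> ereal" where
  "conjugate f s = (SUP t\<in>{0..}. ereal (s * t) + ext_ln (f t))"

definition random_series ::
    "(nat \<Rightarrow> 'a \<Rightarrow> complex) \<Rightarrow> (nat \<Rightarrow> nat \<Rightarrow> complex) \<Rightarrow> nat \<Rightarrow> 'a \<Rightarrow> complex fps" where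
  "random_series \<xi> F n \<omega> = Abs_fps (\<lambda>k. \<xi> k \<omega> * F k n)"

text \<open>The zero-counting measure, as a Borel measure on the disk of radius \<open>R\<close>. Only zeros
  inside the disk of convergence are counted, since \<^const>\<open>eval_fps\<close> is meaningless outside it.
  At a zero of a power series that does not vanish identically, \<^const>\<open>zorder\<close> is the (positive)
  multiplicity. The zero series gets the zero measure.\<close>

definition zero_measure :: "ereal \<Rightarrow> complex fps \<Rightarrow> complex measure" where
  "zero_measure R g =
    (if g = 0 then null_measure (restrict_space borel (eball 0 R))
     else distr
       (density
         (count_space {z \<in> eball 0 R \<inter> eball 0 (fps_conv_radius g). eval_fps g z = 0})
         (\<lambda>z. of_nat (nat (zorder (eval_fps g) z))))
       (restrict_space borel (eball 0 R)) (\<lambda>z. z))"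

definition locally_finite_borel_on :: "'b::topological_space set \<Rightarrow> 'b measure \<Rightarrow> bool" where
  "locally_finite_borel_on X \<mu> \<longleftrightarrow>
    sets \<mu> = sets (restrict_space borel X) \<and>
    (\<forall>K. compact K \<and> K \<subseteq> X \<longrightarrow> emeasure \<mu> K < \<infinity>)"

definition rotation_invariant :: "complex measure \<Rightarrow> bool" where
  "rotation_invariant \<mu> \<longleftrightarrow> (\<forall>\<theta>. distr \<mu> \<mu> (\<lambda>z. cis \<theta> * z) = \<mu>)"

text \<open>\<^const>\<open>measure\<close> is \<open>0\<close> on non-measurable sets; the outer measure keeps the following definition
  meaningful without measurability assumptions on \<open>Y\<close> and agrees with the usual probability
  when \<open>Y n\<close> is a random variable.\<close>

definition tendsto_in_prob :: "'a measure \<Rightarrow> (nat \<Rightarrow> 'a \<Rightarrow> real) \<Rightarrow> real \<Rightarrow> bool" where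
  "tendsto_in_prob M Y c \<longleftrightarrow>
    (\<forall>\<epsilon>>0. (\<lambda>n. outer_measure_of M {\<omega> \<in> space M. \<bar>Y n \<omega> - c\<bar> > \<epsilon>}) \<longlonglongrightarrow> 0)"

definition measures_tendsto_in_prob ::
    "'a measure \<Rightarrow> 'b::topological_space set \<Rightarrow> (nat \<Rightarrow> 'a \<Rightarrow> 'b measure) \<Rightarrow> 'b measure \<Rightarrow> bool" where
  "measures_tendsto_in_prob M X \<mu>s \<mu> \<longleftrightarrow>
    (\<forall>\<phi> :: 'b \<Rightarrow> real.
       continuous_on X \<phi> \<and> (\<exists>K. compact K \<and> K \<subseteq> X \<and> (\<forall>x\<in>X - K. \<phi> x = 0)) \<longrightarrow>
       tendsto_in_prob M (\<lambda>n \<omega>. \<integral>x. \<phi> x \<partial>\<mu>s n \<omega>) (\<integral>x. \<phi> x \<partial>\<mu>))"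

text \<open>The derivative within \<open>at_left\<close> is the left derivative. It is used with \<open>I\<close> finite below
  \<open>ln R\<close>, so that \<^const>\<open>real_of_ereal\<close> loses nothing.\<close>

definition radial_measure :: "ereal \<Rightarrow> (real \<Rightarrow> ereal) \<Rightarrow> complex measure \<Rightarrow> bool" where
  "radial_measure R I \<mu> \<longleftrightarrow>
    locally_finite_borel_on (eball 0 R) \<mu> \<and>
    rotation_invariant \<mu> \<and>
    (\<forall>r. 0 < r \<and> ereal r < R \<longrightarrow>
       ((\<lambda>s. real_of_ereal (I s)) has_real_derivative measure \<mu> (ball 0 r)) (at_left (ln r)))"

end

theory Submission
  imports Defs "HOL-Real_Asymp.Real_Asymp"
begin

text \<open>
  Put \<open>u z = I (ln (cmod z))\<close>. With high probability \<open>v z = ln (cmod (G\<^sub>n z)) / n\<close> is at most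
  \<open>u + \<eta>\<close> on compact subsets of the disk, because the moment assumption bounds \<open>\<xi> k\<close> by
  \<open>C * exp (\<delta> * k)\<close>, and at any given point \<open>p \<noteq> 0\<close> it is at least \<open>u p - \<eta>\<close>: of the order of \<open>n\<close>
  terms of the series have modulus nearly \<open>exp (n * u p)\<close>, so a smaller value contradicts
  anti-concentration of sums of independent variables. As \<open>v\<close> is subharmonic, lower bounds at the
  points of a fine finite grid together with the upper bound make \<open>v - u\<close> small in \<open>L\<^sup>1\<close> on compact sets.

  Instead of distributional Laplacians we use circle averages: integrating \<open>v\<close> against the average
  of \<open>\<psi>\<close> over circles of radius \<open>\<rho>\<close> minus \<open>\<psi>\<close> itself gives, by Jensen's formula, the sum over the
  zeros of \<open>\<psi>\<close> smoothed by the kernel \<open>ln (max \<rho> (cmod z)) - ln (cmod z)\<close>, divided by \<open>n\<close>. The same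
  identity holds for \<open>u\<close> and the limit measure, since \<open>u\<close> is up to a constant the logarithmic potential
  of the rotation invariant measure with \<open>\<mu> (ball 0 r) = I' (ln r)\<close>. Letting \<open>\<rho>\<close> tend to \<open>0\<close> removes
  the smoothing.
\<close>

section \<open>The uniform measure on the unit circle and Jensen's formula\<close>

text \<open>Lower bounds avoid the origin because the series there is the single term
  \<open>\<xi> 0 \<omega> * F 0 n\<close>, which may vanish with positive probability. Nor can a
  lower bound be uniform near zeros; the sub-mean value property is what turns a bound at the centre
  of a small disk into one for the average over it. Anti-concentration needs no rate: the threshold
  is smaller than the relevant terms by a factor exponential in n, so any bound tending to 0 with
  the number of summands suffices. Comparison with a random walk killed at 0 provides one without
  characteristic functions or moments. The smoothing error is uniform per zero, so removing it
  requires an a priori bound on the number of zeros. The smoothed identity itself gives that bound,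
  applied with tolerance 1 to a plateau function. Circle averages ask only for continuous test
  functions, Fubini and Jensen's formula for one linear factor; averaging over rotations takes the
  place of polar coordinates. Probabilities enter only through measurable events that cover the bad
  set, as the outer measure in the conclusion suggests.\<close>

definition circ :: "complex measure" where
  "circ = distr (uniform_measure lborel {0..1}) borel (\<lambda>t::real. cis (2 * pi * t))"

lemma circ_cis_measurable [measurable]: "(\<lambda>t::real. cis (2 * pi * t)) \<in> borel_measurable borel"
  by (intro borel_measurable_continuous_onI) (auto intro!: continuous_intros)

lemma space_circ [simp]: "space circ = UNIV" and sets_circ [simp, measurable_cong]: "sets circ = sets borel"
  by (auto simp: circ_def)

lemma prob_space_circ: "prob_space circ"
  unfolding circ_def
  by (intro prob_space.prob_space_distr prob_space_uniform_measure) auto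

interpretation circ: prob_space circ by (rule prob_space_circ)

lemma AE_circ_unit: "AE \<omega> in circ. cmod \<omega> = 1"
  unfolding circ_def by (subst AE_distr_iff) auto

text \<open>Contour integrals are gauge integrals over the unit interval; this bridge lets Cauchy's
  formula evaluate integrals against \<open>circ\<close>.\<close>

lemma integral_circ:
  fixes f :: "complex \<Rightarrow> 'b::euclidean_space"
  assumes c: "continuous_on (sphere 0 1) f" and m: "f \<in> borel_measurable borel"
  shows "integrable circ f"
    and "(\<integral>\<omega>. f \<omega> \<partial>circ) = integral {0..1} (\<lambda>t. f (cis (2 * pi * t)))"
proof -
  have [measurable]: "f \<in> borel_measurable borel" by fact
  have cc: "continuous_on {0..1} (\<lambda>t. f (cis (2 * pi * t)))"
    by (rule continuous_on_compose2[OF c]) (auto intro!: continuous_intros)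
  have si: "set_integrable lborel {0..1} (\<lambda>t. f (cis (2 * pi * t)))"
    by (rule borel_integrable_atLeastAtMost') (rule cc)
  have u: "uniform_measure lborel {0..1::real} = density lborel (\<lambda>x. ennreal (indicator {0..1} x))"
    by (auto simp: uniform_measure_def intro!: density_cong split: split_indicator)
  have "integrable (uniform_measure lborel {0..1}) (\<lambda>t. f (cis (2 * pi * t)))"
    unfolding u by (subst integrable_density) (use si in \<open>auto simp: set_integrable_def\<close>)
  then show "integrable circ f"
    unfolding circ_def by (subst integrable_distr_eq) auto
  have "(\<integral>\<omega>. f \<omega> \<partial>circ) = (LINT t:{0..1}|lborel. f (cis (2 * pi * t)))"
    unfolding circ_def set_lebesgue_integral_def
    by (subst integral_distr) (auto simp: u integral_density)
  also have "\<dots> = integral {0..1} (\<lambda>t. f (cis (2 * pi * t)))"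
    using set_borel_integral_eq_integral(2)[OF si] .
  finally show "(\<integral>\<omega>. f \<omega> \<partial>circ) = integral {0..1} (\<lambda>t. f (cis (2 * pi * t)))" .
qed

text \<open>On a circle about w the form dz / (z - w) is 2 \<pi> i dt, so Cauchy's integral formula
  becomes the mean value property. Measurability is asked on the whole plane because that is the
  space of \<open>circ\<close>.\<close>

lemma circ_mean_value:
  assumes hol: "F holomorphic_on cball w \<rho>" and \<rho>: "\<rho> > 0" and m: "F \<in> borel_measurable borel"
  shows "integrable circ (\<lambda>\<omega>. F (w + of_real \<rho> * \<omega>))"
    and "(\<integral>\<omega>. F (w + of_real \<rho> * \<omega>) \<partial>circ) = F w"
proof -
  have [measurable]: "F \<in> borel_measurable borel" by fact
  have c: "continuous_on (sphere 0 1) (\<lambda>\<omega>. F (w + of_real \<rho> * \<omega>))"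
    by (rule continuous_on_compose2[OF holomorphic_on_imp_continuous_on[OF hol]])
      (use \<rho> in \<open>auto intro!: continuous_intros simp: dist_norm norm_mult\<close>)
  have mm: "(\<lambda>\<omega>. F (w + of_real \<rho> * \<omega>)) \<in> borel_measurable borel" by measurable
  show "integrable circ (\<lambda>\<omega>. F (w + of_real \<rho> * \<omega>))"
    by (rule integral_circ(1)[OF c mm])
  have "((\<lambda>u. F u / (u - w)) has_contour_integral (2 * of_real pi * \<i> * F w)) (circlepath w \<rho>)"
    by (rule Cauchy_integral_circlepath_simple)
      (use hol \<rho> in \<open>auto intro: holomorphic_on_subset\<close>)
  then have "((\<lambda>t. F (circlepath w \<rho> t) / (circlepath w \<rho> t - w) *
      vector_derivative (circlepath w \<rho>) (at t)) has_integral (2 * of_real pi * \<i> * F w)) {0..1}"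
    unfolding has_contour_integral
    by (auto intro: has_integral_spike_interior simp: has_contour_integral_def)
  then have "((\<lambda>t. (2 * of_real pi * \<i>) * F (w + of_real \<rho> * cis (2 * pi * t))) has_integral
       (2 * of_real pi * \<i> * F w)) {0..1}"
  proof (rule has_integral_eq[rotated])
    fix t :: real
    have e: "circlepath w \<rho> t = w + of_real \<rho> * cis (2 * pi * t)"
      by (simp add: circlepath cis_conv_exp mult_ac)
    have d: "vector_derivative (circlepath w \<rho>) (at t) = 2 * of_real pi * \<i> * (of_real \<rho> * cis (2 * pi * t))"
      by (simp add: vector_derivative_circlepath cis_conv_exp mult_ac)
    show "F (circlepath w \<rho> t) / (circlepath w \<rho> t - w) * vector_derivative (circlepath w \<rho>) (at t)
       = (2 * of_real pi * \<i>) * F (w + of_real \<rho> * cis (2 * pi * t))"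
      unfolding d unfolding e using \<rho> by (simp add: cis_neq_zero)
  qed
  then have "((\<lambda>t. F (w + of_real \<rho> * cis (2 * pi * t))) has_integral F w) {0..1}"
    by (drule_tac has_integral_mult_right[where c="inverse (2 * of_real pi * \<i>)"]) (simp add: field_simps)
  then show "(\<integral>\<omega>. F (w + of_real \<rho> * \<omega>) \<partial>circ) = F w"
    using integral_circ(2)[OF c mm] by (auto dest: integral_unique)
qed

text \<open>Dropping the null endpoint 1 turns the parameter interval into an exact fundamental
  domain for the period 1.\<close>

lemma emeasure_circ:
  assumes "E \<in> sets borel"
  shows "emeasure circ E = emeasure lborel {t \<in> {0..<1}. cis (2 * pi * t) \<in> E}"
proof -
  have [measurable]: "E \<in> sets borel" by fact
  have v: "(\<lambda>t. cis (2 * pi * t)) -` E \<in> sets borel"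
    using measurable_sets_borel[OF circ_cis_measurable assms] by simp
  have "emeasure circ E = emeasure lborel ({0..1} \<inter> (\<lambda>t. cis (2 * pi * t)) -` E)"
    unfolding circ_def using v by (subst emeasure_distr) (auto simp: divide_ennreal_def)
  also have "\<dots> = emeasure lborel {t \<in> {0..<1}. cis (2 * pi * t) \<in> E}"
  proof (rule emeasure_eq_AE)
    have "AE t in lborel. t \<noteq> (1::real)" by (rule AE_lborel_singleton)
    then show "AE x in lborel. (x \<in> {0..1} \<inter> (\<lambda>t. cis (2 * pi * t)) -` E) = (x \<in> {t \<in> {0..<1}. cis (2 * pi * t) \<in> E})"
      by eventually_elim auto
  qed (use v in auto)
  finally show ?thesis .
qed

text \<open>Rotation shifts the parameter by s. The part of [s, 1 + s) beyond 1 is moved back by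
  periodicity, and Lebesgue measure on the line is translation invariant.\<close>

lemma distr_circ_rotate:
  assumes "cmod \<alpha> = 1"
  shows "distr circ borel ((*) \<alpha>) = circ"
proof (rule measure_eqI)
  fix E assume "E \<in> sets (distr circ borel ((*) \<alpha>))"
  then have [measurable]: "E \<in> sets borel" by simp
  obtain s where s: "0 \<le> s" "s < 1" "\<alpha> = cis (2 * pi * s)"
  proof -
    have "\<alpha> = cis (Arg2pi \<alpha>)"
      using complex_norm_eq_1_exp assms Arg2pi_eq[of \<alpha>] by (auto simp: cis_conv_exp mult_ac)
    moreover have "0 \<le> Arg2pi \<alpha> / (2*pi)" "Arg2pi \<alpha> / (2*pi) < 1"
      using Arg2pi[of \<alpha>] by auto
    ultimately show ?thesis by (intro that[of "Arg2pi \<alpha> / (2*pi)"]) auto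
  qed
  define P where "P t \<longleftrightarrow> cis (2 * pi * t) \<in> E" for t :: real
  have [measurable]: "Measurable.pred borel P" unfolding P_def by measurable
  have P1: "P (t + 1) = P t" for t
    by (simp add: P_def ring_distribs flip: cis_mult)
  have shift: "emeasure lborel {t. t + c \<in> A} = emeasure lborel A" if "A \<in> sets borel" for c :: real and A
  proof -
    have "emeasure lborel A = emeasure (distr lborel borel ((+) c)) A" by (simp add: lborel_distr_plus)
    also have "\<dots> = emeasure lborel {t. t + c \<in> A}"
      using that by (subst emeasure_distr) (auto intro!: arg_cong[where f="emeasure lborel"] simp: add_ac)
    finally show ?thesis ..
  qed
  have "emeasure (distr circ borel ((*) \<alpha>)) E = emeasure circ {w. \<alpha> * w \<in> E}"
    by (subst emeasure_distr) (auto intro!: arg_cong[where f="emeasure circ"])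
  also have "\<dots> = emeasure lborel {t \<in> {0..<1}. P (t + s)}"
    unfolding P_def by (subst emeasure_circ) (auto simp: s cis_mult ring_distribs add_ac)
  also have "\<dots> = emeasure lborel {t. t + s \<in> {t \<in> {s..<1+s}. P t}}"
    by (intro arg_cong[where f="emeasure lborel"]) auto
  also have "\<dots> = emeasure lborel {t \<in> {s..<1+s}. P t}"
    by (rule shift) measurable
  also have "{t \<in> {s..<1+s}. P t} = {t \<in> {s..<1}. P t} \<union> {t \<in> {1..<1+s}. P t}"
    using s by auto
  also have "emeasure lborel \<dots> = emeasure lborel {t \<in> {s..<1}. P t} + emeasure lborel {t \<in> {1..<1+s}. P t}"
    by (rule plus_emeasure[symmetric]) (measurable, auto)
  also have "emeasure lborel {t \<in> {1..<1+s}. P t} = emeasure lborel {t. t + 1 \<in> {t \<in> {1..<1+s}. P t}}"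
    by (rule shift[symmetric]) measurable
  also have "{t. t + 1 \<in> {t \<in> {1..<1+s}. P t}} = {t \<in> {0..<s}. P t}"
    using P1 by auto
  also have "emeasure lborel {t \<in> {s..<1}. P t} + emeasure lborel {t \<in> {0..<s}. P t} =
      emeasure lborel ({t \<in> {s..<1}. P t} \<union> {t \<in> {0..<s}. P t})"
    by (rule plus_emeasure) (measurable, auto)
  also have "({t \<in> {s..<1}. P t} \<union> {t \<in> {0..<s}. P t}) = {t \<in> {0..<1}. P t}"
    using s by auto
  also have "emeasure lborel \<dots> = emeasure circ E" by (simp add: emeasure_circ P_def)
  finally show "emeasure (distr circ borel ((*) \<alpha>)) E = emeasure circ E" .
qed simp

lemma integral_circ_rotate:
  fixes f :: "complex \<Rightarrow> real"
  assumes "cmod \<alpha> = 1" "f \<in> borel_measurable borel"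
  shows "(\<integral>\<omega>. f (\<alpha> * \<omega>) \<partial>circ) = (\<integral>\<omega>. f \<omega> \<partial>circ)"
  using integral_distr[of "(*) \<alpha>" circ borel f] assms distr_circ_rotate[OF assms(1)] by simp

text \<open>Factoring out the larger of w and \<rho> leaves 1 - b \<omega> with
  \<open>cmod b < 1\<close>, whose logarithmic modulus has mean 0. On the excluded circle
  \<open>cmod w = \<rho>\<close> the integrand is singular; in every later use that circle is a
  Lebesgue null set.\<close>

lemma circ_jensen:
  assumes "cmod w \<noteq> \<rho>" "\<rho> \<ge> 0"
  shows "integrable circ (\<lambda>\<omega>. ln (cmod (w - of_real \<rho> * \<omega>)))"
    and "(\<integral>\<omega>. ln (cmod (w - of_real \<rho> * \<omega>)) \<partial>circ) = ln (max \<rho> (cmod w))"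
proof -
  have nz: "w \<noteq> of_real \<rho> * \<omega>" if "cmod \<omega> = 1" for \<omega>
    using assms that by (auto simp: norm_mult)
  have c: "continuous_on (sphere 0 1) (\<lambda>\<omega>. ln (cmod (w - of_real \<rho> * \<omega>)))"
    by (auto intro!: continuous_intros simp: nz)
  have m: "(\<lambda>\<omega>. ln (cmod (w - of_real \<rho> * \<omega>))) \<in> borel_measurable borel" by measurable
  show i: "integrable circ (\<lambda>\<omega>. ln (cmod (w - of_real \<rho> * \<omega>)))"
    by (rule integral_circ(1)[OF c m])
  \<comment> \<open>The argument of \<open>Ln\<close> stays in the right half-plane on the closed
    unit disk, so the mean value property applies; the value at the centre is
    \<open>Ln 1 = 0\<close>.\<close>
  have base: "integrable circ (\<lambda>\<omega>. ln (cmod (1 - b * \<omega>)))"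
             "(\<integral>\<omega>. ln (cmod (1 - b * \<omega>)) \<partial>circ) = 0" if "cmod b < 1" for b
  proof -
    have re: "Re (1 - b * \<omega>) > 0" if "cmod \<omega> \<le> 1" for \<omega>
    proof -
      have "Re (b * \<omega>) \<le> cmod b * cmod \<omega>" by (metis complex_Re_le_cmod norm_mult)
      also have "\<dots> \<le> cmod b * 1" using that by (intro mult_left_mono) auto
      finally show ?thesis using \<open>cmod b < 1\<close> by simp
    qed
    have nn: "1 - b * \<omega> \<noteq> 0" if "cmod \<omega> \<le> 1" for \<omega> using re[OF that] by (metis less_irrefl zero_complex.simps(1))
    have h: "(\<lambda>\<omega>. Ln (1 - b * \<omega>)) holomorphic_on cball 0 1"
      using re by (auto intro!: holomorphic_intros simp: complex_nonpos_Reals_iff) (force simp: not_less)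
    have m: "(\<lambda>\<omega>. Ln (1 - b * \<omega>)) \<in> borel_measurable borel" by measurable
    have I: "integrable circ (\<lambda>\<omega>. Ln (1 - b * \<omega>))" "(\<integral>\<omega>. Ln (1 - b * \<omega>) \<partial>circ) = 0"
      using circ_mean_value[OF h _ m] by auto
    have e: "AE \<omega> in circ. ln (cmod (1 - b * \<omega>)) = Re (Ln (1 - b * \<omega>))"
      using AE_circ_unit by eventually_elim (use nn in \<open>auto simp: Re_Ln\<close>)
    have "integrable circ (\<lambda>\<omega>. ln (cmod (1 - b * \<omega>))) \<longleftrightarrow> integrable circ (\<lambda>\<omega>. Re (Ln (1 - b * \<omega>)))"
      by (rule integrable_cong_AE) (use e in auto)
    then show "integrable circ (\<lambda>\<omega>. ln (cmod (1 - b * \<omega>)))" using I by auto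
    have "(\<integral>\<omega>. ln (cmod (1 - b * \<omega>)) \<partial>circ) = (\<integral>\<omega>. Re (Ln (1 - b * \<omega>)) \<partial>circ)"
      by (rule integral_cong_AE) (use e in auto)
    then show "(\<integral>\<omega>. ln (cmod (1 - b * \<omega>)) \<partial>circ) = 0"
      using I by (simp add: integral_Re)
  qed
  show "(\<integral>\<omega>. ln (cmod (w - of_real \<rho> * \<omega>)) \<partial>circ) = ln (max \<rho> (cmod w))"
  proof (cases "\<rho> < cmod w")
    case True
    then have w: "w \<noteq> 0" using assms by auto
    have b: "cmod (of_real \<rho> / w) < 1" using True assms w by (simp add: norm_divide)
    have "(\<integral>\<omega>. ln (cmod (w - of_real \<rho> * \<omega>)) \<partial>circ) = (\<integral>\<omega>. ln (cmod w) + ln (cmod (1 - of_real \<rho> / w * \<omega>)) \<partial>circ)"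
    proof (rule integral_cong_AE)
      show "AE \<omega> in circ. ln (cmod (w - of_real \<rho> * \<omega>)) = ln (cmod w) + ln (cmod (1 - of_real \<rho> / w * \<omega>))"
        using AE_circ_unit
      proof eventually_elim
        case (elim \<omega>)
        have "w - of_real \<rho> * \<omega> = w * (1 - of_real \<rho> / w * \<omega>)" using w by (simp add: field_simps)
        moreover have "1 - of_real \<rho> / w * \<omega> \<noteq> 0" using nz[OF elim] w by (auto simp: field_simps)
        ultimately show ?case using w by (simp only: norm_mult) (simp add: ln_mult)
      qed
    qed auto
    also have "\<dots> = ln (cmod w)" using base[OF b] by (simp add: circ.prob_space[simplified])
    finally show ?thesis using True by simp
  next
    case False
    then have r: "cmod w < \<rho>" "\<rho> > 0" using assms by (auto simp: less_le)
    \<comment> \<open>Reflection in the circle: for \<open>cmod \<omega> = 1\<close>, conjugating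
      and multiplying by \<omega> gives \<open>cmod (w - \<rho> * \<omega>) = cmod (cnj w * \<omega>
      - \<rho>)\<close>, which moves the zero out of the closed unit disk.\<close>
    have b: "cmod (cnj w / of_real \<rho>) < 1" using r by (simp add: norm_divide)
    have "(\<integral>\<omega>. ln (cmod (w - of_real \<rho> * \<omega>)) \<partial>circ) = (\<integral>\<omega>. ln \<rho> + ln (cmod (1 - cnj w / of_real \<rho> * \<omega>)) \<partial>circ)"
    proof (rule integral_cong_AE)
      show "AE \<omega> in circ. ln (cmod (w - of_real \<rho> * \<omega>)) = ln \<rho> + ln (cmod (1 - cnj w / of_real \<rho> * \<omega>))"
        using AE_circ_unit
      proof eventually_elim
        case (elim \<omega>)
        have o: "\<omega> * cnj \<omega> = 1" using elim by (simp add: complex_norm_square[symmetric])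
        have "cmod (w - of_real \<rho> * \<omega>) = cmod (cnj (w - of_real \<rho> * \<omega>)) * cmod \<omega>"
          using elim by (simp only: complex_mod_cnj mult_1_right)
        also have "\<dots> = cmod (cnj w * \<omega> - of_real \<rho> * (\<omega> * cnj \<omega>))"
          by (simp add: norm_mult[symmetric] algebra_simps)
        also have "\<dots> = cmod (- of_real \<rho> * (1 - cnj w / of_real \<rho> * \<omega>))"
        proof -
          have "cnj w * \<omega> - of_real \<rho> * (\<omega> * cnj \<omega>) = - of_real \<rho> * (1 - cnj w / of_real \<rho> * \<omega>)"
            unfolding o using r by (simp add: field_simps)
          then show ?thesis by simp
        qed
        also have "\<dots> = \<rho> * cmod (1 - cnj w / of_real \<rho> * \<omega>)"
          using r by (simp add: norm_mult)
        finally have e: "cmod (w - of_real \<rho> * \<omega>) = \<rho> * cmod (1 - cnj w / of_real \<rho> * \<omega>)" .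
        moreover have "1 - cnj w / of_real \<rho> * \<omega> \<noteq> 0" using e nz[OF elim] by auto
        ultimately show ?case using r by (simp add: ln_mult)
      qed
    qed auto
    also have "\<dots> = ln \<rho>" using base[OF b] by (simp add: circ.prob_space[simplified])
    finally show ?thesis using r by (simp add: max_def)
  qed
qed

section \<open>Circle averages and logarithmic potentials\<close>

lemma measurable_ball_mem [measurable (raw)]:
  fixes a :: complex
  assumes [measurable]: "f \<in> borel_measurable M"
  shows "Measurable.pred M (\<lambda>x. f x \<in> ball a r)"
  unfolding mem_ball by measurable

lemma integrable_indicator_balls:
  shows "integrable lborel (indicat_real (cball (a::complex) r))"
    and "integrable lborel (indicat_real (ball (a::complex) r))"
  using emeasure_bounded_finite[of "cball a r"] emeasure_bounded_finite[of "ball a r"]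
  by (auto simp: integrable_indicator_iff)

lemma lborel_shift:
  fixes f :: "complex \<Rightarrow> real"
  shows "integrable lborel f \<Longrightarrow> integrable lborel (\<lambda>z. f (c + z))"
    and "f \<in> borel_measurable borel \<Longrightarrow> (\<integral>z. f (c + z) \<partial>lborel) = (\<integral>z. f z \<partial>lborel)"
proof -
  have d: "distr lborel borel ((+) c) = (lborel :: complex measure)" by (rule lborel_distr_plus)
  show "integrable lborel (\<lambda>z. f (c + z))" if f: "integrable lborel f"
  proof -
    have "integrable (distr lborel borel ((+) c)) f" unfolding d by (rule f)
    then show ?thesis by (subst (asm) integrable_distr_eq) (use borel_measurable_integrable[OF f] in auto)
  qed
  show "(\<integral>z. f (c + z) \<partial>lborel) = (\<integral>z. f z \<partial>lborel)" if f: "f \<in> borel_measurable borel"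
    using integral_distr[of "(+) c" lborel borel f] f by (simp add: d)
qed

lemma AE_lborel_norm_neq: "AE z in lborel. cmod (z - a) \<noteq> \<rho>"
proof -
  have "sphere a \<rho> \<in> null_sets lborel"
    using negligible_sphere[of a \<rho>]
    by (auto simp: null_sets_completion_iff negligible_iff_null_sets negligible_convex_frontier)
  from AE_not_in[OF this] show ?thesis
    by eventually_elim (auto simp: dist_norm norm_minus_commute)
qed

text \<open>Layer-cake bound: inside the unit disk, \<open>- ln (cmod z)\<close> is at most the
  number of disks of radius \<open>exp (- k)\<close>, k = 0, 1, ..., that contain z, and their areas
  form a convergent geometric series. Outside the unit disk the logarithm is bounded by
  \<open>ln r\<close>.\<close>

lemma integrable_ln_norm_0: "integrable lborel (\<lambda>z. indicator (ball 0 r) z * ln (cmod z))"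
proof (cases "r > 0")
  case False
  then have "(\<lambda>z. indicator (ball (0::complex) r) z * ln (cmod z)) = (\<lambda>z. 0)"
    by (auto simp: fun_eq_iff indicator_def not_less intro: order_trans[OF _ norm_ge_zero])
  then show ?thesis by (simp only:) simp
next
  case True
  have b: "ennreal (norm (indicator (ball 0 r) z * ln (cmod z))) \<le>
     ennreal \<bar>ln r\<bar> * indicator (ball 0 r) z + (\<Sum>k. indicator (cball 0 (exp (- real k))) z)" for z :: complex
  proof (cases "z \<in> ball 0 r \<and> z \<noteq> 0")
    case False
    then show ?thesis by (auto split: split_indicator)
  next
    case T: True
    then have zr: "0 < cmod z" "cmod z < r" by auto
    show ?thesis
    proof (cases "cmod z \<ge> 1")
      case True
      then have "0 \<le> ln (cmod z)" "ln (cmod z) \<le> ln r" using zr by auto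
      then have "ennreal (norm (indicator (ball 0 r) z * ln (cmod z))) \<le> ennreal \<bar>ln r\<bar> * indicator (ball 0 r) z"
        using T by (auto intro!: ennreal_leI)
      then show ?thesis by (simp add: add_increasing2)
    next
      case False
      define y where "y = - ln (cmod z)"
      have y: "y \<ge> 0" using False zr by (simp add: y_def)
      define n where "n = nat \<lfloor>y\<rfloor> + 1"
      have n: "y \<le> real n" unfolding n_def using y by linarith
      have i: "indicator (cball 0 (exp (- real k))) z = (1::ennreal)" if "k < n" for k
      proof -
        have "real k \<le> y" using that y unfolding n_def by linarith
        then have "cmod z \<le> exp (- real k)" using zr by (simp add: y_def ln_ge_iff[symmetric] ln_le_cancel_iff[symmetric] del: ln_le_cancel_iff)
        then show ?thesis by simp
      qed
      have "ennreal (norm (indicator (ball 0 r) z * ln (cmod z))) = ennreal y"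
        using T y by (simp add: y_def)
      also have "\<dots> \<le> ennreal (real n)" using n by (rule ennreal_leI)
      also have "\<dots> = (\<Sum>k<n. indicator (cball 0 (exp (- real k))) z)"
        using i by (simp add: ennreal_of_nat_eq_real_of_nat)
      also have "\<dots> \<le> (\<Sum>k. indicator (cball 0 (exp (- real k))) z)"
        by (rule sum_le_suminf) auto
      finally show ?thesis by (simp add: add_increasing)
    qed
  qed
  show ?thesis
  proof (rule integrableI_bounded)
    have "(\<integral>\<^sup>+z. ennreal (norm (indicator (ball 0 r) z * ln (cmod z))) \<partial>lborel) \<le>
      (\<integral>\<^sup>+z. ennreal \<bar>ln r\<bar> * indicator (ball 0 r) z + (\<Sum>k. indicator (cball (0::complex) (exp (- real k))) z) \<partial>lborel)"
      by (intro nn_integral_mono b)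
    also have "\<dots> = ennreal \<bar>ln r\<bar> * emeasure lborel (ball (0::complex) r) + (\<Sum>k. emeasure lborel (cball (0::complex) (exp (- real k))))"
    proof -
      have [measurable]: "cball (0::complex) r \<in> sets borel" for r by simp
      have [measurable]: "ball (0::complex) r \<in> sets borel" for r by simp
      show ?thesis
        by (subst nn_integral_add; measurable?) (simp add: nn_integral_cmult_indicator nn_integral_suminf)
    qed
    also have "\<dots> < \<infinity>"
    proof -
      have "(\<Sum>k. emeasure lborel (cball (0::complex) (exp (- real k)))) = (\<Sum>k. ennreal (pi * (exp (-2)) ^ k))"
        by (intro suminf_cong) (simp add: emeasure_cball unit_ball_vol_2 exp_double[symmetric] exp_of_nat_mult[symmetric] power2_eq_square exp_add[symmetric] mult_ac)
      also have "\<dots> = ennreal (\<Sum>k. pi * (exp (-2)) ^ k)"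
        by (rule suminf_ennreal2) (auto intro!: summable_mult summable_geometric)
      finally have "(\<Sum>k. emeasure lborel (cball (0::complex) (exp (- real k)))) < \<infinity>" by simp
      moreover have "emeasure lborel (ball (0::complex) r) < \<infinity>" using emeasure_bounded_finite[of "ball (0::complex) r"] by simp
      ultimately show ?thesis by (simp add: ennreal_mult_less_top)
    qed
    finally show "(\<integral>\<^sup>+z. ennreal (norm (indicator (ball 0 r) z * ln (cmod z))) \<partial>lborel) < \<infinity>" .
  qed measurable
qed

text \<open>Translate the singularity to 0 and enlarge the disk by s. The bound depends on a only
  through s, which is the uniformity that \<open>Fubini_bounded_sections\<close> asks for.\<close>

lemma integrable_ln_norm: "integrable lborel (\<lambda>z. indicator (ball 0 r) z * ln (cmod (z - a)))"
  and integral_ln_norm_le: "cmod a \<le> s \<Longrightarrow>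
    (\<integral>z. \<bar>indicator (ball 0 r) z * ln (cmod (z - a))\<bar> \<partial>lborel) \<le> (\<integral>z. \<bar>indicator (ball 0 (r + s)) z * ln (cmod z)\<bar> \<partial>lborel)"
proof -
  have *: "integrable lborel (\<lambda>z. indicator (ball 0 r) z * ln (cmod (z - a))) \<and>
    (\<integral>z. \<bar>indicator (ball 0 r) z * ln (cmod (z - a))\<bar> \<partial>lborel) \<le> (\<integral>z. \<bar>indicator (ball 0 (r + s)) z * ln (cmod z)\<bar> \<partial>lborel)"
    if s: "cmod a \<le> s" for s
  proof -
    let ?f = "\<lambda>z. indicator (ball 0 (r + s)) z * ln (cmod z)"
    have le: "\<bar>indicator (ball 0 r) z * ln (cmod (z - a))\<bar> \<le> \<bar>?f (-a + z)\<bar>" for z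
    proof (cases "z \<in> ball 0 r")
      case True
      then have "-a + z \<in> ball 0 (r + s)" using s norm_triangle_ineq4[of z a] by auto
      then show ?thesis using True by (simp add: algebra_simps)
    qed simp
    have i: "integrable lborel (\<lambda>z. \<bar>?f (-a + z)\<bar>)"
      by (intro integrable_abs lborel_shift integrable_ln_norm_0)
    have i2: "integrable lborel (\<lambda>z. indicator (ball 0 r) z * ln (cmod (z - a)))"
    proof (rule Bochner_Integration.integrable_bound[OF i])
      show "AE z in lborel. norm (indicator (ball 0 r) z * ln (cmod (z - a))) \<le> norm \<bar>?f (-a + z)\<bar>"
        unfolding real_norm_def abs_idempotent by (rule AE_I2) (rule le)
    qed measurable
    have "(\<integral>z. \<bar>indicator (ball 0 r) z * ln (cmod (z - a))\<bar> \<partial>lborel) \<le> (\<integral>z. \<bar>?f (-a + z)\<bar> \<partial>lborel)"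
      by (rule integral_mono[OF integrable_abs[OF i2] i]) (rule le)
    also have "\<dots> = (\<integral>z. \<bar>?f z\<bar> \<partial>lborel)"
      by (rule lborel_shift(2)[where f="\<lambda>z. \<bar>?f z\<bar>"]) measurable
    finally show ?thesis using i2 by simp
  qed
  show "integrable lborel (\<lambda>z. indicator (ball 0 r) z * ln (cmod (z - a)))" using *[of "cmod a"] by simp
  show "cmod a \<le> s \<Longrightarrow>
    (\<integral>z. \<bar>indicator (ball 0 r) z * ln (cmod (z - a))\<bar> \<partial>lborel) \<le> (\<integral>z. \<bar>indicator (ball 0 (r + s)) z * ln (cmod z)\<bar> \<partial>lborel)"
    using * by blast
qed

text \<open>Over a finite measure, uniformly bounded L1 norms of the sections already give
  integrability on the product, so no joint majorant has to be found.\<close>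

lemma Fubini_bounded_sections:
  fixes f :: "complex \<times> complex \<Rightarrow> real"
  assumes N: "finite_measure N"
    and m[measurable]: "f \<in> borel_measurable (N \<Otimes>\<^sub>M lborel)"
    and i: "AE \<omega> in N. integrable lborel (\<lambda>z. f (\<omega>, z))"
    and b: "AE \<omega> in N. (\<integral>z. \<bar>f (\<omega>, z)\<bar> \<partial>lborel) \<le> B"
  shows "integrable lborel (\<lambda>z. \<integral>\<omega>. f (\<omega>, z) \<partial>N)"
    and "integrable N (\<lambda>\<omega>. \<integral>z. f (\<omega>, z) \<partial>lborel)"
    and "(\<integral>z. (\<integral>\<omega>. f (\<omega>, z) \<partial>N) \<partial>lborel) = (\<integral>\<omega>. (\<integral>z. f (\<omega>, z) \<partial>lborel) \<partial>N)"
proof -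
  interpret N: finite_measure N by fact
  interpret pair_sigma_finite N "lborel :: complex measure"
    by (intro pair_sigma_finite.intro N.sigma_finite_measure_axioms lborel.sigma_finite_measure_axioms)
  have I: "integrable (N \<Otimes>\<^sub>M lborel) f"
  proof (rule Fubini_integrable[OF m])
    show "integrable N (\<lambda>x. \<integral>y. norm (f (x, y)) \<partial>lborel)"
      by (rule N.integrable_const_bound[where B=B]) (use b in \<open>auto simp: integral_nonneg_AE\<close>)
  qed fact
  then have I': "integrable (N \<Otimes>\<^sub>M lborel) (case_prod (\<lambda>x y. f (x, y)))" by simp
  show "integrable lborel (\<lambda>z. \<integral>\<omega>. f (\<omega>, z) \<partial>N)" using integrable_snd[OF I'] by simp
  show "integrable N (\<lambda>\<omega>. \<integral>z. f (\<omega>, z) \<partial>lborel)" using integrable_fst[OF I'] by simp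
  show "(\<integral>z. (\<integral>\<omega>. f (\<omega>, z) \<partial>N) \<partial>lborel) = (\<integral>\<omega>. (\<integral>z. f (\<omega>, z) \<partial>lborel) \<partial>N)"
    using Fubini_integral[OF I'] by simp
qed

section \<open>Averages over circles\<close>

definition circ_avg :: "real \<Rightarrow> (complex \<Rightarrow> real) \<Rightarrow> complex \<Rightarrow> real" where
  "circ_avg \<rho> \<psi> z = (\<integral>\<omega>. \<psi> (z + of_real \<rho> * \<omega>) \<partial>circ)"

lemma circ_avg_measurable [measurable]:
  assumes [measurable]: "\<psi> \<in> borel_measurable borel"
  shows "circ_avg \<rho> \<psi> \<in> borel_measurable borel"
  unfolding circ_avg_def
  by (rule circ.borel_measurable_lebesgue_integral) measurable

lemma circ_avg_bound:
  assumes [measurable]: "\<psi> \<in> borel_measurable borel" and b: "\<And>z. \<bar>\<psi> z\<bar> \<le> B"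
  shows "\<bar>circ_avg \<rho> \<psi> z\<bar> \<le> B"
proof -
  have i: "integrable circ (\<lambda>\<omega>. \<psi> (z + of_real \<rho> * \<omega>))"
    by (rule circ.integrable_const_bound[where B=B]) (use b in auto)
  have "\<bar>circ_avg \<rho> \<psi> z\<bar> \<le> (\<integral>\<omega>. \<bar>\<psi> (z + of_real \<rho> * \<omega>)\<bar> \<partial>circ)"
    unfolding circ_avg_def by (rule integral_abs_bound)
  also have "\<dots> \<le> (\<integral>\<omega>. B \<partial>circ)"
    by (rule integral_mono) (use b i in auto)
  finally have "\<bar>circ_avg \<rho> \<psi> z\<bar> \<le> (\<integral>\<omega>. B \<partial>circ)" .
  then show ?thesis using circ.prob_space by simp
qed

lemma circ_avg_eq_0:
  assumes "\<And>z. cmod z > r \<Longrightarrow> \<psi> z = 0" "cmod z > r + \<rho>" "\<rho> \<ge> 0"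
  shows "circ_avg \<rho> \<psi> z = 0"
proof -
  have "AE \<omega> in circ. \<psi> (z + of_real \<rho> * \<omega>) = 0"
    using AE_circ_unit
  proof eventually_elim
    case (elim \<omega>)
    have "cmod z \<le> cmod (z + of_real \<rho> * \<omega>) + cmod (of_real \<rho> * \<omega>)"
      using norm_triangle_ineq4[of "z + of_real \<rho> * \<omega>" "of_real \<rho> * \<omega>"] by simp
    then show ?case using elim assms by (intro assms(1)) (auto simp: norm_mult)
  qed
  then show ?thesis unfolding circ_avg_def by (rule integral_eq_zero_AE)
qed

text \<open>Averaging over circles is self-adjoint: for each fixed \<omega> translate by
  \<open>\<rho> * \<omega>\<close>, then integrate over \<omega>.\<close>

lemma integral_circ_avg:
  assumes v: "integrable lborel v" and \<psi>m[measurable]: "\<psi> \<in> borel_measurable borel" and b: "\<And>z. \<bar>\<psi> z\<bar> \<le> B"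
  shows "integrable lborel (\<lambda>z. v z * circ_avg \<rho> \<psi> z)"
    and "integrable lborel (\<lambda>w. \<psi> w * (\<integral>\<omega>. v (w - of_real \<rho> * \<omega>) \<partial>circ))"
    and "(\<integral>z. v z * circ_avg \<rho> \<psi> z \<partial>lborel) = (\<integral>w. \<psi> w * (\<integral>\<omega>. v (w - of_real \<rho> * \<omega>) \<partial>circ) \<partial>lborel)"
proof -
  have [measurable]: "v \<in> borel_measurable borel" using borel_measurable_integrable[OF v] by simp
  have B: "B \<ge> 0" using b[of 0] by linarith
  let ?f = "\<lambda>(\<omega>, z). v z * \<psi> (z + of_real \<rho> * \<omega>)"
  let ?g = "\<lambda>(\<omega>, z). \<psi> z * v (z - of_real \<rho> * \<omega>)"
  have fm: "?f \<in> borel_measurable (circ \<Otimes>\<^sub>M lborel)" by measurable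
  have gm: "?g \<in> borel_measurable (circ \<Otimes>\<^sub>M lborel)" by measurable
  have fi: "integrable lborel (\<lambda>z. v z * \<psi> (z + c))" for c
    by (rule Bochner_Integration.integrable_bound[OF integrable_mult_right[OF v, of B]])
      (use b B in \<open>auto simp: abs_mult mult.commute[of B] intro!: AE_I2 mult_left_mono\<close>)
  have fb: "(\<integral>z. \<bar>v z * \<psi> (z + c)\<bar> \<partial>lborel) \<le> B * (\<integral>z. \<bar>v z\<bar> \<partial>lborel)" for c
  proof -
    have "(\<integral>z. \<bar>v z * \<psi> (z + c)\<bar> \<partial>lborel) \<le> (\<integral>z. B * \<bar>v z\<bar> \<partial>lborel)"
    proof (rule integral_mono)
      show "\<bar>v z * \<psi> (z + c)\<bar> \<le> B * \<bar>v z\<bar>" for z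
        using mult_left_mono[OF b[of "z + c"], of "\<bar>v z\<bar>"] by (simp add: abs_mult mult.commute)
    qed (use fi v in auto)
    then show ?thesis by simp
  qed
  have eq: "(\<lambda>z. \<psi> z * v (z - c)) = (\<lambda>z. (\<lambda>z. v z * \<psi> (z + c)) (- c + z))" for c
    by (auto simp: fun_eq_iff)
  have gi: "integrable lborel (\<lambda>z. \<psi> z * v (z - c))" for c
    unfolding eq by (rule lborel_shift(1)) (rule fi)
  have gb: "(\<integral>z. \<bar>\<psi> z * v (z - c)\<bar> \<partial>lborel) \<le> B * (\<integral>z. \<bar>v z\<bar> \<partial>lborel)" for c
  proof -
    have "(\<integral>z. \<bar>\<psi> z * v (z - c)\<bar> \<partial>lborel) = (\<integral>z. (\<lambda>z. \<bar>v z * \<psi> (z + c)\<bar>) (- c + z) \<partial>lborel)"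
      by (simp add: mult.commute)
    also have "\<dots> = (\<integral>z. \<bar>v z * \<psi> (z + c)\<bar> \<partial>lborel)"
      by (rule lborel_shift(2)) measurable
    finally show ?thesis using fb by simp
  qed
  have gf: "(\<integral>z. \<psi> z * v (z - c) \<partial>lborel) = (\<integral>z. v z * \<psi> (z + c) \<partial>lborel)" for c
    unfolding eq by (rule lborel_shift(2)) measurable
  note F = Fubini_bounded_sections[OF circ.finite_measure_axioms fm, where B="B * (\<integral>z. \<bar>v z\<bar> \<partial>lborel)"]
  note G = Fubini_bounded_sections[OF circ.finite_measure_axioms gm, where B="B * (\<integral>z. \<bar>v z\<bar> \<partial>lborel)"]
  show "integrable lborel (\<lambda>z. v z * circ_avg \<rho> \<psi> z)"
    using F(1) fi fb by (simp add: circ_avg_def)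
  show "integrable lborel (\<lambda>w. \<psi> w * (\<integral>\<omega>. v (w - of_real \<rho> * \<omega>) \<partial>circ))"
    using G(1) gi gb by simp
  show "(\<integral>z. v z * circ_avg \<rho> \<psi> z \<partial>lborel) = (\<integral>w. \<psi> w * (\<integral>\<omega>. v (w - of_real \<rho> * \<omega>) \<partial>circ) \<partial>lborel)"
    using F(3) G(3) fi fb gi gb by (simp add: circ_avg_def gf)
qed

section \<open>The circle Laplacian of a test function\<close>

locale test_function =
  fixes \<psi> :: "complex \<Rightarrow> real" and r B :: real
  assumes cont: "continuous_on UNIV \<psi>"
    and supp: "\<And>z. cmod z > r \<Longrightarrow> \<psi> z = 0"
    and bound: "\<And>z. \<bar>\<psi> z\<bar> \<le> B"
begin

lemma meas [measurable]: "\<psi> \<in> borel_measurable borel"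
  using cont by (rule borel_measurable_continuous_onI)

text \<open>\<open>lap\<close> replaces the Laplacian of \<open>\<psi>\<close>; \<open>pot\<close> is \<open>\<psi>\<close> convolved with the nonnegative kernel
  supported on the disk of radius \<open>\<rho>\<close> that Jensen's formula produces.\<close>

definition lap :: "real \<Rightarrow> complex \<Rightarrow> real" where
  "lap \<rho> z = circ_avg \<rho> \<psi> z - \<psi> z"

definition pot :: "real \<Rightarrow> complex \<Rightarrow> real" where
  "pot \<rho> a = (\<integral>z. \<psi> z * (ln (max \<rho> (cmod (z - a))) - ln (cmod (z - a))) \<partial>lborel)"

lemma lap_measurable [measurable]: "lap \<rho> \<in> borel_measurable borel"
  unfolding lap_def by measurable

lemma lap_bound: "\<bar>lap \<rho> z\<bar> \<le> 2 * B"
  using circ_avg_bound[OF meas bound, of \<rho> z] bound[of z] unfolding lap_def by linarith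

lemma lap_eq_0: "\<rho> \<ge> 0 \<Longrightarrow> cmod z > r + \<rho> \<Longrightarrow> lap \<rho> z = 0"
  using circ_avg_eq_0[OF supp] supp unfolding lap_def by simp

text \<open>Self-adjointness for v cut off to a disk, as v need not be integrable on the plane.
  Since \<open>lap \<rho>\<close> vanishes beyond r + \<rho> < R, the left-hand side does not see
  the cut-off.\<close>

lemma integral_lap:
  assumes v: "integrable lborel (\<lambda>z. indicator (ball 0 R) z * v z)" and R: "r + \<rho> < R" "\<rho> \<ge> 0"
  shows "integrable lborel (\<lambda>z. lap \<rho> z * v z)"
    and "integrable lborel (\<lambda>z. \<psi> z * ((\<integral>\<omega>. indicator (ball 0 R) (z - of_real \<rho> * \<omega>) * v (z - of_real \<rho> * \<omega>) \<partial>circ) - v z))"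
    and "(\<integral>z. lap \<rho> z * v z \<partial>lborel) =
      (\<integral>z. \<psi> z * ((\<integral>\<omega>. indicator (ball 0 R) (z - of_real \<rho> * \<omega>) * v (z - of_real \<rho> * \<omega>) \<partial>circ) - v z) \<partial>lborel)"
proof -
  let ?v = "\<lambda>z. indicator (ball 0 R) z * v z"
  have [measurable]: "?v \<in> borel_measurable borel" using borel_measurable_integrable[OF v] by simp
  have e1: "lap \<rho> z * v z = ?v z * circ_avg \<rho> \<psi> z - ?v z * \<psi> z" for z
  proof (cases "z \<in> ball 0 R")
    case False
    then show ?thesis using lap_eq_0[of \<rho> z] R by auto
  qed (auto simp: lap_def algebra_simps)
  have e2: "\<psi> z * (i - v z) = \<psi> z * i - ?v z * \<psi> z" for z i
  proof (cases "z \<in> ball 0 R")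
    case False
    then show ?thesis using supp[of z] R by auto
  qed (auto simp: algebra_simps)
  have i: "integrable lborel (\<lambda>z. ?v z * \<psi> z)"
  proof (rule Bochner_Integration.integrable_bound[OF integrable_mult_right[OF v, of B]])
    show "AE x in lborel. norm (?v x * \<psi> x) \<le> norm (B * ?v x)"
    proof (rule AE_I2)
      fix x
      have "\<bar>\<psi> x\<bar> \<le> \<bar>B\<bar>" using bound[of x] by linarith
      then have "\<bar>?v x\<bar> * \<bar>\<psi> x\<bar> \<le> \<bar>?v x\<bar> * \<bar>B\<bar>" by (rule mult_left_mono) simp
      then show "norm (?v x * \<psi> x) \<le> norm (B * ?v x)" by (simp add: abs_mult mult_ac)
    qed
  qed measurable
  note C = integral_circ_avg[OF v meas bound, of \<rho>]
  show "integrable lborel (\<lambda>z. lap \<rho> z * v z)"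
    unfolding e1 by (intro Bochner_Integration.integrable_diff C i)
  show "integrable lborel (\<lambda>z. \<psi> z * ((\<integral>\<omega>. indicator (ball 0 R) (z - of_real \<rho> * \<omega>) * v (z - of_real \<rho> * \<omega>) \<partial>circ) - v z))"
    unfolding e2 by (intro Bochner_Integration.integrable_diff C i)
  show "(\<integral>z. lap \<rho> z * v z \<partial>lborel) =
      (\<integral>z. \<psi> z * ((\<integral>\<omega>. indicator (ball 0 R) (z - of_real \<rho> * \<omega>) * v (z - of_real \<rho> * \<omega>) \<partial>circ) - v z) \<partial>lborel)"
    unfolding e1 e2 using C i by simp
qed

lemma circ_in_ball:
  assumes "cmod \<omega> = 1" "cmod z \<le> r" "r + \<rho> < R" "\<rho> \<ge> 0"
  shows "z - of_real \<rho> * \<omega> \<in> ball 0 R"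
  using norm_triangle_ineq4[of z "of_real \<rho> * \<omega>"] assms by (auto simp: norm_mult)

text \<open>The inner circle mean is evaluated by Jensen's formula for almost every z, namely off
  the circle of radius \<rho> about a. This is the counterpart of the logarithm having a point mass
  as its Laplacian, with the mass spread over a disk of radius \<rho>.\<close>

lemma integral_lap_ln:
  assumes "\<rho> > 0"
  shows "integrable lborel (\<lambda>z. lap \<rho> z * ln (cmod (z - a)))"
    and "integrable lborel (\<lambda>z. \<psi> z * (ln (max \<rho> (cmod (z - a))) - ln (cmod (z - a))))"
    and "(\<integral>z. lap \<rho> z * ln (cmod (z - a)) \<partial>lborel) = pot \<rho> a"
proof -
  let ?R = "r + \<rho> + 1"
  note L = integral_lap[OF integrable_ln_norm[of ?R a], of \<rho>]
  have ae: "AE z in lborel. \<psi> z * ((\<integral>\<omega>. indicator (ball 0 ?R) (z - of_real \<rho> * \<omega>) * ln (cmod (z - of_real \<rho> * \<omega> - a)) \<partial>circ) - ln (cmod (z - a)))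
     = \<psi> z * (ln (max \<rho> (cmod (z - a))) - ln (cmod (z - a)))"
    using AE_lborel_norm_neq[of a \<rho>]
  proof eventually_elim
    case (elim z)
    show ?case
    proof (cases "cmod z \<le> r")
      case True
      have "(\<integral>\<omega>. indicator (ball 0 ?R) (z - of_real \<rho> * \<omega>) * ln (cmod (z - of_real \<rho> * \<omega> - a)) \<partial>circ)
        = (\<integral>\<omega>. ln (cmod ((z - a) - of_real \<rho> * \<omega>)) \<partial>circ)"
      proof (rule integral_cong_AE)
        show "AE \<omega> in circ. indicator (ball 0 ?R) (z - of_real \<rho> * \<omega>) * ln (cmod (z - of_real \<rho> * \<omega> - a)) = ln (cmod ((z - a) - of_real \<rho> * \<omega>))"
          using AE_circ_unit
        proof eventually_elim
          case (elim \<omega>)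
          then show ?case using circ_in_ball[OF elim True, of \<rho> ?R] assms by (simp add: algebra_simps)
        qed
      qed measurable
      also have "\<dots> = ln (max \<rho> (cmod (z - a)))" using circ_jensen(2)[OF elim] assms by simp
      finally show ?thesis by simp
    qed (simp add: supp)
  qed
  show "integrable lborel (\<lambda>z. lap \<rho> z * ln (cmod (z - a)))" using L(1) assms by simp
  show "integrable lborel (\<lambda>z. \<psi> z * (ln (max \<rho> (cmod (z - a))) - ln (cmod (z - a))))"
  proof (rule integrable_cong_AE_imp)
    show "integrable lborel (\<lambda>z. \<psi> z * ((\<integral>\<omega>. indicator (ball 0 ?R) (z - of_real \<rho> * \<omega>) * ln (cmod (z - of_real \<rho> * \<omega> - a)) \<partial>circ) - ln (cmod (z - a))))"
      by (rule L(2)) (use assms in auto)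
  qed (measurable, rule ae)
  show "(\<integral>z. lap \<rho> z * ln (cmod (z - a)) \<partial>lborel) = pot \<rho> a"
    unfolding pot_def using assms by (subst L(3)) (auto intro!: integral_cong_AE ae)
qed

text \<open>Real parts of holomorphic functions equal their circle averages, so they are invisible
  to \<open>lap\<close>. This disposes of the zero-free factor of a holomorphic function.\<close>

lemma integral_lap_harmonic:
  assumes L: "L holomorphic_on ball 0 R" and \<rho>: "\<rho> > 0" "r + \<rho> < R"
  shows "integrable lborel (\<lambda>z. lap \<rho> z * Re (L z))"
    and "(\<integral>z. lap \<rho> z * Re (L z) \<partial>lborel) = 0"
proof -
  \<comment> \<open>L may be unbounded near the boundary of its disk; on the closed disk of radius
    R' it is bounded, hence integrable.\<close>
  define R' where "R' = (r + \<rho> + R) / 2"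
  have R': "r + \<rho> < R'" "R' < R" using \<rho> by (auto simp: R'_def)
  define F where "F z = (if z \<in> ball 0 R' then L z else 0)" for z
  have Lc: "continuous_on (ball 0 R) L" by (rule holomorphic_on_imp_continuous_on[OF L])
  have Fm[measurable]: "F \<in> borel_measurable borel"
    unfolding F_def
    by (rule borel_measurable_continuous_on_if)
       (use R' in \<open>auto intro!: continuous_on_subset[OF Lc] continuous_intros\<close>)
  have Fh: "F holomorphic_on ball 0 R'"
    by (rule holomorphic_transform[where f=L]) (use R' L in \<open>auto intro: holomorphic_on_subset simp: F_def\<close>)
  have bd: "bounded (L ` cball 0 R')"
    by (rule compact_imp_bounded[OF compact_continuous_image]) (use R' in \<open>auto intro!: continuous_on_subset[OF Lc]\<close>)
  then obtain C where "\<forall>y\<in>L ` cball 0 R'. cmod y \<le> C" unfolding bounded_iff by blast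
  then have C: "\<And>z. z \<in> cball 0 R' \<Longrightarrow> cmod (L z) \<le> C" by blast
  have eq: "indicator (ball 0 R') z * Re (L z) = Re (F z)" for z
    by (auto simp: F_def)
  have v: "integrable lborel (\<lambda>z. indicator (ball 0 R') z * Re (L z))"
    unfolding eq
  proof (rule Bochner_Integration.integrable_bound[where f="\<lambda>z. C * indicator (cball 0 R') z"])
    show "integrable lborel (\<lambda>z. C * indicator (cball (0::complex) R') z)"
      by (intro integrable_mult_right integrable_indicator_balls)
    show "AE x in lborel. norm (Re (F x)) \<le> norm (C * indicator (cball 0 R') x)"
    proof (rule AE_I2)
      fix x show "norm (Re (F x)) \<le> norm (C * indicator (cball 0 R') x)"
        using C[of x] abs_Re_le_cmod[of "L x"] by (auto simp: F_def)
    qed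
  qed measurable
  note I = integral_lap[OF v R'(1)]
  show "integrable lborel (\<lambda>z. lap \<rho> z * Re (L z))" using I(1) \<rho> by simp
  have z: "\<psi> z * ((\<integral>\<omega>. indicator (ball 0 R') (z - of_real \<rho> * \<omega>) * Re (L (z - of_real \<rho> * \<omega>)) \<partial>circ) - Re (L z)) = 0" for z
  proof (cases "cmod z \<le> r")
    case True
    \<comment> \<open>Self-adjointness produces a minus sign, the mean value property a plus sign;
      rotation by -1 reconciles them.\<close>
    have m: "z + of_real \<rho> * ((-1) * \<omega>) = z - of_real \<rho> * \<omega>" for \<omega> by simp
    have sub: "cball z \<rho> \<subseteq> ball 0 R'"
    proof
      fix x assume "x \<in> cball z \<rho>"
      then show "x \<in> ball 0 R'"
        using True R' norm_triangle_ineq2[of x z] by (auto simp: dist_norm norm_minus_commute)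
    qed
    have M: "(\<integral>\<omega>. F (z + of_real \<rho> * \<omega>) \<partial>circ) = F z" "integrable circ (\<lambda>\<omega>. F (z + of_real \<rho> * \<omega>))"
      using circ_mean_value[OF holomorphic_on_subset[OF Fh sub] \<rho>(1) Fm] by auto
    have "(\<integral>\<omega>. indicator (ball 0 R') (z - of_real \<rho> * \<omega>) * Re (L (z - of_real \<rho> * \<omega>)) \<partial>circ)
       = (\<integral>\<omega>. Re (F (z + of_real \<rho> * ((-1) * \<omega>))) \<partial>circ)"
      unfolding eq m ..
    also have "\<dots> = (\<integral>\<omega>. Re (F (z + of_real \<rho> * \<omega>)) \<partial>circ)"
      by (rule integral_circ_rotate[where f="\<lambda>\<omega>. Re (F (z + of_real \<rho> * \<omega>))"]) auto
    also have "\<dots> = Re (F z)" using M by (simp add: integral_Re)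
    also have "\<dots> = Re (L z)" using True R' \<rho> by (simp add: F_def)
    finally show ?thesis by simp
  qed (simp add: supp)
  show "(\<integral>z. lap \<rho> z * Re (L z) \<partial>lborel) = 0"
    using I(3) \<rho> by (simp add: z)
qed

end

section \<open>Mean values over disks and zeros of holomorphic functions\<close>

lemma lborel_real2_rotate:
  fixes f :: "real^2 \<Rightarrow> real^2"
  assumes f: "orthogonal_transformation f"
  shows "distr lborel borel f = lborel"
proof -
  obtain g where g: "orthogonal_transformation g" "g \<circ> f = id" "f \<circ> g = id"
    using f orthogonal_transformation_bij orthogonal_transformation_inv
    by (metis bij_def inv_o_cancel surj_iff)
  have [measurable]: "f \<in> borel_measurable borel"
    using f by (intro borel_measurable_continuous_onI linear_continuous_on)
      (auto simp: orthogonal_transformation_linear linear_conv_bounded_linear[symmetric])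
  show ?thesis
  proof (rule lborel_eqI[symmetric])
    fix l u :: "real^2" assume lu: "\<And>b. b \<in> Basis \<Longrightarrow> l \<bullet> b \<le> u \<bullet> b"
    have e: "f -` box l u = g ` box l u"
    proof (intro equalityI subsetI)
      fix x assume "x \<in> f -` box l u"
      then have "f x \<in> box l u" "x = g (f x)" using fun_cong[OF g(2), of x] by auto
      then show "x \<in> g ` box l u" by (rule image_eqI[rotated])
    qed (use fun_cong[OF g(3)] in auto)
    have v: "f -` box l u \<in> sets borel"
      using measurable_sets_borel[OF \<open>f \<in> borel_measurable borel\<close>, of "box l u"] by simp
    have m: "g ` box l u \<in> lmeasurable" "measure lebesgue (g ` box l u) = measure lebesgue (box l u)"
      using measurable_orthogonal_image[OF g(1)] measure_orthogonal_image[OF g(1)] by auto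
    have "emeasure (distr lborel borel f) (box l u) = emeasure lborel (f -` box l u)"
      by (subst emeasure_distr) auto
    also have "\<dots> = emeasure lebesgue (f -` box l u)" using v by simp
    also have "\<dots> = ennreal (measure lebesgue (g ` box l u))"
      unfolding e by (rule emeasure_eq_measure2[OF m(1)])
    also have "\<dots> = ennreal (measure lebesgue (box l u))" by (simp only: m)
    also have "\<dots> = emeasure lborel (box l u)"
      using lu by (simp add: measure_lborel_box_eq emeasure_lborel_box_eq)
    also have "\<dots> = (\<Prod>b\<in>Basis. (u - l) \<bullet> b)"
      using lu by (rule emeasure_lborel_box)
    finally show "emeasure (distr lborel borel f) (box l u) = (\<Prod>b\<in>Basis. (u - l) \<bullet> b)" .
  qed simp
qed

text \<open>Carried over to \<open>real^2\<close> along the coordinate isometry, which matches boxes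
  with boxes, multiplication by \<alpha> is an orthogonal map.\<close>

lemma lborel_complex_rotate:
  assumes "cmod \<alpha> = 1"
  shows "distr lborel borel ((*) \<alpha>) = (lborel :: complex measure)"
proof -
  define iso where "iso x = Complex (x $ 1) (x $ 2)" for x :: "real^2"
  define iso' where "iso' z = (vector [Re z, Im z] :: real^2)" for z
  have ii: "iso (iso' z) = z" "iso' (iso x) = x" for z x
    by (auto simp: iso_def iso'_def vec_eq_iff forall_2 complex_eq_iff)
  have iso_lin: "linear iso" by (rule linearI) (auto simp: iso_def complex_eq_iff)
  have iso'_lin: "linear iso'" by (rule linearI) (auto simp: iso'_def vec_eq_iff forall_2)
  have nrm: "cmod (iso x) = norm x" for x
    by (simp add: iso_def cmod_def norm_vec_def L2_set_def sum_2)
  have [measurable]: "iso \<in> borel_measurable borel"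
    using iso_lin by (intro borel_measurable_continuous_onI linear_continuous_on) (auto simp: linear_conv_bounded_linear)
  have iso: "distr lborel borel iso = lborel"
  proof (rule lborel_eqI[symmetric])
    fix l u :: complex assume lu: "\<And>b. b \<in> Basis \<Longrightarrow> l \<bullet> b \<le> u \<bullet> b"
    have "iso -` box l u = box (iso' l) (iso' u)"
      by (auto simp: iso_def iso'_def mem_box_cart forall_2 in_box_complex_iff)
    then have "emeasure (distr lborel borel iso) (box l u) = emeasure lborel (box (iso' l) (iso' u))"
      by (subst emeasure_distr) auto
    also have "\<dots> = (\<Prod>b\<in>Basis. (iso' u - iso' l) \<bullet> b)"
    proof (rule emeasure_lborel_box)
      fix b :: "real^2" assume "b \<in> Basis"
      then obtain i where i: "b = axis i 1" by (auto simp: Basis_vec_def)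
      consider "i = 1" | "i = 2" using exhaust_2 by blast
      then show "iso' l \<bullet> b \<le> iso' u \<bullet> b"
        using lu[of 1] lu[of \<i>] by cases (auto simp: i iso'_def inner_axis Basis_complex_def)
    qed
    also have "\<dots> = (\<Prod>b\<in>Basis. (u - l) \<bullet> b)"
    proof -
      have "(\<Prod>b\<in>Basis. (iso' u - iso' l) \<bullet> b) = (\<Prod>i\<in>UNIV. (iso' u - iso' l) $ i)"
        by (simp add: Basis_vec_def prod.UNION_disjoint axis_eq_axis inner_axis)
      then show ?thesis by (simp add: prod_2 UNIV_2 iso'_def Basis_complex_def complex_eq_iff)
    qed
    finally show "emeasure (distr lborel borel iso) (box l u) = (\<Prod>b\<in>Basis. (u - l) \<bullet> b)" .
  qed simp
  define f where "f = iso' \<circ> (*) \<alpha> \<circ> iso"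
  have "orthogonal_transformation f"
    unfolding orthogonal_transformation f_def
  proof (intro conjI allI)
    show "linear (iso' \<circ> (*) \<alpha> \<circ> iso)"
      by (intro linear_compose iso_lin iso'_lin linear_times)
    show "norm ((iso' \<circ> (*) \<alpha> \<circ> iso) v) = norm v" for v
      using nrm[of "iso' (\<alpha> * iso v)"] assms by (simp add: ii nrm norm_mult)
  qed
  note r = lborel_real2_rotate[OF this]
  have fm: "f \<in> borel_measurable borel"
    unfolding f_def using linear_compose[OF linear_compose[OF iso_lin linear_times[of \<alpha>]] iso'_lin]
    by (intro borel_measurable_continuous_onI linear_continuous_on) (auto simp: linear_conv_bounded_linear comp_assoc)
  have "distr lborel borel ((*) \<alpha>) = distr (distr lborel borel iso) borel ((*) \<alpha>)" by (simp add: iso)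
  also have "\<dots> = distr lborel borel ((*) \<alpha> \<circ> iso)" by (rule distr_distr) auto
  also have "(*) \<alpha> \<circ> iso = iso \<circ> f" by (auto simp: f_def ii)
  also have "distr lborel borel (iso \<circ> f) = distr (distr lborel borel f) borel iso"
    by (rule distr_distr[symmetric]) (use fm in auto)
  also have "\<dots> = lborel" by (simp add: r iso)
  finally show ?thesis .
qed

lemma lborel_rotate:
  fixes f :: "complex \<Rightarrow> real"
  assumes "cmod \<alpha> = 1"
  shows "integrable lborel f \<Longrightarrow> integrable lborel (\<lambda>z. f (\<alpha> * z))"
    and "f \<in> borel_measurable borel \<Longrightarrow> (\<integral>z. f (\<alpha> * z) \<partial>lborel) = (\<integral>z. f z \<partial>lborel)"
proof -
  note d = lborel_complex_rotate[OF assms]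
  show "integrable lborel (\<lambda>z. f (\<alpha> * z))" if f: "integrable lborel f"
  proof -
    have "integrable (distr lborel borel ((*) \<alpha>)) f" unfolding d by (rule f)
    then show ?thesis by (subst (asm) integrable_distr_eq) (use borel_measurable_integrable[OF f] in auto)
  qed
  show "(\<integral>z. f (\<alpha> * z) \<partial>lborel) = (\<integral>z. f z \<partial>lborel)" if f: "f \<in> borel_measurable borel"
    using integral_distr[of "(*) \<alpha>" lborel borel f] f by (simp add: d)
qed

text \<open>This replaces polar coordinates: the integral over the disk is invariant under each
  rotation about its centre, so it equals its average over all rotations, and Fubini moves that
  average inside.\<close>

lemma integral_ball_circle_average:
  fixes f :: "complex \<Rightarrow> real"
  assumes i: "integrable lborel (\<lambda>z. indicator (ball z0 h) z * f z)"
    and fm[measurable]: "f \<in> borel_measurable borel"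
  shows "integrable lborel (\<lambda>z. indicator (ball 0 h) z * (\<integral>\<omega>. f (z0 + \<omega> * z) \<partial>circ))"
    and "(\<integral>z. indicator (ball z0 h) z * f z \<partial>lborel) = (\<integral>z. indicator (ball (0::complex) h) z * (\<integral>\<omega>. f (z0 + \<omega> * z) \<partial>circ) \<partial>lborel)"
proof -
  let ?f = "\<lambda>z. indicator (ball 0 h) z * f (z0 + z)"
  have e0: "?f = (\<lambda>z. (\<lambda>z. indicator (ball z0 h) z * f z) (z0 + z))"
    by (auto simp: fun_eq_iff dist_norm indicator_def)
  have fi: "integrable lborel ?f" unfolding e0 by (rule lborel_shift(1)[OF i])
  have fe: "(\<integral>z. ?f z \<partial>lborel) = (\<integral>z. indicator (ball z0 h) z * f z \<partial>lborel)"
    unfolding e0 by (rule lborel_shift(2)) measurable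
  let ?g = "\<lambda>(\<omega>, z). indicator (ball 0 h) z * f (z0 + \<omega> * z)"
  have gm: "?g \<in> borel_measurable (circ \<Otimes>\<^sub>M lborel)" by measurable
  have ge: "(\<lambda>z. ?g (\<omega>, z)) = (\<lambda>z. ?f (\<omega> * z))" if "cmod \<omega> = 1" for \<omega>
    using that by (auto simp: fun_eq_iff norm_mult indicator_def)
  have ai: "AE \<omega> in circ. integrable lborel (\<lambda>z. ?g (\<omega>, z))"
    using AE_circ_unit
  proof eventually_elim
    case (elim \<omega>)
    show ?case unfolding ge[OF elim] by (rule lborel_rotate(1)[OF elim fi])
  qed
  have ab: "AE \<omega> in circ. (\<integral>z. \<bar>?g (\<omega>, z)\<bar> \<partial>lborel) \<le> (\<integral>z. \<bar>?f z\<bar> \<partial>lborel)"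
    using AE_circ_unit
  proof eventually_elim
    case (elim \<omega>)
    have "(\<integral>z. \<bar>?g (\<omega>, z)\<bar> \<partial>lborel) = (\<integral>z. \<bar>?f (\<omega> * z)\<bar> \<partial>lborel)"
      using fun_cong[OF ge[OF elim]] by (simp only:)
    also have "\<dots> = (\<integral>z. \<bar>?f z\<bar> \<partial>lborel)" by (rule lborel_rotate(2)[OF elim, where f="\<lambda>z. \<bar>?f z\<bar>"]) measurable
    finally show ?case by simp
  qed
  have ae: "AE \<omega> in circ. (\<integral>z. ?g (\<omega>, z) \<partial>lborel) = (\<integral>z. ?f z \<partial>lborel)"
    using AE_circ_unit
  proof eventually_elim
    case (elim \<omega>)
    show ?case unfolding ge[OF elim] by (rule lborel_rotate(2)[OF elim, where f="?f"]) measurable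
  qed
  note F = Fubini_bounded_sections[OF circ.finite_measure_axioms gm ai ab]
  show "integrable lborel (\<lambda>z. indicator (ball 0 h) z * (\<integral>\<omega>. f (z0 + \<omega> * z) \<partial>circ))"
    using F(1) by simp
  have "(\<integral>\<omega>. (\<integral>z. ?g (\<omega>, z) \<partial>lborel) \<partial>circ) = (\<integral>\<omega>. (\<integral>z. ?f z \<partial>lborel) \<partial>circ)"
    by (rule integral_cong_AE[OF borel_measurable_integrable[OF F(2)] _ ae]) simp
  then show "(\<integral>z. indicator (ball z0 h) z * f z \<partial>lborel) = (\<integral>z. indicator (ball (0::complex) h) z * (\<integral>\<omega>. f (z0 + \<omega> * z) \<partial>circ) \<partial>lborel)"
    using F(3) circ.prob_space by (simp add: fe)
qed

lemma circ_avg_through: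
  fixes f :: "complex \<Rightarrow> real"
  assumes [measurable]: "f \<in> borel_measurable borel"
  shows "(\<integral>\<omega>. f (w + \<omega> * z) \<partial>circ) = (\<integral>\<omega>. f (w + of_real (cmod z) * \<omega>) \<partial>circ)"
proof (cases "z = 0")
  case False
  define b where "b = z / of_real (cmod z)"
  have b: "cmod b = 1" "\<And>\<omega>. w + \<omega> * z = w + of_real (cmod z) * (b * \<omega>)"
    using False by (auto simp: b_def norm_divide)
  show ?thesis unfolding b(2)
    by (rule integral_circ_rotate[OF b(1), where f="\<lambda>\<omega>. f (w + of_real (cmod z) * \<omega>)"]) measurable
qed simp

lemma circ_avg_through_ln:
  assumes "cmod z \<noteq> cmod w"
  shows "(\<integral>\<omega>. ln (cmod (w + \<omega> * z)) \<partial>circ) = ln (max (cmod z) (cmod w))"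
proof -
  have "(\<integral>\<omega>. ln (cmod (w + \<omega> * z)) \<partial>circ) = (\<integral>\<omega>. ln (cmod (w + \<omega> * (- z))) \<partial>circ)"
    using circ_avg_through[of "\<lambda>x. ln (cmod x)" w z] circ_avg_through[of "\<lambda>x. ln (cmod x)" w "-z"] by simp
  also have "\<dots> = (\<integral>\<omega>. ln (cmod (w + of_real (cmod z) * ((-1) * \<omega>))) \<partial>circ)"
    using circ_avg_through[of "\<lambda>x. ln (cmod x)" w "-z"] 
      integral_circ_rotate[of "-1" "\<lambda>\<omega>. ln (cmod (w + of_real (cmod z) * \<omega>))"] by simp
  also have "\<dots> = ln (max (cmod z) (cmod w))"
    using circ_jensen(2)[of w "cmod z"] assms by simp
  finally show ?thesis .
qed

text \<open>By Jensen every circle mean about z0 is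
  \<open>ln (max (cmod z) (cmod (z0 - a)))\<close>, which dominates the value at the centre. For a =
  z0 the convention \<open>ln 0 = 0\<close> would make the inequality false on small disks.\<close>

lemma ball_mean_ln:
  assumes a: "a \<noteq> z0"
  shows "integrable lborel (\<lambda>z. indicator (ball z0 h) z * ln (cmod (z - a)))"
    and "measure lborel (ball (0::complex) h) * ln (cmod (z0 - a)) \<le> (\<integral>z. indicator (ball z0 h) z * ln (cmod (z - a)) \<partial>lborel)"
proof -
  show i: "integrable lborel (\<lambda>z. indicator (ball z0 h) z * ln (cmod (z - a)))"
  proof (rule Bochner_Integration.integrable_bound[OF integrable_ln_norm[of "cmod z0 + h" a]])
    show "AE z in lborel. norm (indicator (ball z0 h) z * ln (cmod (z - a))) \<le> norm (indicator (ball 0 (cmod z0 + h)) z * ln (cmod (z - a)))"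
    proof (rule AE_I2)
      fix z
      have "cmod z < cmod z0 + h" if "z \<in> ball z0 h"
        using that norm_triangle_ineq2[of z z0] by (auto simp: dist_norm norm_minus_commute)
      then show "norm (indicator (ball z0 h) z * ln (cmod (z - a))) \<le> norm (indicator (ball 0 (cmod z0 + h)) z * ln (cmod (z - a)))"
        by (auto split: split_indicator)
    qed
  qed measurable
  note C = integral_ball_circle_average[OF i]
  have "(\<integral>z. indicator (ball (0::complex) h) z * ln (cmod (z0 - a)) \<partial>lborel) \<le>
     (\<integral>z. indicator (ball (0::complex) h) z * (\<integral>\<omega>. ln (cmod (z0 + \<omega> * z - a)) \<partial>circ) \<partial>lborel)"
  proof (rule integral_mono_AE)
    show "integrable lborel (\<lambda>z. indicator (ball (0::complex) h) z * ln (cmod (z0 - a)))"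
      by (intro integrable_mult_left integrable_indicator_balls)
    show "integrable lborel (\<lambda>z. indicator (ball 0 h) z * (\<integral>\<omega>. ln (cmod (z0 + \<omega> * z - a)) \<partial>circ))"
      by (rule C(1)) measurable
    show "AE z in lborel. indicator (ball 0 h) z * ln (cmod (z0 - a)) \<le> indicator (ball 0 h) z * (\<integral>\<omega>. ln (cmod (z0 + \<omega> * z - a)) \<partial>circ)"
      using AE_lborel_norm_neq[of 0 "cmod (z0 - a)"]
    proof eventually_elim
      case (elim z)
      have "(\<integral>\<omega>. ln (cmod (z0 + \<omega> * z - a)) \<partial>circ) = (\<integral>\<omega>. ln (cmod ((z0 - a) + \<omega> * z)) \<partial>circ)"
        by (simp add: algebra_simps)
      also have "\<dots> = ln (max (cmod z) (cmod (z0 - a)))"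
        by (rule circ_avg_through_ln) (use elim in simp)
      also have "\<dots> \<ge> ln (cmod (z0 - a))"
        using a by (intro ln_mono) auto
      finally show ?case by (intro mult_left_mono) auto
    qed
  qed
  also have "\<dots> = (\<integral>z. indicator (ball z0 h) z * ln (cmod (z - a)) \<partial>lborel)"
    by (rule C(2)[symmetric]) measurable
  finally show "measure lborel (ball (0::complex) h) * ln (cmod (z0 - a)) \<le> (\<integral>z. indicator (ball z0 h) z * ln (cmod (z - a)) \<partial>lborel)"
    by simp
qed

lemma ball_mean_harmonic:
  assumes L: "L holomorphic_on S" and S: "open S" "cball z0 h \<subseteq> S"
  shows "integrable lborel (\<lambda>z. indicator (ball z0 h) z * Re (L z))"
    and "(\<integral>z. indicator (ball z0 h) z * Re (L z) \<partial>lborel) = measure lborel (ball (0::complex) h) * Re (L z0)"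
proof -
  have Lc: "continuous_on S L" by (rule holomorphic_on_imp_continuous_on[OF L])
  define F where "F z = (if z \<in> S then L z else 0)" for z
  have Fm[measurable]: "F \<in> borel_measurable borel"
    unfolding F_def by (rule borel_measurable_continuous_on_if) (use S in \<open>auto intro!: Lc continuous_intros\<close>)
  have Fh: "F holomorphic_on S"
    by (rule holomorphic_transform[OF L]) (simp add: F_def)
  have bd: "bounded (L ` cball z0 h)"
    by (rule compact_imp_bounded[OF compact_continuous_image]) (use S in \<open>auto intro!: continuous_on_subset[OF Lc]\<close>)
  then obtain C where "\<forall>y\<in>L ` cball z0 h. cmod y \<le> C" unfolding bounded_iff by blast
  then have C: "\<And>z. z \<in> cball z0 h \<Longrightarrow> cmod (L z) \<le> C" by blast
  have eq: "indicator (ball z0 h) z * Re (L z) = indicator (ball z0 h) z * Re (F z)" for z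
  proof -
    have "z \<in> S" if "z \<in> ball z0 h" using that S ball_subset_cball by blast
    then show ?thesis by (simp add: F_def split: split_indicator)
  qed
  show i: "integrable lborel (\<lambda>z. indicator (ball z0 h) z * Re (L z))"
    unfolding eq
  proof (rule Bochner_Integration.integrable_bound[where f="\<lambda>z. C * indicator (cball z0 h) z"])
    show "integrable lborel (\<lambda>z. C * indicator (cball z0 h) z)"
      by (intro integrable_mult_right integrable_indicator_balls)
    show "AE x in lborel. norm (indicator (ball z0 h) x * Re (F x)) \<le> norm (C * indicator (cball z0 h) x)"
    proof (rule AE_I2)
      fix x show "norm (indicator (ball z0 h) x * Re (F x)) \<le> norm (C * indicator (cball z0 h) x)"
        using C[of x] abs_Re_le_cmod[of "L x"] S by (auto simp: F_def indicator_def)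
    qed
  qed measurable
  have i': "integrable lborel (\<lambda>z. indicator (ball z0 h) z * Re (F z))" using i unfolding eq .
  have "(\<integral>z. indicator (ball z0 h) z * Re (L z) \<partial>lborel) = (\<integral>z. indicator (ball (0::complex) h) z * (\<integral>\<omega>. Re (F (z0 + \<omega> * z)) \<partial>circ) \<partial>lborel)"
    unfolding eq by (rule integral_ball_circle_average(2)[OF i']) measurable
  also have "\<dots> = (\<integral>z. indicator (ball (0::complex) h) z * Re (L z0) \<partial>lborel)"
  proof (intro Bochner_Integration.integral_cong refl)
    fix z
    show "indicator (ball 0 h) z * (\<integral>\<omega>. Re (F (z0 + \<omega> * z)) \<partial>circ) = indicator (ball 0 h) z * Re (L z0)"
    proof (cases "z \<in> ball 0 h")
      case True
      then have "0 \<le> h" using norm_ge_zero[of z] by (simp del: norm_ge_zero)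
      then have z0: "z0 \<in> S" using S by auto
      show ?thesis
      proof (cases "z = 0")
        case True
        then show ?thesis using z0 circ.prob_space by (simp add: F_def)
      next
        case False
        have "cball z0 (cmod z) \<subseteq> S" using S True by (auto intro: order_trans)
        note M = circ_mean_value[OF holomorphic_on_subset[OF Fh this] _ Fm]
        have "(\<integral>\<omega>. Re (F (z0 + \<omega> * z)) \<partial>circ) = (\<integral>\<omega>. Re (F (z0 + of_real (cmod z) * \<omega>)) \<partial>circ)"
          by (rule circ_avg_through[where f="\<lambda>x. Re (F x)"]) measurable
        also have "\<dots> = Re (F z0)" using M False by (simp add: integral_Re)
        finally show ?thesis using z0 by (simp add: F_def)
      qed
    qed simp
  qed
  also have "\<dots> = measure lborel (ball (0::complex) h) * Re (L z0)" by simp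
  finally show "(\<integral>z. indicator (ball z0 h) z * Re (L z) \<partial>lborel) = measure lborel (ball (0::complex) h) * Re (L z0)" .
qed

section \<open>Zeros as logarithmic singularities\<close>

lemma zorder_nonzero:
  assumes "g holomorphic_on S" "open S" "z \<in> S" "g z \<noteq> 0"
  shows "zorder g z = 0"
  using assms by (intro zorder_eqI[of S z g]) auto

text \<open>Dividing by the polynomial with the same zeros and orders leaves a zero-free function,
  which has a holomorphic logarithm on the disk. The larger radius R2 makes the zeros in the closed
  disk of radius R1 finite in number.\<close>

lemma holomorphic_ln_norm_decomposition:
  assumes g: "g holomorphic_on ball 0 R2" and R: "0 < R1" "R1 < R2" and nz: "\<exists>z\<in>ball 0 R2. g z \<noteq> 0"
  defines "Z \<equiv> {z \<in> ball 0 R1. g z = 0}"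
  obtains L where "finite Z" "L holomorphic_on ball 0 R1"
    "\<And>z. z \<in> ball 0 R1 \<Longrightarrow> g z \<noteq> 0 \<Longrightarrow> ln (cmod (g z)) = (\<Sum>a\<in>Z. real (nat (zorder g a)) * ln (cmod (z - a))) + Re (L z)"
proof -
  have nc: "\<not> g constant_on ball 0 R2" if "Z \<noteq> {}"
  proof
    assume "g constant_on ball 0 R2"
    then obtain c where "\<And>z. z \<in> ball 0 R2 \<Longrightarrow> g z = c" unfolding constant_on_def by blast
    then show False using that nz R unfolding Z_def by force
  qed
  have finZ: "finite Z"
  proof (cases "Z = {}")
    case False
    have "finite {z \<in> cball 0 R1. g z = 0}"
      by (rule holomorphic_compact_finite_zeros[OF g]) (use R nc[OF False] in auto)
    then show ?thesis by (rule finite_subset[rotated]) (auto simp: Z_def)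
  qed simp
  define n where "n a = nat (zorder g a)" for a
  define P where "P z = (\<Prod>a\<in>Z. (z - a) ^ n a)" for z
  have Ph: "P holomorphic_on S" for S unfolding P_def by (intro holomorphic_intros)
  have gh1: "g holomorphic_on ball 0 R1" using g R by (auto intro: holomorphic_on_subset)
  have zg: "zorder g a > 0" if "a \<in> Z" for a
    using zorder_exist_zero[OF g, of a] that R nz unfolding Z_def by auto
  have P0: "P z = 0 \<longleftrightarrow> z \<in> Z" for z
  proof -
    have "P z = 0 \<longleftrightarrow> (\<exists>a\<in>Z. (z - a) ^ n a = 0)" unfolding P_def using finZ by simp
    also have "\<dots> \<longleftrightarrow> z \<in> Z" using zg by (auto simp: n_def)
    finally show ?thesis .
  qed
  have zP: "zorder P z = zorder g z" if z: "z \<in> ball 0 R1" for z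
  proof (cases "z \<in> Z")
    case False
    then have "zorder P z = 0" using P0 Ph by (intro zorder_nonzero[of _ UNIV]) auto
    moreover have "zorder g z = 0" using False z gh1 by (intro zorder_nonzero[of _ "ball 0 R1"]) (auto simp: Z_def)
    ultimately show ?thesis by simp
  next
    case True
    have "zorder P z = int (n z)"
    proof (rule zorder_eqI[of UNIV z "\<lambda>w. \<Prod>a\<in>Z - {z}. (w - a) ^ n a"])
      show "(\<lambda>w. \<Prod>a\<in>Z - {z}. (w - a) ^ n a) holomorphic_on UNIV" by (intro holomorphic_intros)
      show "(\<Prod>a\<in>Z - {z}. (z - a) ^ n a) \<noteq> 0" using finZ by (auto simp: prod_zero_iff)
      show "P w = (\<Prod>a\<in>Z - {z}. (w - a) ^ n a) * (w - z) powi int (n z)" for w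
        unfolding P_def using finZ True by (subst prod.remove[OF finZ True]) (simp add: mult.commute)
    qed auto
    then show ?thesis using zg[OF True] by (simp add: n_def)
  qed
  have zeq: "P z = 0 \<longleftrightarrow> g z = 0" if "z \<in> ball 0 R1" for z
    using P0 that by (auto simp: Z_def)
  obtain H where H: "H holomorphic_on ball 0 R1" "\<And>z. z \<in> ball 0 R1 \<Longrightarrow> H z \<noteq> 0"
    "\<And>z. z \<in> ball 0 R1 \<Longrightarrow> g z = H z * P z"
    by (rule holomorphic_zorder_factorization[OF gh1 open_ball connected_ball Ph zeq zP]) auto
  obtain L where L: "L holomorphic_on ball 0 R1" "\<And>z. z \<in> ball 0 R1 \<Longrightarrow> H z = exp (L z)"
    using contractible_imp_holomorphic_log[OF H(1) convex_imp_contractible[OF convex_ball]] H(2) by metis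
  show ?thesis
  proof (rule that[OF finZ L(1)])
    fix z assume z: "z \<in> ball 0 R1" "g z \<noteq> 0"
    then have zZ: "\<And>a. a \<in> Z \<Longrightarrow> z \<noteq> a" by (auto simp: Z_def)
    have "cmod (g z) = (\<Prod>a\<in>Z. cmod (z - a) ^ n a) * exp (Re (L z))"
      using H(3)[OF z(1)] L(2)[OF z(1)] by (simp add: P_def norm_mult prod_norm[symmetric] norm_power)
    also have "ln \<dots> = ln (\<Prod>a\<in>Z. cmod (z - a) ^ n a) + Re (L z)"
      using zZ finZ by (subst ln_mult) (auto intro!: prod_pos simp: prod_zero_iff)
    also have "ln (\<Prod>a\<in>Z. cmod (z - a) ^ n a) = (\<Sum>a\<in>Z. real (n a) * ln (cmod (z - a)))"
      using zZ finZ by (subst ln_prod) (auto simp: ln_realpow)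
    finally show "ln (cmod (g z)) = (\<Sum>a\<in>Z. real (nat (zorder g a)) * ln (cmod (z - a))) + Re (L z)"
      by (simp add: n_def)
  qed
qed

section \<open>Convex radial profiles\<close>

text \<open>Both functions behave like a primitive of D. On n equal steps the increments differ by
  at most the increment of D times the step length; these errors telescope to a multiple of 1 / n,
  so no integral of D is ever formed.\<close>

lemma squeeze_by_increments:
  fixes f g D :: "real \<Rightarrow> real"
  assumes ab: "a \<le> b"
    and f: "\<And>x y. a \<le> x \<Longrightarrow> x < y \<Longrightarrow> y \<le> b \<Longrightarrow> D x * (y - x) \<le> f y - f x \<and> f y - f x \<le> D y * (y - x)"
    and g: "\<And>x y. a \<le> x \<Longrightarrow> x < y \<Longrightarrow> y \<le> b \<Longrightarrow> D x * (y - x) \<le> g y - g x \<and> g y - g x \<le> D y * (y - x)"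
  shows "f b - f a = g b - g a"
proof (cases "a = b")
  case False
  then have ab: "a < b" using ab by simp
  define h where "h x = f x - g x" for x
  have h: "\<bar>h y - h x\<bar> \<le> (D y - D x) * (y - x)" if "a \<le> x" "x < y" "y \<le> b" for x y
    using f[OF that] g[OF that] unfolding h_def by (auto simp: abs_le_iff algebra_simps)
  have n: "\<bar>h b - h a\<bar> \<le> (D b - D a) * (b - a) / real n" if n: "n > 0" for n :: nat
  proof -
    define x where "x i = a + real i * (b - a) / real n" for i
    have x: "x 0 = a" "x n = b" using n by (auto simp: x_def)
    have d: "x (Suc i) - x i = (b - a) / real n" for i
      using n by (simp add: x_def field_simps)
    have xb: "a \<le> x i" "i \<le> n \<Longrightarrow> x i \<le> b" for i
    proof -
      show "a \<le> x i" using ab by (simp add: x_def)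
      assume "i \<le> n"
      then have "real i * (b - a) \<le> real n * (b - a)" using ab by (intro mult_right_mono) auto
      then show "x i \<le> b" using n by (simp add: x_def field_simps)
    qed
    have "\<bar>h (x m) - h (x 0)\<bar> \<le> (D (x m) - D (x 0)) * ((b - a) / real n)" if "m \<le> n" for m
      using that
    proof (induction m)
      case (Suc m)
      have "x m < x (Suc m)" using d[of m] ab n by (smt (verit) divide_pos_pos of_nat_0_less_iff)
      then have "\<bar>h (x (Suc m)) - h (x m)\<bar> \<le> (D (x (Suc m)) - D (x m)) * (x (Suc m) - x m)"
        using Suc xb by (intro h) auto
      then show ?case using Suc unfolding d by (simp add: algebra_simps abs_le_iff)
    qed simp
    from this[of n] show ?thesis by (simp add: x)
  qed
  have "(\<lambda>n. (D b - D a) * (b - a) / real n) \<longlonglongrightarrow> 0"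
    by (rule lim_const_over_n)
  then have "\<bar>h b - h a\<bar> \<le> 0"
    by (rule LIMSEQ_le_const) (use n in \<open>auto intro!: exI[of _ 1]\<close>)
  then show ?thesis by (simp add: h_def)
qed simp

text \<open>The variable s stands for the logarithm of a radius. The lower bound m is what keeps the
  radial extension \<open>u\<close> finite at the origin.\<close>

locale convex_profile =
  fixes I :: "real \<Rightarrow> real" and R0 :: ereal and m :: real
  assumes R0_pos: "R0 > 0"
    and conv: "convex_on {s. ereal (exp s) < R0} I"
    and mono: "\<And>s t. s \<le> t \<Longrightarrow> ereal (exp t) < R0 \<Longrightarrow> I s \<le> I t"
    and lower: "\<And>s. ereal (exp s) < R0 \<Longrightarrow> m \<le> I s"
begin

abbreviation "S \<equiv> {s. ereal (exp s) < R0}"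

lemma S_down: "t \<in> S \<Longrightarrow> s \<le> t \<Longrightarrow> s \<in> S"
  by (auto intro: le_less_trans[rotated])

lemma S_up: "s \<in> S \<Longrightarrow> \<exists>t>s. t \<in> S"
proof -
  assume "s \<in> S"
  then obtain x where x: "ereal (exp s) < ereal x" "ereal x < R0" using ereal_dense2 by blast
  then have "exp s < x" by simp
  then have "x > 0" using exp_gt_zero[of s] by linarith
  then have "s < ln x" "exp (ln x) = x" using x by (auto simp: ln_less_cancel_iff[of "exp s" x, simplified])
  then show ?thesis using x by (intro exI[of _ "ln x"]) auto
qed

lemma ln_in_S: "0 < r \<Longrightarrow> ereal r < R0 \<Longrightarrow> ln r \<in> S" by simp

lemma open_S: "open S"
proof -
  have "S = {..<(THE x. ereal (exp x) = R0)} \<or> S = UNIV"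
  proof (cases R0)
    case (real r)
    then have r: "r > 0" using R0_pos by simp
    have "(THE x. ereal (exp x) = R0) = ln r" using r real by (intro the_equality) (auto simp: ln_unique)
    moreover have "exp s < r \<longleftrightarrow> s < ln r" for s using r by (metis exp_less_cancel_iff exp_ln)
    ultimately show ?thesis using real by auto
  qed (use R0_pos in auto)
  then show ?thesis by (metis open_UNIV open_lessThan)
qed

section \<open>Slopes and the left derivative\<close>

definition slope :: "real \<Rightarrow> real \<Rightarrow> real" where "slope x y = (I y - I x) / (y - x)"

lemma three_slopes:
  assumes "x < y" "y < z" "z \<in> S"
  shows "slope x y \<le> slope x z" "slope x z \<le> slope y z"
proof -
  define t where "t = (y - x) / (z - x)"
  have tz: "t * (z - x) = y - x" using assms by (simp add: t_def)
  have t: "0 \<le> t" "t \<le> 1" using assms by (auto simp: t_def field_simps)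
  have ty: "y = (1 - t) *\<^sub>R x + t *\<^sub>R z" using tz by (simp add: algebra_simps)
  have "x \<in> S" using S_down[OF assms(3)] assms by auto
  then have "I y \<le> (1 - t) * I x + t * I z"
    using convex_onD[OF conv t(1,2) _ assms(3), of x] ty by simp
  then have "(z - x) * I y \<le> (z - x) * ((1 - t) * I x + t * I z)"
    using assms by (intro mult_left_mono) auto
  also have "\<dots> = (z - y) * I x + (y - x) * I z"
  proof -
    have "(z - x) * ((1 - t) * I x + t * I z) = ((z - x) - t * (z - x)) * I x + (t * (z - x)) * I z"
      by (simp add: algebra_simps)
    then show ?thesis unfolding tz by simp
  qed
  finally have k: "(z - x) * I y \<le> (z - y) * I x + (y - x) * I z" .
  show "slope x y \<le> slope x z" "slope x z \<le> slope y z"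
    unfolding slope_def using assms k by (auto simp: divide_simps algebra_simps)
qed

text \<open>The left derivative of I: slopes towards s increase with their left end point, so the
  limit is a supremum and its existence needs no argument.\<close>

definition D :: "real \<Rightarrow> real" where "D s = (SUP y\<in>{..<s}. slope y s)"

lemma D_bdd:
  assumes "s \<in> S"
  shows "bdd_above ((\<lambda>y. slope y s) ` {..<s})"
proof -
  obtain t where t: "t > s" "t \<in> S" using S_up[OF assms] by blast
  show ?thesis
  proof (rule bdd_aboveI2)
    fix y assume "y \<in> {..<s}"
    then show "slope y s \<le> slope s t" using three_slopes[of y s t] t by auto
  qed
qed

lemma slope_le_D: "s \<in> S \<Longrightarrow> y < s \<Longrightarrow> slope y s \<le> D s"
  unfolding D_def by (rule cSUP_upper) (auto intro: D_bdd)

lemma D_le_slope: "t \<in> S \<Longrightarrow> s < t \<Longrightarrow> D s \<le> slope s t"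
  unfolding D_def
proof (rule cSUP_least)
  fix y assume "t \<in> S" "s < t" "y \<in> {..<s}"
  then show "slope y s \<le> slope s t" using three_slopes[of y s t] by auto
qed auto

lemma D_mono: "t \<in> S \<Longrightarrow> s \<le> t \<Longrightarrow> D s \<le> D t"
  using D_le_slope[of t s] slope_le_D[of t s] by (cases "s = t") auto

lemma D_nonneg: "s \<in> S \<Longrightarrow> 0 \<le> D s"
proof -
  assume s: "s \<in> S"
  have "0 \<le> slope (s - 1) s" using mono[of "s - 1" s] s by (simp add: slope_def)
  then show ?thesis using slope_le_D[OF s, of "s - 1"] by simp
qed

lemma D_increments:
  assumes "x < y" "y \<in> S"
  shows "D x * (y - x) \<le> I y - I x" "I y - I x \<le> D y * (y - x)"
proof -
  have "D x * (y - x) \<le> slope x y * (y - x)" using D_le_slope[of y x] assms by (intro mult_right_mono) auto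
  then show "D x * (y - x) \<le> I y - I x" using assms by (simp add: slope_def)
  have "slope x y * (y - x) \<le> D y * (y - x)" using slope_le_D[of y x] assms by (intro mult_right_mono) auto
  then show "I y - I x \<le> D y * (y - x)" using assms by (simp add: slope_def)
qed

lemma I_continuous: "continuous_on S I"
  by (rule convex_on_continuous[OF open_S conv])

text \<open>A left slope at s exceeding x still exceeds x when s is lowered slightly, because I is
  continuous. For the monotone function D this is left continuity, which any function giving the
  masses of open balls must have.\<close>

lemma D_left_cont:
  assumes "s \<in> S" "x < D s"
  shows "\<exists>s'<s. x < D s'"
proof -
  have "\<exists>y\<in>{..<s}. x < slope y s"
    using assms D_bdd[OF assms(1)] unfolding D_def by (subst (asm) less_cSUP_iff) auto
  then obtain y where y: "y < s" "x < slope y s" by auto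
  have Ic: "(I \<longlongrightarrow> I s) (at_left s)"
    using I_continuous assms(1) open_S by (metis at_le continuous_on_eq_continuous_at isCont_def subset_UNIV tendsto_mono)
  have "((\<lambda>s'. slope y s') \<longlongrightarrow> slope y s) (at_left s)"
    unfolding slope_def using y by (intro tendsto_intros Ic) auto
  then have "eventually (\<lambda>s'. x < slope y s') (at_left s)"
    using y(2) by (rule order_tendstoD)
  moreover have "eventually (\<lambda>s'. s' \<in> {y<..<s}) (at_left s)"
    using y(1) by (rule eventually_at_left_real)
  ultimately have "eventually (\<lambda>s'. s' \<in> {y<..<s} \<and> x < slope y s') (at_left s)"
    by eventually_elim auto
  then obtain s' where s': "y < s'" "s' < s" "x < slope y s'"
    using eventually_happens' trivial_limit_at_left_real by (metis (no_types, lifting) greaterThanLessThan_iff)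
  then have "x < D s'" using slope_le_D[of s' y] S_down[OF assms(1)] by fastforce
  then show ?thesis using s' by blast
qed

lemma D_left_derivative:
  assumes s: "s \<in> S"
  shows "(I has_real_derivative D s) (at_left s)"
proof -
  have "((\<lambda>y. slope y s) \<longlongrightarrow> D s) (at_left s)"
  proof (rule order_tendstoI)
    fix a assume "a < D s"
    then have "\<exists>y\<in>{..<s}. a < slope y s"
      using D_bdd[OF s] unfolding D_def by (subst (asm) less_cSUP_iff) auto
    then obtain y where y: "y < s" "a < slope y s" by auto
    show "eventually (\<lambda>x. a < slope x s) (at_left s)"
      using eventually_at_left_real[OF y(1)]
    proof eventually_elim
      case (elim x)
      then have "slope y s \<le> slope x s" using three_slopes[of y x s] s by auto
      then show ?case using y by simp
    qed
  next
    fix a assume a: "D s < a"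
    have "eventually (\<lambda>x. x \<in> {s - 1<..<s}) (at_left s)" by (rule eventually_at_left_real) simp
    then show "eventually (\<lambda>x. slope x s < a) (at_left s)"
    proof eventually_elim
      case (elim x)
      then show ?case using slope_le_D[OF s, of x] a by auto
    qed
  qed
  moreover have "(I y - I s) / (y - s) = slope y s" for y
    unfolding slope_def by (metis minus_diff_eq minus_divide_divide)
  ultimately show ?thesis
    unfolding has_field_derivative_iff by simp
qed

text \<open>The value at 0 is the limit of I at minus infinity, by monotonicity, so u is continuous;
  evaluating \<open>ln 0 = 0\<close> would give an unrelated value.\<close>

definition u :: "complex \<Rightarrow> real" where
  "u z = (if z = 0 then (INF s\<in>S. I s) else I (ln (cmod z)))"

lemma I_bdd_below: "bdd_below (I ` S)"
  using lower by (auto intro!: bdd_belowI2)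

lemma S_nonempty: "S \<noteq> {}"
proof -
  obtain x where x: "0 < ereal x" "ereal x < R0" using ereal_dense2[OF R0_pos] by blast
  then have "0 < x" by simp
  from ln_in_S[OF this x(2)] show ?thesis by blast
qed

lemma continuous_on_u: "continuous_on (eball 0 R0) u"
proof (rule continuous_at_imp_continuous_on, intro ballI)
  fix z :: complex assume z: "z \<in> eball 0 R0"
  show "isCont u z"
  proof (cases "z = 0")
    case False
    have "ln (cmod z) \<in> S" using z False by (auto simp: in_eball_iff)
    then have "isCont I (ln (cmod z))" using I_continuous open_S by (simp add: continuous_on_eq_continuous_at)
    then have c: "isCont (\<lambda>z. I (ln (cmod z))) z"
      using False by (intro isCont_o2[of z "\<lambda>z. ln (cmod z)" I] continuous_intros) auto
    have "eventually (\<lambda>x. x \<in> - {0}) (nhds z)"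
      using False by (intro eventually_nhds_in_open) auto
    then have "eventually (\<lambda>x. u x = I (ln (cmod x))) (nhds z)"
      by eventually_elim (auto simp: u_def)
    then show ?thesis using c isCont_cong by metis
  next
    case True
    define l where "l = (INF s\<in>S. I s)"
    have "(u \<longlongrightarrow> l) (at 0)"
    proof (rule order_tendstoI)
      fix a assume a: "a < l"
      have "eventually (\<lambda>x. x \<in> eball 0 R0) (at (0::complex))"
        by (rule eventually_at_in_open') (use R0_pos in \<open>auto simp: zero_ereal_def\<close>)
      then show "eventually (\<lambda>x. a < u x) (at 0)"
      proof eventually_elim
        case (elim x)
        have "l \<le> u x"
        proof (cases "x = 0")
          case False
          then have "ln (cmod x) \<in> S" using elim by (auto simp: in_eball_iff)
          then show ?thesis unfolding l_def using False I_bdd_below by (simp add: u_def cINF_lower)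
        qed (simp add: u_def l_def)
        then show ?case using a by simp
      qed
    next
      fix a assume a: "l < a"
      then obtain s where s: "s \<in> S" "I s < a"
        using I_bdd_below S_nonempty unfolding l_def by (subst (asm) cINF_less_iff) auto
      have "eventually (\<lambda>x. x \<in> ball 0 (exp s) - {0}) (at (0::complex))"
        by (rule eventually_at_in_open) auto
      then show "eventually (\<lambda>x. u x < a) (at 0)"
      proof eventually_elim
        case (elim x)
        then have "ln (cmod x) < ln (exp s)" by (subst ln_less_cancel_iff) auto
        then have "ln (cmod x) \<le> s" by simp
        then have "u x \<le> I s" using mono[of "ln (cmod x)" s] s elim by (simp add: u_def)
        then show ?case using s by simp
      qed
    qed
    then show ?thesis using True by (simp add: isCont_def u_def l_def)
  qed
qed

end

section \<open>Rotation invariant measures\<close>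

lemma ereal_le_less: "x \<le> y \<Longrightarrow> ereal y < R \<Longrightarrow> ereal x < R"
  by (meson ereal_less_eq(3) le_less_trans)

lemma in_eball_0_iff: "z \<in> eball 0 R \<longleftrightarrow> ereal (cmod z) < R"
  by (simp add: in_eball_iff)

lemma ball_subset_eball_0:
  assumes "ereal r < R"
  shows "ball 0 r \<subseteq> eball (0::complex) R" "cball 0 r \<subseteq> eball (0::complex) R"
  using ereal_le_less[OF _ assms] by (auto simp: in_eball_0_iff)

definition rotation_invariant_borel :: "complex measure \<Rightarrow> bool" where
  "rotation_invariant_borel N \<longleftrightarrow> sets N = sets borel \<and> (\<forall>\<alpha>. cmod \<alpha> = 1 \<longrightarrow> distr N borel ((*) \<alpha>) = N)"

text \<open>Integrate the invariance over all rotations and exchange the integrals. What remains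
  depends on N only through the distribution of the modulus.\<close>

lemma rotation_invariant_integral:
  fixes \<Phi> :: "complex \<Rightarrow> real"
  assumes N: "finite_measure N" "rotation_invariant_borel N"
    and [measurable]: "\<Phi> \<in> borel_measurable borel" and b: "\<And>z. \<bar>\<Phi> z\<bar> \<le> B"
  shows "(\<integral>a. \<Phi> a \<partial>N) = (\<integral>a. (\<integral>\<omega>. \<Phi> (of_real (cmod a) * \<omega>) \<partial>circ) \<partial>N)"
proof -
  interpret N: finite_measure N by fact
  have [measurable_cong, simp]: "sets N = sets borel" using N by (simp add: rotation_invariant_borel_def)
  interpret P: pair_sigma_finite circ N
    by (intro pair_sigma_finite.intro N.sigma_finite_measure_axioms circ.sigma_finite_measure_axioms)
  have fm: "finite_measure (circ \<Otimes>\<^sub>M N)"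
    by (intro finite_measure_pair_measure circ.finite_measure_axioms N.finite_measure_axioms)
  have i: "integrable (circ \<Otimes>\<^sub>M N) (\<lambda>(\<omega>, a). \<Phi> (\<omega> * a))"
    by (rule finite_measure.integrable_const_bound[OF fm, where B=B]) (use b in auto)
  have rot: "(\<integral>a. \<Phi> (\<omega> * a) \<partial>N) = (\<integral>a. \<Phi> a \<partial>N)" if "cmod \<omega> = 1" for \<omega>
  proof -
    have "distr N borel ((*) \<omega>) = N" using N that by (simp add: rotation_invariant_borel_def)
    then show ?thesis using integral_distr[of "(*) \<omega>" N borel \<Phi>] by simp
  qed
  have "(\<integral>a. \<Phi> a \<partial>N) = (\<integral>\<omega>. (\<integral>a. \<Phi> a \<partial>N) \<partial>circ)" using circ.prob_space by simp
  also have "\<dots> = (\<integral>\<omega>. (\<integral>a. \<Phi> (\<omega> * a) \<partial>N) \<partial>circ)"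
  proof (rule integral_cong_AE)
    show "AE \<omega> in circ. (\<integral>a. \<Phi> a \<partial>N) = (\<integral>a. \<Phi> (\<omega> * a) \<partial>N)"
      using AE_circ_unit by eventually_elim (simp add: rot)
    show "(\<lambda>\<omega>. \<integral>a. \<Phi> (\<omega> * a) \<partial>N) \<in> borel_measurable circ"
      using P.integrable_fst[OF i] by auto
  qed simp
  also have "\<dots> = (\<integral>a. (\<integral>\<omega>. \<Phi> (\<omega> * a) \<partial>circ) \<partial>N)"
    by (rule P.Fubini_integral[OF i, symmetric])
  also have "\<dots> = (\<integral>a. (\<integral>\<omega>. \<Phi> (of_real (cmod a) * \<omega>) \<partial>circ) \<partial>N)"
  proof (rule Bochner_Integration.integral_cong[OF refl])
    fix a
    show "(\<integral>\<omega>. \<Phi> (\<omega> * a) \<partial>circ) = (\<integral>\<omega>. \<Phi> (of_real (cmod a) * \<omega>) \<partial>circ)"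
    proof (cases "a = 0")
      case False
      define c where "c = a / of_real (cmod a)"
      have c: "cmod c = 1" "\<And>\<omega>. \<omega> * a = of_real (cmod a) * (c * \<omega>)"
        using False by (auto simp: c_def norm_divide)
      show ?thesis unfolding c(2)
        by (rule integral_circ_rotate[OF c(1), where f="\<lambda>\<omega>. \<Phi> (of_real (cmod a) * \<omega>)"]) measurable
    qed simp
  qed
  finally show ?thesis .
qed

text \<open>The balls fix the distribution of the modulus, since half-lines generate the Borel sets
  of the line and are stable under intersection. The mass of any E is the integral, under that
  distribution, of the proportion of each circle lying in E.\<close>

lemma rotation_invariant_eqI:
  assumes N: "finite_measure N" "rotation_invariant_borel N"
    and N': "finite_measure N'" "rotation_invariant_borel N'"
    and eq: "\<And>t. t > 0 \<Longrightarrow> emeasure N (ball 0 t) = emeasure N' (ball 0 t)"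
  shows "N = N'"
proof -
  interpret N: finite_measure N by fact
  interpret N': finite_measure N' by fact
  have sN[measurable_cong, simp]: "sets N = sets borel" "sets N' = sets borel" using N N' by (auto simp: rotation_invariant_borel_def)
  have sp[simp]: "space N = UNIV" "space N' = UNIV" using sets_eq_imp_space_eq[OF sN(1)] sets_eq_imp_space_eq[OF sN(2)] by auto
  have eqn: "distr N borel cmod = distr N' borel cmod"
  proof (rule measure_eqI_generator_eq[where E="range lessThan" and \<Omega>=UNIV and A="\<lambda>i. {..<real i}"])
    show "Int_stable (range (lessThan :: real \<Rightarrow> _))"     proof (rule Int_stableI)
      fix a b :: "real set" assume "a \<in> range lessThan" "b \<in> range lessThan"
      then obtain x y where "a = {..<x}" "b = {..<y}" by auto
      then have "a \<inter> b = {..<min x y}" by auto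
      then show "a \<inter> b \<in> range lessThan" by blast
    qed
    show "sets (distr N borel cmod) = sigma_sets UNIV (range lessThan)" 
      using arg_cong[OF borel_Iio[where 'a=real], of sets] by simp
    show "sets (distr N' borel cmod) = sigma_sets UNIV (range lessThan)" 
      using arg_cong[OF borel_Iio[where 'a=real], of sets] by simp
    show "(\<Union>i. {..<real i}) = UNIV" using reals_Archimedean2 by auto
    show "emeasure (distr N borel cmod) {..<real i} \<noteq> \<infinity>" for i
      by (subst emeasure_distr) auto
    fix X assume "X \<in> range (lessThan :: real \<Rightarrow> _)"
    then obtain t where X: "X = {..<t}" by auto
    have v: "cmod -` {..<t} = ball 0 t" by auto
    show "emeasure (distr N borel cmod) X = emeasure (distr N' borel cmod) X"
    proof (cases "t > 0")
      case True
      then show ?thesis using eq[OF True] by (simp add: X emeasure_distr v)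
    next
      case False
      have v0: "cmod -` {..<t} = {}"
      proof -
        have "\<not> cmod z < t" for z using False norm_ge_zero[of z] by linarith
        then show ?thesis by auto
      qed
      show ?thesis by (simp add: X emeasure_distr v0)
    qed
  qed auto
  show ?thesis
  proof (rule measure_eqI)
    fix E assume "E \<in> sets N"
    then have [measurable]: "E \<in> sets borel" by simp
    define k where "k t = (\<integral>\<omega>. indicat_real E (of_real t * \<omega>) \<partial>circ)" for t :: real
    have km[measurable]: "k \<in> borel_measurable borel"
      unfolding k_def by (rule circ.borel_measurable_lebesgue_integral) measurable
    have "measure N'' E = (\<integral>t. k t \<partial>distr N'' borel cmod)"
      if "finite_measure N''" "rotation_invariant_borel N''" for N''
    proof -
      interpret N'': finite_measure N'' by fact
      have [measurable_cong, simp]: "sets N'' = sets borel" using that by (simp add: rotation_invariant_borel_def)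
      have "measure N'' E = (\<integral>a. indicator E a \<partial>N'')" by simp
      also have "\<dots> = (\<integral>a. k (cmod a) \<partial>N'')"
        unfolding k_def by (rule rotation_invariant_integral[OF that, where B=1]) auto
      also have "\<dots> = (\<integral>t. k t \<partial>distr N'' borel cmod)" by (rule integral_distr[symmetric]) auto
      finally show ?thesis .
    qed
    from this[OF N] this[OF N'] show "emeasure N E = emeasure N' E"
      by (simp add: eqn N.emeasure_eq_measure N'.emeasure_eq_measure)
  qed simp
qed

section \<open>Finite truncations and uniqueness of radial measures\<close>

definition trunc :: "complex measure \<Rightarrow> real \<Rightarrow> complex measure" where
  "trunc \<nu> r = distr (restrict_space \<nu> (ball 0 r)) borel (\<lambda>z. z)"

lemma sets_trunc [simp]: "sets (trunc \<nu> r) = sets borel" and space_trunc [simp]: "space (trunc \<nu> r) = UNIV"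
  by (auto simp: trunc_def)

context
  fixes \<nu> :: "complex measure" and R0 :: ereal and r :: real
  assumes lf: "locally_finite_borel_on (eball 0 R0) \<nu>" and r: "ereal r < R0"
begin

lemma lf_sets: "sets \<nu> = sets (restrict_space borel (eball 0 R0))"
  using lf by (simp add: locally_finite_borel_on_def)

lemma lf_space: "space \<nu> = eball 0 R0"
  using sets_eq_imp_space_eq[OF lf_sets] by (simp add: space_restrict_space)

lemmas ball_subset_eball = ball_subset_eball_0[OF r]

lemma lf_set: "E \<in> sets borel \<Longrightarrow> E \<inter> ball 0 r \<in> sets \<nu>"
  unfolding lf_sets by (subst sets_restrict_space_iff) (use ball_subset_eball in auto)

lemma trunc_measurable: "(\<lambda>z. z) \<in> measurable (restrict_space \<nu> (ball 0 r)) borel"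
proof -
  have "(\<lambda>z. z) \<in> measurable \<nu> borel"
    using measurable_restrict_space1[of "\<lambda>z. z" borel borel "eball 0 R0"] measurable_cong_sets[OF lf_sets refl] by auto
  then show ?thesis by (rule measurable_restrict_space1)
qed

lemma emeasure_trunc: "E \<in> sets borel \<Longrightarrow> emeasure (trunc \<nu> r) E = emeasure \<nu> (E \<inter> ball 0 r)"
proof -
  assume E: "E \<in> sets borel"
  have sp: "(\<lambda>z. z) -` E \<inter> space (restrict_space \<nu> (ball 0 r)) = E \<inter> ball 0 r"
    using ball_subset_eball by (auto simp: space_restrict_space lf_space)
  have b: "ball 0 r \<inter> space \<nu> \<in> sets \<nu>"
    using lf_set[of UNIV] ball_subset_eball by (simp add: lf_space Int_absorb2)
  have "emeasure (trunc \<nu> r) E = emeasure (restrict_space \<nu> (ball 0 r)) (E \<inter> ball 0 r)"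
    unfolding trunc_def emeasure_distr[OF trunc_measurable E] sp ..
  also have "\<dots> = emeasure \<nu> (E \<inter> ball 0 r)"
    by (rule emeasure_restrict_space[OF b]) auto
  finally show ?thesis .
qed

lemma emeasure_ball_finite: "emeasure \<nu> (ball 0 r) < \<infinity>"
proof -
  have "emeasure \<nu> (ball 0 r) \<le> emeasure \<nu> (cball 0 r)"
    by (rule emeasure_mono) (use ball_subset_eball in \<open>auto simp: lf_sets sets_restrict_space_iff\<close>)
  also have "\<dots> < \<infinity>" using lf compact_cball ball_subset_eball(2) unfolding locally_finite_borel_on_def by blast
  finally show ?thesis .
qed

lemma finite_measure_trunc: "finite_measure (trunc \<nu> r)"
  using emeasure_ball_finite by (intro finite_measureI) (auto simp: emeasure_trunc)

lemma trunc_rotation_invariant: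
  assumes "rotation_invariant \<nu>"
  shows "rotation_invariant_borel (trunc \<nu> r)"
  unfolding rotation_invariant_borel_def
proof (intro conjI allI impI)
  fix \<alpha> assume a: "cmod \<alpha> = 1"
  then obtain \<theta> where \<alpha>: "\<alpha> = cis \<theta>" by (metis cis_Arg norm_zero sgn_eq complex_sgn_def divide_self_if scaleR_one inverse_1 zero_neq_one)
  have inv: "distr \<nu> \<nu> ((*) \<alpha>) = \<nu>" using assms by (simp add: rotation_invariant_def \<alpha>)
  have eb: "\<alpha> * z \<in> eball 0 R0 \<longleftrightarrow> z \<in> eball 0 R0" "\<alpha> * z \<in> ball 0 r \<longleftrightarrow> z \<in> ball 0 r" for z
    using a by (auto simp: in_eball_0_iff norm_mult)
  have am: "(*) \<alpha> \<in> measurable \<nu> \<nu>"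
    unfolding measurable_cong_sets[OF lf_sets lf_sets]
    by (intro measurable_restrict_space3) (use eb in auto)
  show "distr (trunc \<nu> r) borel ((*) \<alpha>) = trunc \<nu> r"
  proof (rule measure_eqI)
    fix E assume "E \<in> sets (distr (trunc \<nu> r) borel ((*) \<alpha>))"
    then have E[measurable]: "E \<in> sets borel" by simp
    have v: "(*) \<alpha> -` E \<in> sets borel"
      by (rule measurable_sets_borel[OF _ E]) simp
    have "emeasure (distr (trunc \<nu> r) borel ((*) \<alpha>)) E = emeasure (trunc \<nu> r) ((*) \<alpha> -` E)"
      by (subst emeasure_distr) (auto simp: measurable_cong_sets[OF sets_trunc refl])
    also have "\<dots> = emeasure \<nu> ((*) \<alpha> -` E \<inter> ball 0 r)" by (rule emeasure_trunc[OF v])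
    also have "(*) \<alpha> -` E \<inter> ball 0 r = (*) \<alpha> -` (E \<inter> ball 0 r) \<inter> space \<nu>"
      using eb ball_subset_eball by (auto simp: lf_space)
    also have "emeasure \<nu> \<dots> = emeasure (distr \<nu> \<nu> ((*) \<alpha>)) (E \<inter> ball 0 r)"
      by (rule emeasure_distr[symmetric, OF am lf_set[OF E]])
    also have "\<dots> = emeasure (trunc \<nu> r) E" by (simp add: inv emeasure_trunc)
    finally show "emeasure (distr (trunc \<nu> r) borel ((*) \<alpha>)) E = emeasure (trunc \<nu> r) E" .
  qed simp
qed simp

end

text \<open>The truncations are finite and agree on centred balls, hence coincide; radii increasing
  to R0 then recover both measures on the whole disk.\<close>

lemma radial_unique:
  assumes R0: "R0 > 0"
    and lf: "locally_finite_borel_on (eball 0 R0) \<nu>" "locally_finite_borel_on (eball 0 R0) \<nu>'"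
    and ri: "rotation_invariant \<nu>" "rotation_invariant \<nu>'"
    and eq: "\<And>r. 0 < r \<Longrightarrow> ereal r < R0 \<Longrightarrow> measure \<nu> (ball 0 r) = measure \<nu>' (ball 0 r)"
  shows "\<nu> = \<nu>'"
proof -
  have sets: "sets \<nu> = sets \<nu>'" using lf by (simp add: locally_finite_borel_on_def)
  have ball: "emeasure \<nu> (ball 0 r) = emeasure \<nu>' (ball 0 r)" if "0 < r" "ereal r < R0" for r
    using eq[OF that] emeasure_ball_finite[OF lf(1) that(2)] emeasure_ball_finite[OF lf(2) that(2)]
    by (simp add: emeasure_eq_ennreal_measure less_top)
  have tr: "trunc \<nu> r = trunc \<nu>' r" if r: "0 < r" "ereal r < R0" for r
  proof (rule rotation_invariant_eqI)
    fix t :: real assume t: "t > 0"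
    have b: "ball (0::complex) t \<inter> ball 0 r = ball 0 (min t r)" by auto
    have "ereal (min t r) < R0" by (rule ereal_le_less[OF _ r(2)]) simp
    then have "emeasure \<nu> (ball 0 (min t r)) = emeasure \<nu>' (ball 0 (min t r))"
      by (intro ball) (use r t in auto)
    then show "emeasure (trunc \<nu> r) (ball 0 t) = emeasure (trunc \<nu>' r) (ball 0 t)"
      using r by (simp add: emeasure_trunc[OF lf(1)] emeasure_trunc[OF lf(2)] b)
  qed (use r finite_measure_trunc[OF lf(1)] finite_measure_trunc[OF lf(2)] 
        trunc_rotation_invariant[OF lf(1) _ ri(1)] trunc_rotation_invariant[OF lf(2) _ ri(2)] in auto)
  obtain X where X: "incseq X" "\<And>i::nat. 0 < ereal (X i)" "\<And>i. ereal (X i) < R0" "(\<lambda>i. ereal (X i)) \<longlonglongrightarrow> R0"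
    using ereal_incseq_approx[OF R0] by blast
  show ?thesis
  proof (rule measure_eqI[OF sets])
    fix E assume E: "E \<in> sets \<nu>"
    then have Eb: "E \<in> sets borel" "E \<subseteq> eball 0 R0"
      unfolding lf_sets[OF lf(1) X(3)[of 0]]
      by (auto simp: sets_restrict_space_iff)
    have U: "(\<Union>i. E \<inter> ball 0 (X i)) = E"
    proof -
      have "\<exists>i. z \<in> ball 0 (X i)" if "z \<in> E" for z
      proof -
        have "ereal (cmod z) < R0" using that Eb by (auto simp: in_eball_0_iff)
        then have "eventually (\<lambda>i. ereal (cmod z) < ereal (X i)) sequentially"
          using X(4) by (rule order_tendstoD(1)[rotated])
        then show ?thesis by (auto simp: eventually_sequentially)
      qed
      then show ?thesis by auto
    qed
    have inc: "incseq (\<lambda>i. E \<inter> ball 0 (X i))"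
      using X(1) by (force simp: incseq_def)
    have s: "emeasure \<mu> E = (SUP i. emeasure (trunc \<mu> (X i)) E)"
      if l: "locally_finite_borel_on (eball 0 R0) \<mu>" for \<mu>
    proof -
      have "(SUP i. emeasure \<mu> (E \<inter> ball 0 (X i))) = emeasure \<mu> (\<Union>i. E \<inter> ball 0 (X i))"
        by (rule SUP_emeasure_incseq[OF _ inc]) (use lf_set[OF l X(3)] Eb in auto)
      then show ?thesis using Eb X(3) unfolding U by (simp add: emeasure_trunc[OF l])
    qed
    show "emeasure \<nu> E = emeasure \<nu>' E"
      unfolding s[OF lf(1)] s[OF lf(2)] using tr X by simp
  qed
qed

section \<open>Construction of a radial measure from the masses of balls\<close>

locale radial_profile =
  fixes L :: "real \<Rightarrow> real" and R0 :: ereal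
  assumes R0: "R0 > 0"
    and L_mono: "\<And>r r'. 0 < r \<Longrightarrow> r \<le> r' \<Longrightarrow> ereal r' < R0 \<Longrightarrow> L r \<le> L r'"
    and L_nonneg: "\<And>r. 0 < r \<Longrightarrow> ereal r < R0 \<Longrightarrow> 0 \<le> L r"
    and L_left: "\<And>r x. 0 < r \<Longrightarrow> ereal r < R0 \<Longrightarrow> x < L r \<Longrightarrow> \<exists>r'. 0 < r' \<and> r' < r \<and> x < L r'"
begin

definition above :: "real \<Rightarrow> real set" where "above t = {r. 0 < r \<and> ereal r < R0 \<and> t < L r}"
text \<open>The levels strictly between 0 and the total mass; for them the infimum defining
  \<open>q\<close> is taken over a nonempty set.\<close>

definition Q :: "real set" where "Q = {t. 0 < t \<and> above t \<noteq> {}}"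
definition q :: "real \<Rightarrow> real" where "q t = Inf (above t)"

lemma above_bdd: "bdd_below (above t)" by (auto simp: above_def intro!: bdd_belowI[of _ 0])

text \<open>Left continuity of L makes the equivalence hold at every level, jumps and flat pieces
  included, so that open balls receive exactly the mass L.\<close>

lemma q_less_iff: "t \<in> Q \<Longrightarrow> 0 < x \<Longrightarrow> ereal x < R0 \<Longrightarrow> q t < x \<longleftrightarrow> t < L x"
proof -
  assume t: "t \<in> Q" and x: "0 < x" "ereal x < R0"
  have "q t < x \<longleftrightarrow> (\<exists>r\<in>above t. r < x)"
    unfolding q_def using t above_bdd by (intro cInf_less_iff) (auto simp: Q_def)
  also have "\<dots> \<longleftrightarrow> t < L x"
  proof
    assume "\<exists>r\<in>above t. r < x"
    then obtain r where "0 < r" "r < x" "t < L r" by (auto simp: above_def)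
    then show "t < L x" using L_mono[of r x] x by simp
  next
    assume "t < L x"
    from L_left[OF x this] obtain r' where r': "0 < r'" "r' < x" "t < L r'" by blast
    moreover have "ereal r' < R0" using r' x by (meson ereal_less_eq(3) le_less_trans less_imp_le)
    ultimately show "\<exists>r\<in>above t. r < x" by (auto simp: above_def)
  qed
  finally show ?thesis .
qed

lemma q_nonneg: "t \<in> Q \<Longrightarrow> 0 \<le> q t"
  unfolding q_def by (rule cInf_greatest) (auto simp: Q_def above_def)

lemma q_less_R0: "t \<in> Q \<Longrightarrow> ereal (q t) < R0"
proof -
  assume "t \<in> Q"
  then obtain r where r: "r \<in> above t" by (auto simp: Q_def)
  then have "q t \<le> r" unfolding q_def using above_bdd by (rule cInf_lower)
  then show ?thesis using r ereal_le_less[of "q t" r R0] by (auto simp: above_def)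
qed

lemma Q_measurable [measurable]: "Q \<in> sets borel"
proof -
  obtain X where X0: "incseq X" and X: "\<And>i::nat. 0 < ereal (X i)" "\<And>i. ereal (X i) < R0" "(\<lambda>i. ereal (X i)) \<longlonglongrightarrow> R0"
    using ereal_incseq_approx[OF R0] by blast
  have "Q = (\<Union>i. {0<..<L (X i)})"
  proof (intro equalityI subsetI)
    fix t assume "t \<in> Q"
    then obtain r where r: "0 < t" "0 < r" "ereal r < R0" "t < L r" by (auto simp: Q_def above_def)
    have "eventually (\<lambda>i. ereal r < ereal (X i)) sequentially"
      using X(3) r(3) by (rule order_tendstoD(1))
    then obtain i where "r < X i" by (auto simp: eventually_sequentially)
    then have "t < L (X i)" using L_mono[of r "X i"] r X(2)[of i] by simp
    then show "t \<in> (\<Union>i. {0<..<L (X i)})" using r(1) by auto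
  next
    fix t assume "t \<in> (\<Union>i. {0<..<L (X i)})"
    then show "t \<in> Q" using X(1,2) by (auto simp: Q_def above_def)
  qed
  then show ?thesis by simp
qed

lemma q_measurable [measurable]: "q \<in> borel_measurable (restrict_space borel Q)"
proof (rule borel_measurable_mono_on_fnc)
  show "mono_on Q q"
  proof (rule mono_onI)
    fix s t assume "s \<in> Q" "t \<in> Q" "s \<le> t"
    then show "q s \<le> q t" unfolding q_def
      by (intro cInf_superset_mono above_bdd) (auto simp: Q_def above_def)
  qed
qed

text \<open>\<open>q\<close> is a generalized inverse of \<open>L\<close>, so it maps Lebesgue measure to the radial part of \<open>\<mu>\<close>.
  The measure \<^const>\<open>circ\<close> charges only the unit circle, but its space is the whole plane: the case
  distinction keeps the image inside the disk everywhere.\<close>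

definition \<mu> :: "complex measure" where
  "\<mu> = distr (restrict_space lborel Q \<Otimes>\<^sub>M circ) (restrict_space borel (eball 0 R0)) (\<lambda>(t, \<omega>). of_real (q t) * (if cmod \<omega> = 1 then \<omega> else 1))"

lemma map_measurable: "(\<lambda>(t, \<omega>). of_real (q t) * (if cmod \<omega> = 1 then \<omega> else 1)) \<in> measurable (restrict_space lborel Q \<Otimes>\<^sub>M circ) (restrict_space borel (eball 0 R0))"
proof (rule measurable_restrict_space2)
  show "(\<lambda>(t, \<omega>). of_real (q t) * (if cmod \<omega> = 1 then \<omega> else 1)) \<in> space (restrict_space lborel Q \<Otimes>\<^sub>M circ) \<rightarrow> eball 0 R0"
    using q_nonneg q_less_R0 by (auto simp: space_pair_measure space_restrict_space in_eball_0_iff norm_mult)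
  have [measurable]: "q \<in> borel_measurable (restrict_space lborel Q)"
    using q_measurable by (simp add: measurable_cong_sets[OF sets_restrict_space_cong[OF sets_lborel] refl])
  show "(\<lambda>(t, \<omega>). of_real (q t) * (if cmod \<omega> = 1 then \<omega> else 1)) \<in> borel_measurable (restrict_space lborel Q \<Otimes>\<^sub>M circ)"
    by measurable
qed

lemma sets_\<mu> [simp]: "sets \<mu> = sets (restrict_space borel (eball 0 R0))" and space_\<mu>: "space \<mu> = eball 0 R0"
  by (auto simp: \<mu>_def space_restrict_space)

lemma emeasure_\<mu>:
  assumes "E \<in> sets \<mu>"
  shows "emeasure \<mu> E = (\<integral>\<^sup>+t. emeasure circ {\<omega>. of_real (q t) * \<omega> \<in> E} \<partial>restrict_space lborel Q)"
proof -
  let ?f = "\<lambda>(t, \<omega>). of_real (q t) * (if cmod \<omega> = 1 then \<omega> else 1)"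
  let ?V = "?f -` E \<inter> space (restrict_space lborel Q \<Otimes>\<^sub>M circ)"
  have E: "E \<in> sets (restrict_space borel (eball 0 R0))" using assms by simp
  then have Eb[measurable]: "E \<in> sets borel"
    by (subst (asm) sets_restrict_space_iff) auto
  have V: "?V \<in> sets (restrict_space lborel Q \<Otimes>\<^sub>M circ)"
    by (rule measurable_sets[OF map_measurable E])
  have "emeasure \<mu> E = emeasure (restrict_space lborel Q \<Otimes>\<^sub>M circ) ?V"
    unfolding \<mu>_def by (rule emeasure_distr[OF map_measurable E])
  also have "\<dots> = (\<integral>\<^sup>+t. emeasure circ (Pair t -` ?V) \<partial>restrict_space lborel Q)"
    by (rule circ.emeasure_pair_measure_alt[OF V])
  also have "\<dots> = (\<integral>\<^sup>+t. emeasure circ {\<omega>. of_real (q t) * \<omega> \<in> E} \<partial>restrict_space lborel Q)"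
  proof (rule nn_integral_cong)
    fix t assume t: "t \<in> space (restrict_space lborel Q)"
    show "emeasure circ (Pair t -` ?V) = emeasure circ {\<omega>. of_real (q t) * \<omega> \<in> E}"
    proof (rule emeasure_eq_AE)
      show "AE x in circ. (x \<in> Pair t -` ?V) = (x \<in> {\<omega>. of_real (q t) * \<omega> \<in> E})"
        using AE_circ_unit by eventually_elim (use t in \<open>auto simp: space_pair_measure\<close>)
      show "Pair t -` ?V \<in> sets circ" using V by (rule sets_Pair1)
      have "{\<omega> \<in> space borel. of_real (q t) * \<omega> \<in> E} \<in> sets borel" by measurable
      then show "{\<omega>. of_real (q t) * \<omega> \<in> E} \<in> sets circ" by simp
    qed
  qed
  finally show ?thesis .
qed

text \<open>For almost every \<omega> the image point lies in the ball exactly when t < L r, so the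
  mass is the length of the interval (0, L r).\<close>

lemma emeasure_\<mu>_ball:
  assumes r: "0 < r" "ereal r < R0"
  shows "emeasure \<mu> (ball 0 r) = ennreal (L r)"
proof -
  have "ball 0 r \<subseteq> eball (0::complex) R0" using r ball_subset_eball_0 by blast
  then have "ball 0 r \<in> sets \<mu>" by (simp add: sets_restrict_space_iff)
  then have "emeasure \<mu> (ball 0 r) = (\<integral>\<^sup>+t. emeasure circ {\<omega>. of_real (q t) * \<omega> \<in> ball 0 r} \<partial>restrict_space lborel Q)"
    by (rule emeasure_\<mu>)
  also have "\<dots> = (\<integral>\<^sup>+t. indicator {0<..<L r} t \<partial>restrict_space lborel Q)"
  proof (rule nn_integral_cong)
    fix t assume "t \<in> space (restrict_space lborel Q)"
    then have t: "t \<in> Q" by (simp add: space_restrict_space)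
    then have t0: "0 < t" by (simp add: Q_def)
    have [measurable]: "{\<omega>. of_real (q t) * \<omega> \<in> ball (0::complex) r} \<in> sets borel"
    proof -
      have "{\<omega> \<in> space borel. of_real (q t) * \<omega> \<in> ball (0::complex) r} \<in> sets borel" by measurable
      then show ?thesis by simp
    qed
    have ae: "AE \<omega> in circ. (of_real (q t) * \<omega> \<in> ball 0 r) = (t < L r)"
      using AE_circ_unit by eventually_elim (use q_less_iff[OF t r] q_nonneg[OF t] in \<open>auto simp: norm_mult\<close>)
    show "emeasure circ {\<omega>. of_real (q t) * \<omega> \<in> ball 0 r} = indicator {0<..<L r} t"
    proof (cases "t < L r")
      case True
      have "emeasure circ {\<omega>. of_real (q t) * \<omega> \<in> ball 0 r} = emeasure circ UNIV"
        by (rule emeasure_eq_AE) (use ae True in auto)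
      then show ?thesis using True t0 circ.emeasure_space_1 by simp
    next
      case False
      have "emeasure circ {\<omega>. of_real (q t) * \<omega> \<in> ball 0 r} = emeasure circ {}"
        by (rule emeasure_eq_AE) (use ae False in auto)
      then show ?thesis using False by simp
    qed
  qed
  also have "\<dots> = (\<integral>\<^sup>+t. indicator {0<..<L r} t * indicator Q t \<partial>lborel)"
    by (rule nn_integral_restrict_space) auto
  also have "\<dots> = (\<integral>\<^sup>+t. indicator {0<..<L r} t \<partial>lborel)"
  proof (rule nn_integral_cong)
    fix t
    have "t \<in> Q" if "0 < t" "t < L r" using that r by (auto simp: Q_def above_def)
    then show "(indicator {0<..<L r} t * indicator Q t :: ennreal) = indicator {0<..<L r} t"
      by (auto split: split_indicator)
  qed
  also have "\<dots> = ennreal (L r)" using L_nonneg[OF r] by simp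
  finally show ?thesis .
qed

lemma locally_finite_\<mu>: "locally_finite_borel_on (eball 0 R0) \<mu>"
  unfolding locally_finite_borel_on_def
proof (intro conjI allI impI sets_\<mu>)
  fix K :: "complex set" assume K: "compact K \<and> K \<subseteq> eball 0 R0"
  show "emeasure \<mu> K < \<infinity>"
  proof (cases "K = {}")
    case False
    obtain z where z: "z \<in> K" "\<And>w. w \<in> K \<Longrightarrow> cmod w \<le> cmod z"
      using continuous_attains_sup[of K cmod] K False by (auto intro: continuous_intros)
    then have "ereal (cmod z) < R0" using K by (auto simp: in_eball_0_iff)
    then obtain r where r: "ereal (cmod z) < ereal r" "ereal r < R0" using ereal_dense2 by blast
    have r0: "0 < r" using r(1) norm_ge_zero[of z] by (simp del: norm_ge_zero)
    have "ball 0 r \<subseteq> eball (0::complex) R0" using r ball_subset_eball_0 by blast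
    then have "ball 0 r \<in> sets \<mu>" by (simp add: sets_restrict_space_iff)
    moreover have "K \<subseteq> ball 0 r" using z(2) r(1) by force
    ultimately have "emeasure \<mu> K \<le> emeasure \<mu> (ball 0 r)" by (intro emeasure_mono)
    then show ?thesis using emeasure_\<mu>_ball[OF r0 r(2)] by (auto intro: le_less_trans)
  qed simp
qed

lemma rotation_invariant_\<mu>: "rotation_invariant \<mu>"
  unfolding rotation_invariant_def
proof
  fix \<theta>
  have eb: "cis \<theta> * z \<in> eball 0 R0 \<longleftrightarrow> z \<in> eball 0 R0" for z by (auto simp: in_eball_0_iff norm_mult)
  have am: "(*) (cis \<theta>) \<in> measurable \<mu> \<mu>"
    unfolding measurable_cong_sets[OF sets_\<mu> sets_\<mu>]
    by (intro measurable_restrict_space3) (use eb in auto)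
  show "distr \<mu> \<mu> ((*) (cis \<theta>)) = \<mu>"
  proof (rule measure_eqI)
    fix E assume "E \<in> sets (distr \<mu> \<mu> ((*) (cis \<theta>)))"
    then have E: "E \<in> sets \<mu>" by simp
    then have Eb[measurable]: "E \<in> sets borel" and Es: "E \<subseteq> eball 0 R0"
      by (auto simp: sets_restrict_space_iff)
    have "emeasure (distr \<mu> \<mu> ((*) (cis \<theta>))) E = emeasure \<mu> ((*) (cis \<theta>) -` E \<inter> space \<mu>)"
      by (rule emeasure_distr[OF am E])
    also have "\<dots> = (\<integral>\<^sup>+t. emeasure circ {\<omega>. of_real (q t) * \<omega> \<in> (*) (cis \<theta>) -` E \<inter> space \<mu>} \<partial>restrict_space lborel Q)"
      by (rule emeasure_\<mu>[OF measurable_sets[OF am E]])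
    also have "\<dots> = (\<integral>\<^sup>+t. emeasure circ {\<omega>. of_real (q t) * \<omega> \<in> E} \<partial>restrict_space lborel Q)"
    proof (rule nn_integral_cong)
      fix t
      have [measurable]: "{\<omega>. of_real (q t) * \<omega> \<in> E} \<in> sets borel"
      proof -
        have "{\<omega> \<in> space borel. of_real (q t) * \<omega> \<in> E} \<in> sets borel" by measurable
        then show ?thesis by simp
      qed
      have "{\<omega>. of_real (q t) * \<omega> \<in> (*) (cis \<theta>) -` E \<inter> space \<mu>} = (*) (cis \<theta>) -` {\<omega>. of_real (q t) * \<omega> \<in> E} \<inter> space circ"
      proof -
        have m: "of_real (q t) * (cis \<theta> * \<omega>) = cis \<theta> * (of_real (q t) * \<omega>)" for \<omega> by (simp add: mult_ac)
        have "x \<in> eball 0 R0" if "cis \<theta> * x \<in> E" for x using eb[of x] that Es by blast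
        then show ?thesis unfolding vimage_def space_\<mu> by (auto simp: m simp del: in_eball_iff)
      qed
      also have "emeasure circ \<dots> = emeasure (distr circ borel ((*) (cis \<theta>))) {\<omega>. of_real (q t) * \<omega> \<in> E}"
        by (rule emeasure_distr[symmetric]) auto
      also have "\<dots> = emeasure circ {\<omega>. of_real (q t) * \<omega> \<in> E}" by (simp add: distr_circ_rotate)
      finally show "emeasure circ {\<omega>. of_real (q t) * \<omega> \<in> (*) (cis \<theta>) -` E \<inter> space \<mu>} = emeasure circ {\<omega>. of_real (q t) * \<omega> \<in> E}" .
    qed
    also have "\<dots> = emeasure \<mu> E" by (rule emeasure_\<mu>[OF E, symmetric])
    finally show "emeasure (distr \<mu> \<mu> ((*) (cis \<theta>))) E = emeasure \<mu> E" .
  qed simp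
qed

end

section \<open>The potential of the limit measure\<close>

text \<open>As a function of s, \<open>ln (max (exp s) x)\<close> has slope 1 where x < exp s and
  slope 0 below. Integrated over x = \<open>cmod a\<close>, the two bounds become masses of
  balls.\<close>

lemma ln_max_increment:
  fixes s t x :: real
  assumes "s < t" "0 \<le> x"
  shows "(if x < exp s then t - s else 0) \<le> ln (max (exp t) x) - ln (max (exp s) x)"
    and "ln (max (exp t) x) - ln (max (exp s) x) \<le> (if x < exp t then t - s else 0)"
proof -
  have e: "exp s < exp t" using assms by simp
  have pos: "0 < max (exp s) x" "0 < max (exp t) x" by (auto simp: less_max_iff_disj)
  show "(if x < exp s then t - s else 0) \<le> ln (max (exp t) x) - ln (max (exp s) x)"
  proof (cases "x < exp s")
    case True
    then have "max (exp t) x = exp t" "max (exp s) x = exp s" using e by linarith+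
    then show ?thesis using True by simp
  next
    case False
    have "max (exp s) x \<le> max (exp t) x" using e by linarith
    then have "ln (max (exp s) x) \<le> ln (max (exp t) x)" using pos by (intro ln_mono)
    then show ?thesis using False by simp
  qed
  show "ln (max (exp t) x) - ln (max (exp s) x) \<le> (if x < exp t then t - s else 0)"
  proof (cases "x < exp t")
    case True
    have "ln (exp s) \<le> ln (max (exp s) x)" by (intro ln_mono) auto
    then show ?thesis using True by (simp add: max_absorb1)
  next
    case False
    then have "max (exp t) x = x" "max (exp s) x = x" using e by linarith+
    then show ?thesis using False by simp
  qed
qed

context convex_profile
begin

lemma radial_profile: "radial_profile (\<lambda>r. D (ln r)) R0"
proof
  show "R0 > 0" by (rule R0_pos)
  show "D (ln r) \<le> D (ln r')" if "0 < r" "r \<le> r'" "ereal r' < R0" for r r'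
    using that by (intro D_mono) auto
  show "0 \<le> D (ln r)" if "0 < r" "ereal r < R0" for r
    using that by (intro D_nonneg) auto
  fix r x assume r: "0 < r" "ereal r < R0" "x < D (ln r)"
  then obtain s where s: "s < ln r" "x < D s" using D_left_cont[of "ln r" x] by auto
  have "exp s < exp (ln r)" using s(1) by (simp only: exp_less_mono)
  then have "exp s < r" using r by simp
  then show "\<exists>r'>0. r' < r \<and> x < D (ln r')" using s by (intro exI[of _ "exp s"]) auto
qed

text \<open>The increments of \<open>V\<close> lie between the same bounds in terms of D as those of
  I, so the two functions differ by a constant up to \<open>ln R1\<close>. By Jensen,
  \<open>ln (max (cmod z) (cmod a))\<close> is the mean of \<open>ln (cmod (z - w))\<close> over the
  circle of radius \<open>cmod a\<close>; for rotation invariant N the integral is thus its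
  logarithmic potential.\<close>

lemma log_potential:
  fixes N :: "complex measure"
  assumes N: "finite_measure N" "sets N = sets borel"
    and R1: "0 < R1" "ereal R1 < R0"
    and ball: "\<And>r. 0 < r \<Longrightarrow> r \<le> R1 \<Longrightarrow> measure N (ball 0 r) = D (ln r)"
    and supp: "AE a in N. a \<in> ball 0 R1"
  obtains c where "\<And>z. z \<noteq> 0 \<Longrightarrow> cmod z \<le> R1 \<Longrightarrow> u z = c + (\<integral>a. ln (max (cmod z) (cmod a)) \<partial>N)"
proof -
  interpret N: finite_measure N by fact
  note [measurable_cong] = N(2)
  define V where "V s = (\<integral>a. ln (max (exp s) (cmod a)) \<partial>N)" for s
  have Vi: "integrable N (\<lambda>a. ln (max (exp s) (cmod a)))" if "exp s \<le> R1" for s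
  proof (rule N.integrable_const_bound[where B="\<bar>s\<bar> + \<bar>ln R1\<bar>"])
    show "AE a in N. norm (ln (max (exp s) (cmod a))) \<le> \<bar>s\<bar> + \<bar>ln R1\<bar>"
      using supp
    proof eventually_elim
      case (elim a)
      have "ln (exp s) \<le> ln (max (exp s) (cmod a))" by (intro ln_mono) auto
      moreover have "ln (max (exp s) (cmod a)) \<le> ln R1"
        using elim that by (intro ln_mono) (auto simp: max_def not_le intro: less_le_trans)
      ultimately show ?case by auto
    qed
  qed measurable
  have sq: "D x * (y - x) \<le> V y - V x \<and> V y - V x \<le> D y * (y - x)" if xy: "x < y" "exp y \<le> R1" for x y
  proof -
    have x: "exp x \<le> R1" using xy by (meson exp_less_mono less_le_trans less_imp_le)
    have d: "V y - V x = (\<integral>a. ln (max (exp y) (cmod a)) - ln (max (exp x) (cmod a)) \<partial>N)"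
      unfolding V_def using Vi x xy by simp
    have i: "integrable N (\<lambda>a. ln (max (exp y) (cmod a)) - ln (max (exp x) (cmod a)))"
      using Vi x xy by simp
    have b: "measure N (ball 0 (exp s)) * c = (\<integral>a. (if cmod a < exp s then c else 0) \<partial>N)"
      "integrable N (\<lambda>a. (if cmod a < exp s then c else 0))" for s and c :: real
    proof -
      have e: "(\<lambda>a. (if cmod a < exp s then c else 0)) = (\<lambda>a. c * indicat_real (ball 0 (exp s)) a)" by (auto simp: fun_eq_iff)
      have ii: "integrable N (indicat_real (ball 0 (exp s)))"
        by (rule N.integrable_const_bound[where B=1]) auto
      show "measure N (ball 0 (exp s)) * c = (\<integral>a. (if cmod a < exp s then c else 0) \<partial>N)"
        unfolding e using sets_eq_imp_space_eq[OF N(2)] by simp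
      show "integrable N (\<lambda>a. (if cmod a < exp s then c else 0))"
        unfolding e using ii by simp
    qed
    have "D x * (y - x) = measure N (ball 0 (exp x)) * (y - x)" using ball[of "exp x"] x by simp
    also have "\<dots> \<le> V y - V x"
      unfolding d b(1) by (rule integral_mono[OF b(2) i]) (use ln_max_increment(1)[OF xy(1)] in auto)
    finally have 1: "D x * (y - x) \<le> V y - V x" .
    have "V y - V x \<le> measure N (ball 0 (exp y)) * (y - x)"
      unfolding d b(1) by (rule integral_mono[OF i b(2)]) (use ln_max_increment(2)[OF xy(1)] in auto)
    also have "\<dots> = D y * (y - x)" using ball[of "exp y"] xy by simp
    finally show ?thesis using 1 by simp
  qed
  have eq: "I (ln R1) - I s = V (ln R1) - V s" if "exp s \<le> R1" for s
  proof (rule squeeze_by_increments[where D=D])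
    have "s = ln (exp s)" by simp
    also have "\<dots> \<le> ln R1" using that by (intro ln_mono) auto
    finally show "s \<le> ln R1" .
    fix x y assume xy: "s \<le> x" "x < y" "y \<le> ln R1"
    have ey: "exp y \<le> R1" using xy R1 by (metis exp_le_cancel_iff exp_ln)
    then have "y \<in> S" using R1 ereal_le_less by auto
    then show "D x * (y - x) \<le> I y - I x \<and> I y - I x \<le> D y * (y - x)" using D_increments[of x y] xy by auto
    show "D x * (y - x) \<le> V y - V x \<and> V y - V x \<le> D y * (y - x)" by (rule sq) fact+
  qed
  show ?thesis
  proof (rule that[of "I (ln R1) - V (ln R1)"])
    fix z :: complex assume z: "z \<noteq> 0" "cmod z \<le> R1"
    then show "u z = I (ln R1) - V (ln R1) + (\<integral>a. ln (max (cmod z) (cmod a)) \<partial>N)"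
      using eq[of "ln (cmod z)"] by (simp add: u_def V_def)
  qed
qed

end

section \<open>The Jensen kernel as a smoothing kernel\<close>

context test_function
begin

text \<open>The kernel is nonnegative almost everywhere and supported in the disk of radius \<rho>,
  and c is its mass, so \<open>pot \<rho> a\<close> is c times a weighted average of \<psi> near a.
  Positivity of c follows because the kernel is at least \<open>ln 2\<close> on the disk of half the
  radius.\<close>

lemma pot_bounds:
  assumes "\<rho> > 0"
  defines "c \<equiv> (\<integral>z. ln (max \<rho> (cmod z)) - ln (cmod z) \<partial>lborel)"
  shows "integrable lborel (\<lambda>z. ln (max \<rho> (cmod z)) - ln (cmod z))"
    and "c > 0"
    and "\<And>e. (\<And>z. cmod (z - a) < \<rho> \<Longrightarrow> \<bar>\<psi> z - \<psi> a\<bar> \<le> e) \<Longrightarrow> \<bar>pot \<rho> a - c * \<psi> a\<bar> \<le> c * e"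
proof -
  let ?h = "\<lambda>z. ln (max \<rho> (cmod z)) - ln (cmod z)"
  have h0: "?h z = 0" if "cmod z \<ge> \<rho>" for z using that by (simp add: max_absorb2)
  have hpos: "?h z > 0" if "cmod z < \<rho>" "z \<noteq> 0" for z using that assms(1) by (simp add: max_absorb1)
  have hnn: "AE z in lborel. 0 \<le> ?h z"
    using AE_lborel_norm_neq[of 0 0]
  proof eventually_elim
    case (elim z)
    then show ?case using h0[of z] hpos[of z] by (cases "cmod z < \<rho>") auto
  qed
  have e: "?h z = indicator (ball 0 \<rho>) z * ln \<rho> - indicator (ball 0 \<rho>) z * ln (cmod z)" for z
    using h0[of z] by (cases "cmod z < \<rho>") (auto simp: max_absorb1)
  show hi: "integrable lborel ?h"
    unfolding e by (intro Bochner_Integration.integrable_diff integrable_mult_left integrable_indicator_balls integrable_ln_norm_0)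
  have "(\<integral>z. indicator (ball (0::complex) (\<rho>/2)) z * ln 2 \<partial>lborel) \<le> c"
    unfolding c_def
  proof (rule integral_mono_AE)
    show "integrable lborel (\<lambda>z. indicator (ball (0::complex) (\<rho>/2)) z * ln 2 :: real)"
      by (intro integrable_mult_left integrable_indicator_balls)
    show "AE z in lborel. indicator (ball (0::complex) (\<rho>/2)) z * ln 2 \<le> ?h z"
      using hnn AE_lborel_norm_neq[of 0 0]
    proof eventually_elim
      case (elim z)
      show ?case
      proof (cases "cmod z < \<rho> / 2")
        case True
        then have "ln 2 \<le> ln (\<rho> / cmod z)" using elim by (intro ln_mono) (auto simp: field_simps)
        then show ?thesis using True elim assms(1) by (simp add: max_absorb1 ln_div)
      qed (use elim in simp)
    qed
  qed (rule hi)
  moreover have "(\<integral>z. indicator (ball (0::complex) (\<rho>/2)) z * ln 2 \<partial>lborel) = measure lborel (ball (0::complex) (\<rho>/2)) * ln 2"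
    by simp
  moreover have "measure lborel (ball (0::complex) (\<rho>/2)) > 0"
    using content_ball_gt_0_iff[of "0::complex" "\<rho>/2"] assms(1) by simp
  ultimately show "c > 0" by (smt (verit) ln_2_less_1 ln_gt_zero mult_pos_pos)
  fix e' assume e': "\<And>z. cmod (z - a) < \<rho> \<Longrightarrow> \<bar>\<psi> z - \<psi> a\<bar> \<le> e'"
  have sh: "(\<lambda>z. ?h (z - a)) = (\<lambda>z. ?h (- a + z))" by (simp add: algebra_simps)
  have hia: "integrable lborel (\<lambda>z. ?h (z - a))"
    unfolding sh by (rule lborel_shift(1)[OF hi])
  have hca: "(\<integral>z. ?h (z - a) \<partial>lborel) = c"
    unfolding sh c_def by (rule lborel_shift(2)[where f="?h"]) measurable
  have hnna: "AE z in lborel. 0 \<le> ?h (z - a)"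
    using AE_lborel_norm_neq[of a 0]
  proof eventually_elim
    case (elim z)
    then show ?case using h0[of "z - a"] hpos[of "z - a"] by (cases "cmod (z - a) < \<rho>") auto
  qed
  have pi: "integrable lborel (\<lambda>z. \<psi> z * ?h (z - a))" by (rule integral_lap_ln(2)[OF assms(1)])
  have eq: "pot \<rho> a - c * \<psi> a = (\<integral>z. \<psi> z * ?h (z - a) - \<psi> a * ?h (z - a) \<partial>lborel)"
    unfolding pot_def using pi hia hca by simp
  have "\<bar>pot \<rho> a - c * \<psi> a\<bar> \<le> (\<integral>z. \<bar>\<psi> z * ?h (z - a) - \<psi> a * ?h (z - a)\<bar> \<partial>lborel)"
    unfolding eq by (rule integral_abs_bound)
  also have "\<dots> \<le> (\<integral>z. e' * ?h (z - a) \<partial>lborel)"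
  proof (rule integral_mono_AE)
    show "integrable lborel (\<lambda>z. \<bar>\<psi> z * ?h (z - a) - \<psi> a * ?h (z - a)\<bar>)" using pi hia by simp
    show "integrable lborel (\<lambda>z. e' * ?h (z - a))" using hia by simp
    show "AE z in lborel. \<bar>\<psi> z * ?h (z - a) - \<psi> a * ?h (z - a)\<bar> \<le> e' * ?h (z - a)"
      using hnna
    proof eventually_elim
      case (elim z)
      have "\<bar>\<psi> z * ?h (z - a) - \<psi> a * ?h (z - a)\<bar> = \<bar>\<psi> z - \<psi> a\<bar> * ?h (z - a)"
        using elim by (simp add: left_diff_distrib[symmetric] abs_mult)
      also have "\<dots> \<le> e' * ?h (z - a)"
        using e'[of z] h0[of "z - a"] elim by (cases "cmod (z - a) < \<rho>") (auto intro: mult_right_mono)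
      finally show ?case .
    qed
  qed
  also have "\<dots> = c * e'" using hca by simp
  finally show "\<bar>pot \<rho> a - c * \<psi> a\<bar> \<le> c * e'" .
qed

lemma pot_measurable [measurable]: "pot \<rho> \<in> borel_measurable borel"
  unfolding pot_def by measurable

text \<open>The factor 3 is 2 B for the oscillation of \<psi> plus B for the value
  \<open>\<psi> a\<close>. The bound serves integrability only.\<close>

lemma pot_abs_le:
  assumes "\<rho> > 0"
  shows "\<bar>pot \<rho> a\<bar> \<le> B * (\<integral>z. ln (max \<rho> (cmod z)) - ln (cmod z) \<partial>lborel) * 3"
proof -
  let ?c = "\<integral>z. ln (max \<rho> (cmod z)) - ln (cmod z) \<partial>lborel"
  have "\<bar>\<psi> z - \<psi> a\<bar> \<le> 2 * B" for z using bound[of z] bound[of a] by linarith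
  then have "\<bar>pot \<rho> a - ?c * \<psi> a\<bar> \<le> ?c * (2 * B)" using pot_bounds(3)[OF assms, of a] by blast
  moreover have "\<bar>?c * \<psi> a\<bar> \<le> ?c * B"
    using bound[of a] pot_bounds(2)[OF assms] by (auto simp: abs_mult intro: mult_left_mono)
  ultimately show ?thesis by (simp add: algebra_simps abs_le_iff)
qed

lemma pot_eq_0:
  assumes "\<rho> > 0" "cmod a > r + \<rho>"
  shows "pot \<rho> a = 0"
proof -
  have z: "\<psi> z = 0" if "cmod (z - a) < \<rho>" for z
    using that assms norm_triangle_ineq2[of a z] by (intro supp) (simp add: norm_minus_commute)
  have "\<psi> a = 0" using assms by (intro supp) simp
  then have "\<bar>pot \<rho> a - (\<integral>z. ln (max \<rho> (cmod z)) - ln (cmod z) \<partial>lborel) * \<psi> a\<bar> \<le> (\<integral>z. ln (max \<rho> (cmod z)) - ln (cmod z) \<partial>lborel) * 0"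
    using z by (intro pot_bounds(3)[OF assms(1)]) auto
  then show ?thesis using \<open>\<psi> a = 0\<close> by simp
qed

text \<open>The kernel \<open>ln (max (cmod z) (cmod a))\<close> is a circle mean of logarithms with
  singularities at \<open>cmod a * \<omega>\<close>. Fubini brings \<open>lap\<close> onto each of
  them and yields \<open>pot\<close>; rotation invariance of N then turns the mean over circles back
  into the integral of \<open>pot\<close> over N.\<close>

lemma integral_lap_radial_potential:
  fixes N :: "complex measure" and v :: "complex \<Rightarrow> real"
  assumes N: "finite_measure N" "rotation_invariant_borel N"
    and supp': "AE a in N. a \<in> ball 0 R1" and \<rho>: "\<rho> > 0" "r + \<rho> < R1" and R1: "R1 > 0"
    and vm: "(\<lambda>z. lap \<rho> z * v z) \<in> borel_measurable lborel"
    and v: "\<And>z. z \<noteq> 0 \<Longrightarrow> cmod z \<le> R1 \<Longrightarrow> v z = c + (\<integral>a. ln (max (cmod z) (cmod a)) \<partial>N)"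
  shows "(\<integral>z. lap \<rho> z * v z \<partial>lborel) = (\<integral>a. pot \<rho> a \<partial>N)"
proof -
  interpret N: finite_measure N by fact
  have sN: "sets N = sets borel" using N by (simp add: rotation_invariant_borel_def)
  note [measurable_cong] = sN
  let ?lm = "\<lambda>z a. ln (max (cmod z) (cmod a))"
  have lapi: "integrable lborel (lap \<rho>)"
    using integral_lap_harmonic(1)[of "\<lambda>_. 1" R1 \<rho>] \<rho> by simp
  \<comment> \<open>The constant function 1 is harmonic; hence the additive constant c in v drops
    out.\<close>
  have lap0: "(\<integral>z. lap \<rho> z \<partial>lborel) = 0"
    using integral_lap_harmonic(2)[of "\<lambda>_. 1" R1 \<rho>] \<rho> by simp
  \<comment> \<open>Between \<open>ln (cmod z)\<close> and \<open>ln R1\<close> the kernel has a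
    majorant that is the same for all a in the disk.\<close>
  have lb: "\<bar>lap \<rho> z * ?lm z a\<bar> \<le> 2 * B * (\<bar>indicator (ball 0 R1) z * ln (cmod z)\<bar> + \<bar>ln R1\<bar> * indicator (ball 0 R1) z)"
    if z: "z \<noteq> 0" and a: "a \<in> ball 0 R1" for z a
  proof (cases "z \<in> ball 0 R1")
    case True
    have "ln (cmod z) \<le> ?lm z a" using z by (intro ln_mono) auto
    moreover have "max (cmod z) (cmod a) \<le> R1" using a True by simp
    then have "?lm z a \<le> ln R1" using z by (intro ln_mono) (auto simp: less_max_iff_disj)
    ultimately have "\<bar>?lm z a\<bar> \<le> \<bar>ln (cmod z)\<bar> + \<bar>ln R1\<bar>" by auto
    then have "\<bar>lap \<rho> z\<bar> * \<bar>?lm z a\<bar> \<le> 2 * B * (\<bar>ln (cmod z)\<bar> + \<bar>ln R1\<bar>)"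
      using lap_bound[of \<rho> z] by (intro mult_mono) auto
    moreover have "indicat_real (ball 0 R1) z = 1" using True by simp
    ultimately show ?thesis by (simp only: abs_mult mult_1_left mult_1_right)
  next
    case False
    then have "lap \<rho> z = 0" using \<rho> by (intro lap_eq_0) auto
    then show ?thesis using False by simp
  qed
  have gi: "integrable lborel (\<lambda>z. 2 * B * (\<bar>indicator (ball 0 R1) z * ln (cmod z)\<bar> + \<bar>ln R1\<bar> * indicator (ball 0 R1) z))"
    by (intro integrable_mult_right Bochner_Integration.integrable_add integrable_abs integrable_ln_norm_0 integrable_indicator_balls)
  let ?C = "\<integral>z. 2 * B * (\<bar>indicator (ball 0 R1) z * ln (cmod z)\<bar> + \<bar>ln R1\<bar> * indicator (ball 0 R1) z) \<partial>lborel"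
  have nz: "AE z in lborel. z \<noteq> (0::complex)" using AE_lborel_norm_neq[of 0 0] by eventually_elim auto
  have li: "integrable lborel (\<lambda>z. lap \<rho> z * ?lm z a)" if a: "a \<in> ball 0 R1" for a
  proof (rule Bochner_Integration.integrable_bound[OF gi])
    show "AE z in lborel. norm (lap \<rho> z * ?lm z a) \<le> norm (2 * B * (\<bar>indicator (ball 0 R1) z * ln (cmod z)\<bar> + \<bar>ln R1\<bar> * indicator (ball 0 R1) z))"
      using nz
    proof eventually_elim
      case (elim z)
      show ?case using lb[OF elim a] abs_ge_self order_trans unfolding real_norm_def by blast
    qed
  qed measurable
  have lbi: "(\<integral>z. \<bar>lap \<rho> z * ?lm z a\<bar> \<partial>lborel) \<le> ?C" if a: "a \<in> ball 0 R1" for a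
  proof (rule integral_mono_AE[OF integrable_abs[OF li[OF a]] gi])
    show "AE z in lborel. \<bar>lap \<rho> z * ?lm z a\<bar> \<le> 2 * B * (\<bar>indicator (ball 0 R1) z * ln (cmod z)\<bar> + \<bar>ln R1\<bar> * indicator (ball 0 R1) z)"
      using nz
    proof eventually_elim
      case (elim z)
      show ?case by (rule lb[OF elim a])
    qed
  qed
  have m1: "(\<lambda>(a, z). lap \<rho> z * ?lm z a) \<in> borel_measurable (N \<Otimes>\<^sub>M lborel)" by measurable
  have ai: "AE a in N. integrable lborel (\<lambda>z. (case (a, z) of (a, z) \<Rightarrow> lap \<rho> z * ?lm z a))"
    using supp' by eventually_elim (simp add: li)
  have ab: "AE a in N. (\<integral>z. \<bar>case (a, z) of (a, z) \<Rightarrow> lap \<rho> z * ?lm z a\<bar> \<partial>lborel) \<le> ?C"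
    using supp' by eventually_elim (use lbi in simp)
  have F: "integrable lborel (\<lambda>z. \<integral>a. lap \<rho> z * ?lm z a \<partial>N)"
    "(\<integral>z. (\<integral>a. lap \<rho> z * ?lm z a \<partial>N) \<partial>lborel) = (\<integral>a. (\<integral>z. lap \<rho> z * ?lm z a \<partial>lborel) \<partial>N)"
    using Fubini_bounded_sections(1,3)[OF N(1) m1 ai ab] by simp_all
  have "(\<integral>z. lap \<rho> z * v z \<partial>lborel) = (\<integral>z. c * lap \<rho> z + (\<integral>a. lap \<rho> z * ?lm z a \<partial>N) \<partial>lborel)"
  proof (rule integral_cong_AE)
    have ae: "AE z in lborel. c * lap \<rho> z + (\<integral>a. lap \<rho> z * ?lm z a \<partial>N) = lap \<rho> z * v z"
      using nz
    proof eventually_elim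
      case (elim z)
      show ?case
      proof (cases "cmod z \<le> R1")
        case True
        then show ?thesis using v[OF elim True] by (simp add: algebra_simps)
      next
        case False
        then have "lap \<rho> z = 0" using \<rho> by (intro lap_eq_0) auto
        then show ?thesis by simp
      qed
    qed
    show "AE z in lborel. lap \<rho> z * v z = c * lap \<rho> z + (\<integral>a. lap \<rho> z * ?lm z a \<partial>N)"
      using ae by eventually_elim simp
    show "(\<lambda>z. c * lap \<rho> z + (\<integral>a. lap \<rho> z * ?lm z a \<partial>N)) \<in> borel_measurable lborel"
      using F(1) lapi by measurable
    show "(\<lambda>z. lap \<rho> z * v z) \<in> borel_measurable lborel" by (rule vm)
  qed
  also have "\<dots> = (\<integral>a. (\<integral>z. lap \<rho> z * ?lm z a \<partial>lborel) \<partial>N)"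
    using lapi F lap0 by simp
  also have "\<dots> = (\<integral>a. (\<integral>\<omega>. pot \<rho> (of_real (cmod a) * \<omega>) \<partial>circ) \<partial>N)"
  proof (rule integral_cong_AE)
    show "(\<lambda>a. \<integral>z. lap \<rho> z * ?lm z a \<partial>lborel) \<in> borel_measurable N" by measurable
    show "(\<lambda>a. \<integral>\<omega>. pot \<rho> (of_real (cmod a) * \<omega>) \<partial>circ) \<in> borel_measurable N"
      by (rule measurable_compose[of cmod N borel "\<lambda>t. \<integral>\<omega>. pot \<rho> (of_real t * \<omega>) \<partial>circ"]) measurable
    show "AE a in N. (\<integral>z. lap \<rho> z * ?lm z a \<partial>lborel) = (\<integral>\<omega>. pot \<rho> (of_real (cmod a) * \<omega>) \<partial>circ)"
      using supp'
    proof eventually_elim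
      case (elim a)
      let ?b = "of_real (cmod a) :: complex"
      have m2: "(\<lambda>(\<omega>, z). lap \<rho> z * ln (cmod (z - ?b * \<omega>))) \<in> borel_measurable (circ \<Otimes>\<^sub>M lborel)" by measurable
      have i2: "AE \<omega> in circ. integrable lborel (\<lambda>z. lap \<rho> z * ln (cmod (z - ?b * \<omega>)))"
        using integral_lap_ln(1)[OF \<rho>(1)] by simp
      have b2: "AE \<omega> in circ. (\<integral>z. \<bar>lap \<rho> z * ln (cmod (z - ?b * \<omega>))\<bar> \<partial>lborel) \<le> 2 * B * (\<integral>z. \<bar>indicator (ball 0 (R1 + R1)) z * ln (cmod z)\<bar> \<partial>lborel)"
        using AE_circ_unit
      proof eventually_elim
        case (elim \<omega>)
        have "cmod (?b * \<omega>) \<le> R1" using elim \<open>a \<in> ball 0 R1\<close> by (simp add: norm_mult)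
        note le = integral_ln_norm_le[OF this, of R1]
        have "(\<integral>z. \<bar>lap \<rho> z * ln (cmod (z - ?b * \<omega>))\<bar> \<partial>lborel) \<le> (\<integral>z. 2 * B * \<bar>indicator (ball 0 R1) z * ln (cmod (z - ?b * \<omega>))\<bar> \<partial>lborel)"
        proof (rule integral_mono)
          show "integrable lborel (\<lambda>z. 2 * B * \<bar>indicator (ball 0 R1) z * ln (cmod (z - ?b * \<omega>))\<bar>)"
            by (intro integrable_mult_right integrable_abs integrable_ln_norm)
          fix z
          show "\<bar>lap \<rho> z * ln (cmod (z - ?b * \<omega>))\<bar> \<le> 2 * B * \<bar>indicator (ball 0 R1) z * ln (cmod (z - ?b * \<omega>))\<bar>"
          proof (cases "z \<in> ball 0 R1")
            case True
            then show ?thesis using lap_bound[of \<rho> z] by (simp add: abs_mult mult_right_mono)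
          next
            case False
            then have "lap \<rho> z = 0" using \<rho> by (intro lap_eq_0) auto
            then show ?thesis using False by simp
          qed
        qed (use integral_lap_ln(1)[OF \<rho>(1)] in auto)
        also have "\<dots> \<le> 2 * B * (\<integral>z. \<bar>indicator (ball 0 (R1 + R1)) z * ln (cmod z)\<bar> \<partial>lborel)"
          using le bound[of 0] by (auto intro!: mult_left_mono)
        finally show ?case .
      qed
      note G = Fubini_bounded_sections(3)[OF circ.finite_measure_axioms m2, where B="2 * B * (\<integral>z. \<bar>indicator (ball 0 (R1 + R1)) z * ln (cmod z)\<bar> \<partial>lborel)"]
      have "(\<integral>z. lap \<rho> z * ?lm z a \<partial>lborel) = (\<integral>z. (\<integral>\<omega>. lap \<rho> z * ln (cmod (z - ?b * \<omega>)) \<partial>circ) \<partial>lborel)"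
      proof (rule integral_cong_AE)
        show "AE z in lborel. lap \<rho> z * ?lm z a = (\<integral>\<omega>. lap \<rho> z * ln (cmod (z - ?b * \<omega>)) \<partial>circ)"
          using AE_lborel_norm_neq[of 0 "cmod a"]
        proof eventually_elim
          case (elim z)
          then show ?case using circ_jensen(2)[of z "cmod a"] by (simp add: max.commute)
        qed
        show "(\<lambda>z. \<integral>\<omega>. lap \<rho> z * ln (cmod (z - ?b * \<omega>)) \<partial>circ) \<in> borel_measurable lborel"
          by (rule circ.borel_measurable_lebesgue_integral) measurable
      qed measurable
      also have "\<dots> = (\<integral>\<omega>. (\<integral>z. lap \<rho> z * ln (cmod (z - ?b * \<omega>)) \<partial>lborel) \<partial>circ)"
        using G i2 b2 by simp
      also have "\<dots> = (\<integral>\<omega>. pot \<rho> (?b * \<omega>) \<partial>circ)"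
        using integral_lap_ln(3)[OF \<rho>(1)] by simp
      finally show ?case .
    qed
  qed
  also have "\<dots> = (\<integral>a. pot \<rho> a \<partial>N)"
    by (rule rotation_invariant_integral[OF N, symmetric, where B="B * (\<integral>z. ln (max \<rho> (cmod z)) - ln (cmod z) \<partial>lborel) * 3"])
      (use pot_abs_le[OF \<rho>(1)] in auto)
  finally show ?thesis .
qed

end

section \<open>Anti-concentration\<close>

text \<open>The intervals may overlap; only their number enters the estimates. Being half-open, the
  topmost interval is disjoint from a copy of the family shifted down by exactly g.\<close>

definition grid_union :: "real \<Rightarrow> real set \<Rightarrow> real set" where
  "grid_union g X = (\<Union>x\<in>X. {x..<x + g})"

lemma grid_union_measurable [measurable]: "finite X \<Longrightarrow> grid_union g X \<in> sets borel"
  unfolding grid_union_def by auto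

lemma grid_union_shift: "s + w \<in> grid_union g X \<longleftrightarrow> s \<in> grid_union g ((\<lambda>x. x - w) ` X)"
  by (simp add: grid_union_def algebra_simps)

text \<open>Moving the topmost interval of \<open>X\<close> to the copy of \<open>X\<close> shifted down by \<open>d \<ge> g\<close> trades \<open>r + r\<close> intervals
   for \<open>(r - 1) + (r + 1)\<close> intervals, because that interval lies above the shifted copy.\<close>

lemma measure_grid_union_pair:
  assumes S: "finite_measure S" "sets S = sets borel"
    and b: "\<And>X. finite X \<Longrightarrow> measure S (grid_union g X) \<le> b (card X)"
    and X: "finite X" "X \<noteq> {}" and g: "g > 0" and d: "d \<ge> g"
  shows "measure S (grid_union g X) + measure S (grid_union g ((\<lambda>x. x - d) ` X))
     \<le> b (card X - 1) + b (card X + 1)"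
proof -
  interpret finite_measure S by fact
  note [measurable_cong] = S(2)
  define t where "t = Max X"
  let ?Y = "(\<lambda>x. x - d) ` X"
  have t: "t \<in> X" "\<And>x. x \<in> X \<Longrightarrow> x \<le> t" using X by (auto simp: t_def)
  have tY: "t \<notin> ?Y" using t g d by force
  have disj: "{t..<t+g} \<inter> grid_union g ?Y = {}"
    using t(2) d g by (force simp: grid_union_def)
  have "measure S (grid_union g X) \<le> measure S (grid_union g (X - {t}) \<union> {t..<t+g})"
  proof (rule finite_measure_mono)
    show "grid_union g X \<subseteq> grid_union g (X - {t}) \<union> {t..<t+g}" by (auto simp: grid_union_def)
    show "grid_union g (X - {t}) \<union> {t..<t+g} \<in> sets S" using X by (simp add: S)
  qed
  also have "\<dots> \<le> measure S (grid_union g (X - {t})) + measure S {t..<t+g}"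
    by (rule measure_Un_le) (use X in \<open>auto simp: S\<close>)
  finally have "measure S (grid_union g X) + measure S (grid_union g ?Y)
      \<le> measure S (grid_union g (X - {t})) + (measure S {t..<t+g} + measure S (grid_union g ?Y))" by simp
  also have "measure S {t..<t+g} + measure S (grid_union g ?Y) = measure S ({t..<t+g} \<union> grid_union g ?Y)"
    by (rule finite_measure_Union[symmetric]) (use X disj in \<open>auto simp: S\<close>)
  also have "{t..<t+g} \<union> grid_union g ?Y = grid_union g (insert t ?Y)"
    by (auto simp: grid_union_def)
  also have "measure S (grid_union g (X - {t})) + measure S (grid_union g (insert t ?Y))
     \<le> b (card (X - {t})) + b (card (insert t ?Y))"
    by (intro add_mono b) (use X in auto)
  also have "card (X - {t}) = card X - 1" using t X by simp
  also have "card (insert t ?Y) = card X + 1"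
    using X tY by (simp add: card_image inj_on_def)
  finally show ?thesis .
qed

text \<open>Transition operator of a walk on the naturals that is killed at 0, stays put with
  probability 1 - p and otherwise moves one step up or down with equal probability.\<close>

definition lazy_step :: "real \<Rightarrow> (nat \<Rightarrow> real) \<Rightarrow> nat \<Rightarrow> real" where
  "lazy_step p b r = (if r = 0 then 0 else (1 - p) * b r + p / 2 * (b (r - 1) + b (r + 1)))"

definition concave_seq :: "(nat \<Rightarrow> real) \<Rightarrow> bool" where
  "concave_seq b \<longleftrightarrow> b 0 = 0 \<and> (\<forall>r\<ge>1. b (r - 1) + b (r + 1) \<le> 2 * b r)"

text \<open>Given W = w, the event says that S lies in the family shifted by w. For two independent
  copies w and w' that are g apart, the exchange of intervals improves the trivial bound
  \<open>2 * b r\<close> to \<open>b (r - 1) + b (r + 1)\<close>, and this happens with probability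
  at least p.\<close>

lemma (in prob_space) grid_union_step:
  fixes S W :: "'a \<Rightarrow> real"
  assumes ind: "indep_var borel S borel W"
    and b: "\<And>X. finite X \<Longrightarrow> prob {\<omega>\<in>space M. S \<omega> \<in> grid_union g X} \<le> b (card X)"
    and conc: "concave_seq b" and g: "g > 0"
    and p: "p \<le> measure (distr M borel W \<Otimes>\<^sub>M distr M borel W) {(w, w'). \<bar>w - w'\<bar> \<ge> g}"
    and X: "finite X"
  shows "prob {\<omega>\<in>space M. S \<omega> + W \<omega> \<in> grid_union g X} \<le> lazy_step p b (card X)"
proof (cases "X = {}")
  case True
  then show ?thesis by (simp add: grid_union_def lazy_step_def)
next
  case False
  have [measurable]: "random_variable borel S" "random_variable borel W"
    using ind by (auto dest: indep_var_rv1 indep_var_rv2)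
  define DS where "DS = distr M borel S"
  define DW where "DW = distr M borel W"
  interpret DS: prob_space DS unfolding DS_def by (intro prob_space_distr) auto
  interpret DW: prob_space DW unfolding DW_def by (intro prob_space_distr) auto
  have sets[simp, measurable_cong]: "sets DS = sets borel" "sets DW = sets borel" by (auto simp: DS_def DW_def)
  have sp[simp]: "space DS = UNIV" "space DW = UNIV" by (auto simp: DS_def DW_def)
  interpret P: pair_prob_space DW DW ..
  interpret Q: pair_prob_space DS DW ..
  have joint: "DS \<Otimes>\<^sub>M DW = distr M (borel \<Otimes>\<^sub>M borel) (\<lambda>x. (S x, W x))"
    using ind unfolding indep_var_distribution_eq DS_def DW_def by auto
  define sh where "sh w = (\<lambda>x. x - w) ` X" for w
  have shf: "finite (sh w)" "card (sh w) = card X" "sh w \<noteq> {}" for w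
    using X False by (auto simp: sh_def card_image inj_on_def)
  define h where "h w = measure DS (grid_union g (sh w))" for w
  define E where "E = {(w, w'). \<bar>w - w'\<bar> \<ge> g}"
  have [measurable]: "grid_union g X \<in> sets borel" using X by auto
  have sm[measurable]: "{sw. fst sw + snd sw \<in> grid_union g X} \<in> sets (DS \<Otimes>\<^sub>M DW)"
  proof -
    have "{sw \<in> space (DS \<Otimes>\<^sub>M DW). fst sw + snd sw \<in> grid_union g X} \<in> sets (DS \<Otimes>\<^sub>M DW)" by measurable
    then show ?thesis by (simp add: space_pair_measure)
  qed
  have heq: "h w = measure DS ((\<lambda>s. (s, w)) -` {sw. fst sw + snd sw \<in> grid_union g X})" for w
    unfolding h_def sh_def by (intro arg_cong[where f="measure DS"]) (auto simp: grid_union_shift)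
  have hm[measurable]: "h \<in> borel_measurable DW"
    unfolding heq measure_def using Q.measurable_emeasure_Pair2[OF sm] by measurable
  have h01: "0 \<le> h w" "h w \<le> 1" for w by (auto simp: h_def)
  have hi: "integrable DW h"
    by (rule DW.integrable_const_bound[where B=1]) (use h01 in auto)
  have Em[measurable]: "E \<in> sets (DW \<Otimes>\<^sub>M DW)"
  proof -
    have "{z \<in> space (DW \<Otimes>\<^sub>M DW). \<bar>fst z - snd z\<bar> \<ge> g} \<in> sets (DW \<Otimes>\<^sub>M DW)" by measurable
    then show ?thesis by (simp add: space_pair_measure E_def case_prod_unfold)
  qed
  have hb: "h w \<le> b (card X)" for w
  proof -
    have "h w = prob {\<omega>\<in>space M. S \<omega> \<in> grid_union g (sh w)}"
      unfolding h_def DS_def using shf by (subst measure_distr) (auto intro!: arg_cong[where f=prob])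
    then show ?thesis using b[OF shf(1)[of w]] shf(2) by simp
  qed
  \<comment> \<open>The gain on the event that the copies are g apart: the negative second
    difference of b, which concavity makes nonnegative.\<close>
  define \<Delta> where "\<Delta> = 2 * b (card X) - (b (card X - 1) + b (card X + 1))"
  have c1: "card X \<ge> 1" using X False by (simp add: Suc_le_eq card_gt_0_iff)
  have \<Delta>: "\<Delta> \<ge> 0" using conc c1 unfolding concave_seq_def \<Delta>_def by auto
  have key0: "h w + h w' \<le> 2 * b (card X) - \<Delta>" if d: "w' - w \<ge> g" for w w'
  proof -
    have "sh w' = (\<lambda>x. x - (w' - w)) ` sh w" by (force simp: sh_def image_image)
    moreover have "measure DS (grid_union g Y) \<le> b (card Y)" if "finite Y" for Y
    proof -
      have "measure DS (grid_union g Y) = prob {\<omega>\<in>space M. S \<omega> \<in> grid_union g Y}"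
        unfolding DS_def using that by (subst measure_distr) (auto intro!: arg_cong[where f=prob])
      then show ?thesis using b[OF that] by simp
    qed
    ultimately have "h w + h w' \<le> b (card (sh w) - 1) + b (card (sh w) + 1)"
      using measure_grid_union_pair[OF DS.finite_measure_axioms sets(1) _ shf(1,3) g d, of b w] 
      unfolding h_def by simp
    then show ?thesis using shf by (simp add: \<Delta>_def)
  qed
  have key: "h w + h w' \<le> 2 * b (card X) - \<Delta> * indicator E (w, w')" for w w'
  proof (cases "(w, w') \<in> E")
    case True
    then consider "w' - w \<ge> g" | "w - w' \<ge> g" by (auto simp: E_def abs_if split: if_splits)
    then show ?thesis using key0[of w w'] key0[of w' w] True by cases auto
  next
    case False
    then show ?thesis using hb[of w] hb[of w'] by simp
  qed
  have "prob {\<omega>\<in>space M. S \<omega> + W \<omega> \<in> grid_union g X} =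
      measure (DS \<Otimes>\<^sub>M DW) {sw. fst sw + snd sw \<in> grid_union g X}"
  proof -
    have "{sw. fst sw + snd sw \<in> grid_union g X} \<in> sets (borel \<Otimes>\<^sub>M borel)"
      using sm sets_pair_measure_cong[OF sets] by simp
    then show ?thesis unfolding joint by (subst measure_distr) (auto intro!: arg_cong[where f=prob])
  qed
  also have "\<dots> = (\<integral>w. h w \<partial>DW)"
  proof -
    have "emeasure (DS \<Otimes>\<^sub>M DW) {sw. fst sw + snd sw \<in> grid_union g X} = (\<integral>\<^sup>+w. ennreal (h w) \<partial>DW)"
      by (subst Q.emeasure_pair_measure_alt2[OF sm]) (auto simp: heq DS.emeasure_eq_measure)
    also have "\<dots> = ennreal (\<integral>w. h w \<partial>DW)"
      by (rule nn_integral_eq_integral[OF hi]) (use h01 in auto)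
    finally show ?thesis
      using h01 by (simp add: measure_def integral_nonneg_AE)
  qed
  \<comment> \<open>Doubling introduces an independent copy of W, so that pairs of shifts can be
    compared.\<close>
  also have "2 * \<dots> = (\<integral>z. h (fst z) + h (snd z) \<partial>(DW \<Otimes>\<^sub>M DW))"
  proof -
    have i1: "integrable (DW \<Otimes>\<^sub>M DW) (\<lambda>z. h (fst z))" "integrable (DW \<Otimes>\<^sub>M DW) (\<lambda>z. h (snd z))"
      by (rule P.integrable_const_bound[where B=1]; use h01 in auto)+
    have "(\<integral>z. h (fst z) \<partial>(DW \<Otimes>\<^sub>M DW)) = (\<integral>w. h w \<partial>DW)"
      using P.integral_fst'[OF i1(1)] DW.prob_space by simp
    moreover have "(\<integral>z. h (snd z) \<partial>(DW \<Otimes>\<^sub>M DW)) = (\<integral>w. h w \<partial>DW)"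
      using P.integral_fst'[OF i1(2)] DW.prob_space by simp
    ultimately show ?thesis using i1 by simp
  qed
  also have "\<dots> \<le> (\<integral>z. 2 * b (card X) - \<Delta> * indicator E z \<partial>(DW \<Otimes>\<^sub>M DW))"
  proof (rule integral_mono)
    show "integrable (DW \<Otimes>\<^sub>M DW) (\<lambda>z. h (fst z) + h (snd z))"
      by (rule P.integrable_const_bound[where B=2]) (use h01 in \<open>auto intro!: AE_I2 simp: abs_le_iff\<close>, smt)
    show "integrable (DW \<Otimes>\<^sub>M DW) (\<lambda>z. 2 * b (card X) - \<Delta> * indicator E z)"
      by (rule P.integrable_const_bound[where B="\<bar>2 * b (card X)\<bar> + \<bar>\<Delta>\<bar>"])
        (auto intro!: AE_I2 split: split_indicator)
  qed (use key in auto)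
  also have "\<dots> = 2 * b (card X) - \<Delta> * measure (DW \<Otimes>\<^sub>M DW) E"
  proof -
    have "integrable (DW \<Otimes>\<^sub>M DW) (indicat_real E)"
      by (rule P.integrable_const_bound[where B=1]) (auto intro!: AE_I2 split: split_indicator)
    then show ?thesis using P.prob_space by (simp add: space_pair_measure)
  qed
  also have "\<dots> \<le> 2 * b (card X) - \<Delta> * p"
    using p \<Delta> by (auto simp: E_def DW_def intro!: mult_left_mono)
  also have "\<dots> = 2 * lazy_step p b (card X)"
    using c1 by (simp add: lazy_step_def \<Delta>_def field_simps)
  finally show ?thesis by simp
qed

lemma concave_seq_lazy_step:
  assumes "concave_seq b" "0 \<le> p" "p \<le> 1"
  shows "concave_seq (lazy_step p b)" "\<And>r. lazy_step p b r \<le> b r"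
proof -
  have c: "b 0 = 0" "\<And>r. r \<ge> 1 \<Longrightarrow> b (r - 1) + b (r + 1) \<le> 2 * b r"
    using assms by (auto simp: concave_seq_def)
  show le: "lazy_step p b r \<le> b r" for r
  proof (cases "r = 0")
    case False
    then have "p / 2 * (b (r - 1) + b (r + 1)) \<le> p / 2 * (2 * b r)"
      using c(2)[of r] assms by (intro mult_left_mono) auto
    then show ?thesis using False by (simp add: lazy_step_def algebra_simps)
  qed (simp add: lazy_step_def c)
  \<comment> \<open>The second difference, extended by 0 at the killed state. A lazy step acts on it
    by the same averaging, which preserves its sign.\<close>
  define d where "d r = (if r = 0 then 0 else b (r - 1) + b (r + 1) - 2 * b r)" for r
  have d: "d r \<le> 0" for r using c(2)[of r] by (auto simp: d_def)
  show "concave_seq (lazy_step p b)"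
    unfolding concave_seq_def
  proof (intro conjI allI impI)
    fix r :: nat assume r: "r \<ge> 1"
    have "lazy_step p b (r - 1) + lazy_step p b (r + 1) - 2 * lazy_step p b r
        = (1 - p) * d r + p / 2 * (d (r - 1) + d (r + 1))"
    proof (cases "r = 1")
      case True
      then show ?thesis by (simp add: lazy_step_def d_def c numeral_2_eq_2 field_simps)
    next
      case False
      then obtain k where "r = Suc (Suc k)" using r by (metis One_nat_def Suc_le_D le_SucE le_zero_eq not0_implies_Suc)
      then show ?thesis by (simp add: lazy_step_def d_def field_simps)
    qed
    also have "\<dots> \<le> 0"
    proof -
      have "(1 - p) * d r \<le> 0" using assms d by (simp add: mult_nonneg_nonpos)
      moreover have "p / 2 * (d (r - 1) + d (r + 1)) \<le> 0"
        using assms d[of "r-1"] d[of "r+1"] by (intro mult_nonneg_nonpos) auto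
      ultimately show ?thesis by simp
    qed
    finally show "lazy_step p b (r - 1) + lazy_step p b (r + 1) \<le> 2 * lazy_step p b r" by simp
  qed (simp add: lazy_step_def)
qed

text \<open>The probability that a lazy random walk started at \<open>r\<close> has not hit \<open>0\<close> by time \<open>N\<close>.\<close>

definition walk_bound :: "real \<Rightarrow> nat \<Rightarrow> nat \<Rightarrow> real" where
  "walk_bound p N = (lazy_step p ^^ N) (\<lambda>r. if r = 0 then 0 else 1)"

lemma concave_walk_bound: "0 \<le> p \<Longrightarrow> p \<le> 1 \<Longrightarrow> concave_seq (walk_bound p N)"
  by (induction N) (auto simp: walk_bound_def concave_seq_lazy_step, auto simp: concave_seq_def)

text \<open>The survival probabilities decrease in N, and their limit is harmonic for the walk and
  vanishes at 0. Such a function on the naturals is linear, and a bounded one is 0.\<close>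

lemma walk_bound_tendsto_0:
  assumes p: "0 < p" "p \<le> 1"
  shows "(\<lambda>N. walk_bound p N r) \<longlonglongrightarrow> 0"
proof -
  have S: "walk_bound p (Suc N) = lazy_step p (walk_bound p N)" for N by (simp add: walk_bound_def)
  have dec: "walk_bound p (Suc N) r \<le> walk_bound p N r" for N r
    unfolding S using concave_seq_lazy_step(2)[OF concave_walk_bound] p by auto
  have nn: "0 \<le> walk_bound p N r" for N r
  proof (induction N arbitrary: r)
    case 0 then show ?case by (simp add: walk_bound_def)
  next
    case (Suc N) then show ?case unfolding S lazy_step_def using p by auto
  qed
  have le1: "walk_bound p N r \<le> 1" for N r
    by (induction N) (use dec in \<open>auto simp: walk_bound_def intro: order_trans\<close>)
  have "\<exists>l. (\<lambda>N. walk_bound p N r) \<longlonglongrightarrow> l" for r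
  proof -
    have "decseq (\<lambda>N. walk_bound p N r)" using dec by (auto intro: decseq_SucI)
    then obtain l where "(\<lambda>N. walk_bound p N r) \<longlonglongrightarrow> l"
      by (rule decseq_convergent[where B=0]) (use nn in auto)
    then show ?thesis by auto
  qed
  then obtain l where l: "\<And>r. (\<lambda>N. walk_bound p N r) \<longlonglongrightarrow> l r" by metis
  have l01: "0 \<le> l r" "l r \<le> 1" for r
    using LIMSEQ_le_const[OF l[of r]] LIMSEQ_le_const2[OF l[of r]] nn le1 by blast+
  have "walk_bound p N 0 = 0" for N by (induction N) (auto simp: walk_bound_def lazy_step_def)
  then have "(\<lambda>N. walk_bound p N 0) \<longlonglongrightarrow> 0" by simp
  then have l0: "l 0 = 0" using LIMSEQ_unique[OF l[of 0]] by blast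
  have rec: "2 * l (Suc r) = l r + l (Suc (Suc r))" for r
  proof -
    have "(\<lambda>N. walk_bound p (Suc N) (Suc r)) \<longlonglongrightarrow> (1 - p) * l (Suc r) + p / 2 * (l r + l (Suc (Suc r)))"
      unfolding S lazy_step_def using l by (auto intro!: tendsto_intros)
    moreover have "(\<lambda>N. walk_bound p (Suc N) (Suc r)) \<longlonglongrightarrow> l (Suc r)"
      using l by (rule LIMSEQ_Suc)
    ultimately have "l (Suc r) = (1 - p) * l (Suc r) + p / 2 * (l r + l (Suc (Suc r)))"
      using LIMSEQ_unique by blast
    then have "p * (2 * l (Suc r)) = p * (l r + l (Suc (Suc r)))" by (simp add: field_simps)
    then show ?thesis using p by simp
  qed
  have lin: "l r = r * l 1 \<and> l (Suc r) = Suc r * l 1" for r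
  proof (induction r)
    case (Suc r)
    then have "l (Suc (Suc r)) = 2 * (Suc r * l 1) - r * l 1" using rec[of r] by auto
    then show ?case using Suc by (simp add: algebra_simps)
  qed (simp add: l0)
  have "l 1 = 0"
  proof (rule ccontr)
    assume "l 1 \<noteq> 0"
    then have pos: "l 1 > 0" using l01[of 1] by simp
    obtain r :: nat where "1 / l 1 < r" using reals_Archimedean2 by blast
    then have "1 < r * l 1" using pos by (simp add: field_simps)
    then show False using lin[of r] l01[of r] by simp
  qed
  then show ?thesis using l[of r] lin[of r] by simp
qed

text \<open>If no gap had positive probability, two independent copies would agree almost surely;
  fixing one of them by Fubini makes the other almost surely constant.\<close>

lemma (in prob_space) nondegenerate_gap:
  fixes \<xi> :: "'a \<Rightarrow> complex"
  assumes [measurable]: "random_variable borel \<xi>"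
    and nd: "\<not> (\<exists>c. AE \<omega> in M. \<xi> \<omega> = c)"
  defines "D \<equiv> distr M borel \<xi>"
  obtains g where "g > 0" "measure (D \<Otimes>\<^sub>M D) {(x, y). dist x y \<ge> g} > 0"
proof (rule ccontr)
  interpret D: prob_space D unfolding D_def by (intro prob_space_distr) auto
  interpret P: pair_prob_space D D ..
  have [simp, measurable_cong]: "sets D = sets borel" and [simp]: "space D = UNIV" by (auto simp: D_def)
  have m[measurable]: "{(x, y). dist x y \<ge> g} \<in> sets (D \<Otimes>\<^sub>M D)" for g :: real
  proof -
    have "{z \<in> space (D \<Otimes>\<^sub>M D). dist (fst z) (snd z) \<ge> g} \<in> sets (D \<Otimes>\<^sub>M D)" by measurable
    then show ?thesis by (simp add: space_pair_measure case_prod_unfold)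
  qed
  note T = that
  assume "\<not> thesis"
  then have z: "measure (D \<Otimes>\<^sub>M D) {(x, y). dist x y \<ge> g} = 0" if "g > 0" for g
    using T[of g] \<open>\<not> thesis\<close> that by (metis less_eq_real_def measure_nonneg)
  have "AE z in D \<Otimes>\<^sub>M D. \<forall>n::nat. \<not> dist (fst z) (snd z) \<ge> 1 / real (Suc n)"
  proof (subst AE_all_countable, intro allI)
    fix n :: nat
    have "{(x, y). dist x y \<ge> 1 / real (Suc n)} \<in> null_sets (D \<Otimes>\<^sub>M D)"
    proof (rule null_setsI)
      have "0 < 1 / real (Suc n)" by simp
      from z[OF this] show "emeasure (D \<Otimes>\<^sub>M D) {(x, y). dist x y \<ge> 1 / real (Suc n)} = 0"
        by (simp only: P.emeasure_eq_measure ennreal_0)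
    qed (rule m)
    then have "AE z in D \<Otimes>\<^sub>M D. z \<notin> {(x, y). dist x y \<ge> 1 / real (Suc n)}"
      by (rule AE_not_in)
    then show "AE z in D \<Otimes>\<^sub>M D. \<not> dist (fst z) (snd z) \<ge> 1 / real (Suc n)"
      by (simp add: case_prod_unfold)
  qed
  then have "AE z in D \<Otimes>\<^sub>M D. fst z = snd z"
  proof eventually_elim
    case (elim z)
    show ?case
    proof (rule ccontr)
      assume "fst z \<noteq> snd z"
      then obtain n where "1 / real (Suc n) < dist (fst z) (snd z)"
        using nat_approx_posE[of "dist (fst z) (snd z)"] by auto
      then show False using elim by (meson less_imp_le)
    qed
  qed
  then have "AE x in D. AE y in D. x = y"
    using P.AE_pair by fastforce
  have "\<exists>x. AE y in D. x = y"
  proof (rule ccontr)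
    assume "\<nexists>x. AE y in D. x = y"
    with \<open>AE x in D. AE y in D. x = y\<close> have "AE x in D. False" by simp
    then show False by simp
  qed
  then obtain x where "AE y in D. x = y" ..
  then have "AE \<omega> in M. \<xi> \<omega> = x"
    unfolding D_def by (subst (asm) AE_distr_iff) auto
  then show False using nd by auto
qed

text \<open>The first variable is a function of the coordinates other than k, so independence comes
  from splitting the index set into k and the rest. Its shape, the series outside J plus a finite
  part A, is the one that recurs at each stage of the induction below.\<close>

lemma (in prob_space) indep_sum_split:
  fixes \<xi> :: "nat \<Rightarrow> 'a \<Rightarrow> complex" and c :: "nat \<Rightarrow> complex" and h :: "complex \<Rightarrow> real"
  assumes ind: "indep_vars (\<lambda>_. borel) \<xi> UNIV"
    and [measurable]: "h \<in> borel_measurable borel"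
    and k: "k \<in> J" "k \<notin> A" 
  shows "indep_var borel (\<lambda>\<omega>. h (\<Sum>j. if j \<in> J then 0 else \<xi> j \<omega> * c j) + (\<Sum>j\<in>A. h (\<xi> j \<omega> * c j)))
                   borel (\<lambda>\<omega>. h (\<xi> k \<omega> * c k))"
proof -
  define K where "K b = (if b then - {k} else {k})" for b
  let ?R = "\<lambda>b \<omega>. restrict (\<lambda>i. \<xi> i \<omega>) (K b)"
  let ?P = "\<lambda>b. PiM (K b) (\<lambda>_. borel :: complex measure)"
  have "indep_vars ?P ?R UNIV"
    by (rule indep_vars_restrict[OF ind]) (auto simp: K_def disjoint_family_on_def)
  moreover have "?P = case_bool (?P True) (?P False)" "?R = case_bool (?R True) (?R False)"
    by (auto simp: fun_eq_iff split: bool.split)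
  ultimately have iv: "indep_var (?P True) (?R True) (?P False) (?R False)"
    unfolding indep_var_def by simp
  have comp: "(\<lambda>x. x j) \<in> borel_measurable (?P True)" if "j \<noteq> k" for j
    by (rule measurable_component_singleton) (use that in \<open>auto simp: K_def\<close>)
  have comp': "(\<lambda>x. x k) \<in> borel_measurable (?P False)"
    by (rule measurable_component_singleton) (auto simp: K_def)
  have t: "(\<lambda>x. if j \<in> J then 0 else x j * c j) \<in> borel_measurable (?P True)" for j
  proof (cases "j \<in> J")
    case False
    with k have "j \<noteq> k" by auto
    from comp[OF this] show ?thesis using False by simp
  qed simp
  have G1: "(\<lambda>x. h (\<Sum>j. if j \<in> J then 0 else x j * c j) + (\<Sum>j\<in>A. h (x j * c j))) \<in> borel_measurable (?P True)"
  proof (intro borel_measurable_add borel_measurable_sum)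
    show "(\<lambda>x. h (\<Sum>j. if j \<in> J then 0 else x j * c j)) \<in> borel_measurable (?P True)"
      by (rule measurable_compose[OF borel_measurable_suminf[OF t]]) simp
    fix j assume "j \<in> A"
    then have "j \<noteq> k" using k by auto
    note [measurable] = comp[OF this]
    show "(\<lambda>x. h (x j * c j)) \<in> borel_measurable (?P True)" by measurable
  qed
  have G2: "(\<lambda>x. h (x k * c k)) \<in> borel_measurable (?P False)"
    using comp' by measurable
  from indep_var_compose[OF iv G1 G2] have "indep_var borel
     (\<lambda>\<omega>. h (\<Sum>j. if j \<in> J then 0 else ?R True \<omega> j * c j) + (\<Sum>j\<in>A. h (?R True \<omega> j * c j)))
     borel (\<lambda>\<omega>. h (?R False \<omega> k * c k))" by (simp add: comp_def)
  moreover have "(\<lambda>j. if j \<in> J then 0 else ?R True \<omega> j * c j) = (\<lambda>j. if j \<in> J then 0 else \<xi> j \<omega> * c j)" for \<omega>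
    using k by (auto simp: K_def fun_eq_iff)
  moreover have "(\<Sum>j\<in>A. h (?R True \<omega> j * c j)) = (\<Sum>j\<in>A. h (\<xi> j \<omega> * c j))" for \<omega>
    using k by (intro sum.cong) (auto simp: K_def)
  ultimately show ?thesis by (simp add: K_def)
qed

text \<open>Induction on A. The series outside J is one random variable about which nothing is
  assumed, so the start is the trivial bound 1, and each index of A contributes one lazy
  step.\<close>

lemma (in prob_space) series_concentration:
  fixes \<xi> :: "nat \<Rightarrow> 'a \<Rightarrow> complex" and h :: "complex \<Rightarrow> real"
  assumes ind: "indep_vars (\<lambda>_. borel) \<xi> UNIV"
    and h[measurable]: "h \<in> borel_measurable borel"
    and g: "g > 0" and p: "0 \<le> p" "p \<le> 1"
    and gap: "\<And>k. k \<in> J \<Longrightarrow> p \<le> measure (distr M borel (\<lambda>\<omega>. h (\<xi> k \<omega> * c k)) \<Otimes>\<^sub>M distr M borel (\<lambda>\<omega>. h (\<xi> k \<omega> * c k)))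
        {(w, w'). \<bar>w - w'\<bar> \<ge> g}"
    and A: "finite A" "A \<subseteq> J" and X: "finite X"
  shows "prob {\<omega> \<in> space M. h (\<Sum>j. if j \<in> J then 0 else \<xi> j \<omega> * c j) + (\<Sum>j\<in>A. h (\<xi> j \<omega> * c j)) \<in> grid_union g X}
     \<le> walk_bound p (card A) (card X)"
  using A X
proof (induction A arbitrary: X rule: finite_induct)
  case empty
  then show ?case
    by (cases "X = {}") (auto simp: walk_bound_def grid_union_def card_eq_0_iff)
next
  case (insert k A)
  have "prob {\<omega> \<in> space M. (h (\<Sum>j. if j \<in> J then 0 else \<xi> j \<omega> * c j) + (\<Sum>j\<in>A. h (\<xi> j \<omega> * c j))) + h (\<xi> k \<omega> * c k) \<in> grid_union g X}
     \<le> lazy_step p (walk_bound p (card A)) (card X)"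
  proof (rule grid_union_step)
    show "indep_var borel (\<lambda>\<omega>. h (\<Sum>j. if j \<in> J then 0 else \<xi> j \<omega> * c j) + (\<Sum>j\<in>A. h (\<xi> j \<omega> * c j)))
                   borel (\<lambda>\<omega>. h (\<xi> k \<omega> * c k))"
      using insert by (intro indep_sum_split ind h) auto
  qed (use insert g p gap concave_walk_bound in auto)
  then show ?case using insert by (simp add: walk_bound_def add_ac)
qed

text \<open>A complex gap shows in the real or in the imaginary part, so at least half of the
  indices have a uniform gap in one common part, to which the real estimate applies. The event A
  covers small sums only where the series converges; elsewhere the value of the sum says
  nothing.\<close>

lemma (in prob_space) anticoncentration:
  fixes \<xi> :: "nat \<Rightarrow> 'a \<Rightarrow> complex"
  assumes ind: "indep_vars (\<lambda>_. borel) \<xi> UNIV"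
    and ident: "\<And>k. distr M borel (\<xi> k) = distr M borel (\<xi> 0)"
    and nd: "\<not> (\<exists>c. AE \<omega> in M. \<xi> 0 \<omega> = c)"
  obtains g p where "g > 0" "0 < p" "p \<le> 1"
    "\<forall>c J N l s. finite J \<and> 2 * N \<le> card J \<and> (\<forall>k\<in>J. l \<le> cmod (c k)) \<and> 2 * s < l * g \<and> l > 0 \<longrightarrow>
       (\<exists>A\<in>events. (\<exists>m\<ge>N. prob A \<le> walk_bound p m 1) \<and>
         (\<forall>\<omega>\<in>space M. summable (\<lambda>k. \<xi> k \<omega> * c k) \<and> cmod (\<Sum>k. \<xi> k \<omega> * c k) \<le> s \<longrightarrow> \<omega> \<in> A))"
proof -
  have rv[measurable]: "random_variable borel (\<xi> k)" for k
    using ind by (auto simp: indep_vars_def)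
  define D where "D = distr M borel (\<xi> 0)"
  interpret D: prob_space D unfolding D_def by (intro prob_space_distr) auto
  interpret P: pair_prob_space D D ..
  have [simp, measurable_cong]: "sets D = sets borel" and [simp]: "space D = UNIV" by (auto simp: D_def)
  obtain g0 where g0: "g0 > 0" "measure (D \<Otimes>\<^sub>M D) {(x, y). dist x y \<ge> g0} > 0"
    using nondegenerate_gap[OF rv nd] unfolding D_def by blast
  \<comment> \<open>One of the two parts receives at least half of the gap probability. The size of
    the gap is halved for the same reason, hence the \<open>g0 / 2\<close> below.\<close>
  define p where "p = measure (D \<Otimes>\<^sub>M D) {(x, y). dist x y \<ge> g0} / 2"
  have "0 < p" using g0 by (simp add: p_def)
  moreover have "p \<le> 1" using P.prob_le_1[of "{(x, y). dist x y \<ge> g0}"] unfolding p_def by linarith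
  ultimately have p: "0 < p" "p \<le> 1" .
  have main: "\<exists>A\<in>events. (\<exists>m\<ge>N. prob A \<le> walk_bound p m 1) \<and>
         (\<forall>\<omega>\<in>space M. summable (\<lambda>k. \<xi> k \<omega> * c k) \<and> cmod (\<Sum>k. \<xi> k \<omega> * c k) \<le> s \<longrightarrow> \<omega> \<in> A)"
    if J: "finite J" "2 * N \<le> card J" and cl: "\<And>k. k \<in> J \<Longrightarrow> l \<le> cmod (c k)"
      and s: "2 * s < l * (g0 / 2)" and l: "l > 0" for c :: "nat \<Rightarrow> complex" and J N l s
  proof -
    define gg where "gg = l * (g0 / 2)"
    have gg: "gg > 0" using l g0 by (simp add: gg_def)
    define q where "q h k = measure (distr M borel (\<lambda>\<omega>. h (\<xi> k \<omega> * c k)) \<Otimes>\<^sub>M distr M borel (\<lambda>\<omega>. h (\<xi> k \<omega> * c k)))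
        {(w, w'). \<bar>w - w'\<bar> \<ge> gg}" for h :: "complex \<Rightarrow> real" and k
    have qeq: "q h k = measure (D \<Otimes>\<^sub>M D) {(x, y). \<bar>h (x * c k) - h (y * c k)\<bar> \<ge> gg}" 
      and qm: "{(x, y). \<bar>h (x * c k) - h (y * c k)\<bar> \<ge> gg} \<in> sets (D \<Otimes>\<^sub>M D)"
      if [measurable]: "h \<in> borel_measurable borel" for h k
    proof -
      have d: "distr M borel (\<lambda>\<omega>. h (\<xi> k \<omega> * c k)) = distr D borel (\<lambda>x. h (x * c k))"
        unfolding D_def ident[of k, symmetric] by (subst distr_distr) (auto simp: comp_def)
      interpret D': prob_space "distr D borel (\<lambda>x. h (x * c k))" by (rule D.prob_space_distr) measurable
      have pd: "distr D borel (\<lambda>x. h (x * c k)) \<Otimes>\<^sub>M distr D borel (\<lambda>x. h (x * c k)) =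
         distr (D \<Otimes>\<^sub>M D) (borel \<Otimes>\<^sub>M borel) (\<lambda>(x, y). (h (x * c k), h (y * c k)))"
        by (rule pair_measure_distr) (measurable, rule D'.sigma_finite_measure_axioms)
      have m: "{(w, w'). \<bar>w - w'\<bar> \<ge> gg} \<in> sets (borel \<Otimes>\<^sub>M borel)"
      proof -
        have "{z \<in> space (borel \<Otimes>\<^sub>M borel). \<bar>fst z - snd z\<bar> \<ge> gg} \<in> sets (borel \<Otimes>\<^sub>M borel)" by measurable
        then show ?thesis by (simp add: space_pair_measure case_prod_unfold)
      qed
      show "q h k = measure (D \<Otimes>\<^sub>M D) {(x, y). \<bar>h (x * c k) - h (y * c k)\<bar> \<ge> gg}"
        unfolding q_def d pd using m
        by (subst measure_distr) (auto simp: space_pair_measure intro!: arg_cong[where f="measure (D \<Otimes>\<^sub>M D)"])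
      have "{z \<in> space (D \<Otimes>\<^sub>M D). \<bar>h (fst z * c k) - h (snd z * c k)\<bar> \<ge> gg} \<in> sets (D \<Otimes>\<^sub>M D)" by measurable
      then show "{(x, y). \<bar>h (x * c k) - h (y * c k)\<bar> \<ge> gg} \<in> sets (D \<Otimes>\<^sub>M D)"
        by (simp add: space_pair_measure case_prod_unfold)
    qed
    define J1 where "J1 = {k\<in>J. q Re k \<ge> p}"
    define J2 where "J2 = {k\<in>J. q Im k \<ge> p}"
    have "J \<subseteq> J1 \<union> J2"
    proof
      fix k assume k: "k \<in> J"
      have "{(x, y). dist x y \<ge> g0} \<subseteq> {(x, y). \<bar>Re (x * c k) - Re (y * c k)\<bar> \<ge> gg} \<union> {(x, y). \<bar>Im (x * c k) - Im (y * c k)\<bar> \<ge> gg}"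
      proof (rule subsetI, rule ccontr)
        fix z assume "z \<in> {(x, y). dist x y \<ge> g0}" and n: "z \<notin> {(x, y). \<bar>Re (x * c k) - Re (y * c k)\<bar> \<ge> gg} \<union> {(x, y). \<bar>Im (x * c k) - Im (y * c k)\<bar> \<ge> gg}"
        then obtain x y where xy: "z = (x, y)" and a: "g0 \<le> dist x y" by auto
        have "l * g0 \<le> cmod (c k) * dist x y" using a cl[OF k] g0 l by (intro mult_mono) auto
        also have "\<dots> = cmod ((x - y) * c k)" by (simp add: norm_mult dist_norm)
        also have "\<dots> \<le> \<bar>Re ((x - y) * c k)\<bar> + \<bar>Im ((x - y) * c k)\<bar>" by (rule cmod_le)
        also have "\<dots> < gg + gg" using n xy by (intro add_strict_mono) (auto simp: left_diff_distrib)
        finally show False by (simp add: gg_def)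
      qed
      then have "measure (D \<Otimes>\<^sub>M D) {(x, y). dist x y \<ge> g0} \<le> measure (D \<Otimes>\<^sub>M D) ({(x, y). \<bar>Re (x * c k) - Re (y * c k)\<bar> \<ge> gg} \<union> {(x, y). \<bar>Im (x * c k) - Im (y * c k)\<bar> \<ge> gg})"
        by (rule P.finite_measure_mono) (intro sets.Un qm, auto)
      also have "\<dots> \<le> q Re k + q Im k"
        using measure_Un_le[OF qm[of Re k] qm[of Im k]] by (simp add: qeq)
      finally show "k \<in> J1 \<union> J2" using k by (auto simp: J1_def J2_def p_def)
    qed
    then have "card J \<le> card J1 + card J2"
      using J by (metis J1_def J2_def card_Un_le card_mono finite_Un finite_subset le_trans mem_Collect_eq subsetI)
    \<comment> \<open>Pigeonhole: J has at least 2 N elements and is covered by \<open>J1\<close>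
      and \<open>J2\<close>.\<close>
    then obtain h where h: "h = Re \<or> h = Im" "N \<le> card {k\<in>J. q h k \<ge> p}"
      using J unfolding J1_def J2_def by (metis (no_types, lifting) add_le_mono linorder_not_le mult_2 not_less_iff_gr_or_eq add_less_mono order.strict_trans1)
    define I where "I = {k\<in>J. q h k \<ge> p}"
    have hm[measurable]: "h \<in> borel_measurable borel" using h by auto
    have Ifin: "finite I" using J by (auto simp: I_def)
    \<comment> \<open>Measurable without any convergence, and equal to the chosen part of the sum
      wherever the series converges. The single interval starting at -s covers [-s, s], as its
      length exceeds 2 s.\<close>
    define T where "T \<omega> = h (\<Sum>j. if j \<in> I then 0 else \<xi> j \<omega> * c j) + (\<Sum>j\<in>I. h (\<xi> j \<omega> * c j))" for \<omega>
    define A where "A = {\<omega>\<in>space M. T \<omega> \<in> grid_union gg {-s}}"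
    have [measurable]: "T \<in> borel_measurable M" unfolding T_def by measurable
    have Ae: "A \<in> events" unfolding A_def by measurable
    have "prob A \<le> walk_bound p (card I) (card {-s})"
      unfolding A_def T_def
      by (rule series_concentration[OF ind hm gg]) (use p Ifin in \<open>auto simp: I_def q_def\<close>)
    moreover have "\<omega> \<in> A" if \<omega>: "\<omega> \<in> space M" and sm: "summable (\<lambda>k. \<xi> k \<omega> * c k)" and le: "cmod (\<Sum>k. \<xi> k \<omega> * c k) \<le> s" for \<omega>
    proof -
      have f: "(\<lambda>j. if j \<in> I then \<xi> j \<omega> * c j else 0) sums (\<Sum>j\<in>I. \<xi> j \<omega> * c j)"
        using sums_If_finite_set[OF Ifin, of "\<lambda>j. \<xi> j \<omega> * c j"] by simp
      have "(\<lambda>j. \<xi> j \<omega> * c j - (if j \<in> I then \<xi> j \<omega> * c j else 0)) sums ((\<Sum>k. \<xi> k \<omega> * c k) - (\<Sum>j\<in>I. \<xi> j \<omega> * c j))"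
        by (intro sums_diff f summable_sums sm)
      moreover have "(\<lambda>j. \<xi> j \<omega> * c j - (if j \<in> I then \<xi> j \<omega> * c j else 0)) = (\<lambda>j. if j \<in> I then 0 else \<xi> j \<omega> * c j)"
        by auto
      ultimately have "(\<Sum>j. if j \<in> I then 0 else \<xi> j \<omega> * c j) = (\<Sum>k. \<xi> k \<omega> * c k) - (\<Sum>j\<in>I. \<xi> j \<omega> * c j)"
        by (simp add: sums_iff)
      then have "T \<omega> = h (\<Sum>k. \<xi> k \<omega> * c k)" using h by (auto simp: T_def)
      moreover have "\<bar>h (\<Sum>k. \<xi> k \<omega> * c k)\<bar> \<le> s" using h le abs_Re_le_cmod abs_Im_le_cmod order_trans by blast
      ultimately have "-s \<le> T \<omega>" "T \<omega> \<le> s" by auto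
      then show ?thesis using s \<omega> by (auto simp: A_def grid_union_def gg_def)
    qed
    ultimately show "\<exists>A\<in>events. (\<exists>m\<ge>N. prob A \<le> walk_bound p m 1) \<and>
         (\<forall>\<omega>\<in>space M. summable (\<lambda>k. \<xi> k \<omega> * c k) \<and> cmod (\<Sum>k. \<xi> k \<omega> * c k) \<le> s \<longrightarrow> \<omega> \<in> A)"
      using Ae h(2) unfolding I_def by (intro bexI[of _ A]) auto
  qed
  show ?thesis
  proof (rule that[of "g0 / 2" p])
    show "\<forall>c J N l s. finite J \<and> 2 * N \<le> card J \<and> (\<forall>k\<in>J. l \<le> cmod (c k)) \<and> 2 * s < l * (g0 / 2) \<and> l > 0 \<longrightarrow>
       (\<exists>A\<in>events. (\<exists>m\<ge>N. prob A \<le> walk_bound p m 1) \<and>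
         (\<forall>\<omega>\<in>space M. summable (\<lambda>k. \<xi> k \<omega> * c k) \<and> cmod (\<Sum>k. \<xi> k \<omega> * c k) \<le> s \<longrightarrow> \<omega> \<in> A))"
      using main by blast
  qed (use g0 p in auto)
qed

section \<open>Consequences of the assumptions on the coefficients\<close>

lemma inv_root_ge_iff:
  assumes "t > 0" "c > 0" "x \<ge> 0"
  shows "inv_root t x \<ge> ereal c \<longleftrightarrow> x \<le> c powr (- t)"
proof (cases "x = 0")
  case False
  then have x: "x > 0" using assms by simp
  have "c \<le> x powr (- 1 / t) \<longleftrightarrow> x \<le> c powr (- t)"
  proof
    assume "c \<le> x powr (- 1 / t)"
    then have "(x powr (- 1 / t)) powr (- t) \<le> c powr (- t)"
      using assms by (intro powr_mono2') auto
    then show "x \<le> c powr (- t)" using x assms by (simp add: powr_powr)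
  next
    assume "x \<le> c powr (- t)"
    then have "(c powr (- t)) powr (- 1 / t) \<le> x powr (- 1 / t)"
      using assms x by (intro powr_mono2') auto
    then show "c \<le> x powr (- 1 / t)" using assms by (simp add: powr_powr)
  qed
  then show ?thesis using False by (simp add: inv_root_def)
qed (use assms in \<open>simp add: inv_root_def\<close>)

locale taylor_profile =
  fixes F :: "nat \<Rightarrow> nat \<Rightarrow> complex" and f :: "real \<Rightarrow> real" and T0 R0 :: ereal
  assumes f_nonneg: "\<And>t. t \<ge> 0 \<Longrightarrow> f t \<ge> 0"
    and T0_pos: "T0 > 0"
    and A1_pos: "\<And>t. t \<ge> 0 \<Longrightarrow> ereal t < T0 \<Longrightarrow> f t > 0"
    and A1_zero: "\<And>t. t \<ge> 0 \<Longrightarrow> ereal t > T0 \<Longrightarrow> f t = 0"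
    and A2_cont: "continuous_on {t. 0 \<le> t \<and> ereal t < T0} f"
    and A2_left: "\<And>T. T0 = ereal T \<Longrightarrow> continuous (at_left T) f"
    and A3: "\<And>A::real. A > 0 \<Longrightarrow>
      (\<lambda>n. SUP k\<in>{k::nat. real k \<le> A * real n}.
             \<bar>norm (F k n) powr (1 / real n) - f (real k / real n)\<bar>) \<longlonglongrightarrow> 0"
    and R0_eq: "R0 = Liminf at_top (\<lambda>t::real. inv_root t (f t))"
    and R0_pos: "R0 > 0"
    and A4: "\<And>c::real. ereal c < R0 \<Longrightarrow>
      \<exists>A::real. A > 0 \<and> (\<forall>n k. real n \<ge> A \<and> real k \<ge> A * real n \<longrightarrow>
        inv_root (real k) (norm (F k n)) \<ge> ereal c)"
begin

text \<open>The exponential of the conjugate: in multiplicative form the zeros of f need no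
  convention for the logarithm.\<close>

definition U :: "real \<Rightarrow> real" where "U s = (SUP t\<in>{0..}. f t * exp (s * t))"
definition I :: "real \<Rightarrow> real" where "I s = ln (U s)"

lemma f0: "f 0 > 0" using A1_pos[of 0] T0_pos by (simp add: zero_ereal_def)

text \<open>Compactness works strictly below T0, left continuity controls the last stretch before
  T0, and f vanishes beyond it.\<close>

lemma f_bounded: "\<exists>C. \<forall>t\<in>{0..t1}. f t \<le> C"
proof -
  have comp: "\<exists>C. \<forall>t\<in>{0..b}. f t \<le> C" if "ereal b < T0" for b
  proof -
    have "continuous_on {0..b} f"
      by (rule continuous_on_subset[OF A2_cont]) (use ereal_le_less[OF _ that] in auto)
    then have "bdd_above (f ` {0..b})"
      by (intro bounded_imp_bdd_above compact_imp_bounded compact_continuous_image) auto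
    then show ?thesis by (auto simp: bdd_above_def)
  qed
  show ?thesis
  proof (cases "ereal t1 < T0")
    case True
    then show ?thesis by (rule comp)
  next
    case False
    then obtain T where T: "T0 = ereal T" using T0_pos by (cases T0) auto
    have T1: "T > 0" using T T0_pos by simp
    have "(f \<longlongrightarrow> f T) (at_left T)" using A2_left[OF T] by (simp add: continuous_within)
    then have "eventually (\<lambda>t. f t < f T + 1) (at_left T)" by (rule order_tendstoD) simp
    then obtain b where b: "b < T" "\<And>t. b < t \<Longrightarrow> t < T \<Longrightarrow> f t < f T + 1"
      by (auto simp: eventually_at_left[of "T - 1"])
    obtain C where C: "\<forall>t\<in>{0..max 0 b}. f t \<le> C" using comp[of "max 0 b"] b T1 T by auto
    have "f t \<le> max C (f T + 1)" if t: "t \<ge> 0" for t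
    proof -
      consider "t \<le> max 0 b" | "b < t" "t < T" | "t = T" | "t > T" by linarith
      then show ?thesis
      proof cases
        case 1 then show ?thesis using C t by (auto simp: le_max_iff_disj)
      next
        case 2 then show ?thesis using b(2)[of t] by (auto simp: le_max_iff_disj)
      next
        case 4
        then have "f t = 0" using A1_zero[OF t] T by simp
        moreover have "f T \<ge> 0" using f_nonneg T1 by simp
        ultimately show ?thesis by (auto simp: le_max_iff_disj)
      qed auto
    qed
    then show ?thesis by (intro exI[of _ "max C (f T + 1)"]) auto
  qed
qed

text \<open>For c strictly between \<open>exp s\<close> and R0, eventually
  \<open>f t \<le> c powr (- t)\<close>, which outweighs \<open>exp (s * t)\<close>; the remaining t
  form a bounded interval.\<close>

lemma U_bdd:
  assumes s: "ereal (exp s) < R0"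
  shows "bdd_above ((\<lambda>t. f t * exp (s * t)) ` {0..})"
proof -
  obtain c where c: "ereal (exp s) < ereal c" "ereal c < R0" using ereal_dense2[OF s] by blast
  then have c0: "c > 0" "exp s < c" using exp_gt_zero[of s] by (auto intro: less_trans simp del: exp_gt_zero)
  have "eventually (\<lambda>t. ereal c < inv_root t (f t)) at_top"
    using c(2) unfolding R0_eq by (rule less_LiminfD)
  then obtain t1 where t1: "\<And>t. t \<ge> t1 \<Longrightarrow> ereal c < inv_root t (f t)" by (auto simp: eventually_at_top_linorder)
  obtain C where C: "\<forall>t\<in>{0..max t1 1}. f t \<le> C" using f_bounded by blast
  show ?thesis
  proof (rule bdd_aboveI2)
    fix t :: real assume "t \<in> {0..}"
    then have t: "t \<ge> 0" by simp
    show "f t * exp (s * t) \<le> max 1 (C * exp (\<bar>s\<bar> * max t1 1))"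
    proof (cases "t \<le> max t1 1")
      case True
      have "f 0 \<le> C" using C by simp
      then have "C \<ge> 0" using f0 by simp
      then have "f t * exp (s * t) \<le> C * exp (\<bar>s\<bar> * max t1 1)"
        using True t C f_nonneg[OF t] by (intro mult_mono) (auto intro!: mult_mono)
      then show ?thesis by simp
    next
      case False
      then have tt: "t > 0" "t \<ge> t1" by auto
      have "f t \<le> c powr (- t)"
        using t1[OF tt(2)] inv_root_ge_iff[OF tt(1) c0(1) f_nonneg[OF t]] by auto
      then have "f t * exp (s * t) \<le> c powr (- t) * c powr t"
      proof (rule mult_mono)
        have "exp (s * t) = exp s powr t" by (simp add: powr_def mult.commute)
        also have "\<dots> \<le> c powr t" using c0 tt by (intro powr_mono2) auto
        finally show "exp (s * t) \<le> c powr t" .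
      qed auto
      also have "\<dots> = 1" using c0 by (simp flip: powr_add)
      finally show ?thesis by simp
    qed
  qed
qed

lemma U_pos: "ereal (exp s) < R0 \<Longrightarrow> U s > 0"
proof -
  assume s: "ereal (exp s) < R0"
  have "f 0 * exp (s * 0) \<le> U s" unfolding U_def by (rule cSUP_upper[OF _ U_bdd[OF s]]) simp
  then show ?thesis using f0 by simp
qed

lemma f_le_exp_I: "ereal (exp s) < R0 \<Longrightarrow> t \<ge> 0 \<Longrightarrow> f t * exp (s * t) \<le> exp (I s)"
  unfolding I_def using U_pos[of s] U_bdd[of s] by (auto simp: U_def intro: cSUP_upper2)

lemma I_approx: "ereal (exp s) < R0 \<Longrightarrow> x < exp (I s) \<Longrightarrow> \<exists>t\<ge>0. x < f t * exp (s * t)"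
  unfolding I_def using U_pos[of s] U_bdd[of s] by (auto simp: U_def less_cSUP_iff)

lemma ln_f_le_I: "ereal (exp s) < R0 \<Longrightarrow> t \<ge> 0 \<Longrightarrow> f t > 0 \<Longrightarrow> s * t + ln (f t) \<le> I s"
proof -
  assume s: "ereal (exp s) < R0" "t \<ge> 0" "f t > 0"
  have "ln (f t * exp (s * t)) \<le> ln (exp (I s))" using f_le_exp_I[OF s(1,2)] s by (intro ln_mono) auto
  then show ?thesis using s by (simp add: ln_mult)
qed

lemma I_least:
  assumes s: "ereal (exp s) < R0" and "\<And>t. t \<ge> 0 \<Longrightarrow> f t > 0 \<Longrightarrow> s * t + ln (f t) \<le> y"
  shows "I s \<le> y"
proof (rule ccontr)
  assume "\<not> I s \<le> y"
  then have "exp y < exp (I s)" by simp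
  from I_approx[OF s this] obtain t where t: "t \<ge> 0" "exp y < f t * exp (s * t)" by blast
  then have ft: "f t > 0" using f_nonneg[OF t(1)] exp_gt_zero[of y] by (cases "f t = 0") (auto simp del: exp_gt_zero)
  have "ln (exp y) < ln (f t * exp (s * t))" using t ft by (subst ln_less_cancel_iff) auto
  then have "y < s * t + ln (f t)" using ft by (simp add: ln_mult)
  then show False using assms(2)[OF t(1) ft] by simp
qed

lemma conjugate_not_MInf: "conjugate f s \<noteq> -\<infinity>"
proof -
  have "ereal (s * 0) + ext_ln (f 0) \<le> conjugate f s"
    unfolding conjugate_def by (rule SUP_upper) simp
  then show ?thesis using f0 by (auto simp: ext_ln_def)
qed

lemma conjugate_eq:
  assumes s: "ereal (exp s) < R0"
  shows "conjugate f s = ereal (I s)"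
  unfolding conjugate_def
proof (rule SUP_eqI)
  fix t :: real assume "t \<in> {0..}"
  then show "ereal (s * t) + ext_ln (f t) \<le> ereal (I s)"
    using ln_f_le_I[OF s, of t] f_nonneg[of t] by (cases "f t = 0") (auto simp: ext_ln_def)
next
  fix y assume y: "\<And>t. t \<in> {0..} \<Longrightarrow> ereal (s * t) + ext_ln (f t) \<le> y"
  show "ereal (I s) \<le> y"
  proof (cases y)
    case (real r)
    have "I s \<le> r"
    proof (rule I_least[OF s])
      fix t assume "0 \<le> t" "0 < f t"
      then show "s * t + ln (f t) \<le> r" using y[of t] real by (simp add: ext_ln_def)
    qed
    then show ?thesis using real by simp
  next
    case MInf
    then show ?thesis using y[of 0] f0 by (simp add: ext_ln_def)
  qed simp
qed

text \<open>I is a supremum of affine functions of s with slopes t \<ge> 0, hence convex and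
  monotone; the member t = 0 supplies the lower bound.\<close>

sublocale convex_profile I R0 "ln (f 0)"
proof
  show "R0 > 0" by (rule R0_pos)
  show "I s \<le> I t" if "s \<le> t" "ereal (exp t) < R0" for s t
  proof (rule I_least)
    show "ereal (exp s) < R0" using that ereal_le_less[of "exp s" "exp t"] by simp
    fix x :: real assume x: "x \<ge> 0" "f x > 0"
    have "s * x \<le> t * x" using that x by (intro mult_right_mono)
    then show "s * x + ln (f x) \<le> I t" using ln_f_le_I[OF that(2) x] by simp
  qed
  show "ln (f 0) \<le> I s" if "ereal (exp s) < R0" for s
    using ln_f_le_I[OF that, of 0] f0 by simp
  have cS: "convex {s. ereal (exp s) < R0}"
  proof -
    have "is_interval {s. ereal (exp s) < R0}"
      unfolding is_interval_1
    proof (intro ballI allI impI)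
      fix a b x :: real
      assume "b \<in> {s. ereal (exp s) < R0}" "a \<le> x \<and> x \<le> b"
      then show "x \<in> {s. ereal (exp s) < R0}" using ereal_le_less[of "exp x" "exp b" R0] by simp
    qed
    then show ?thesis by (simp add: is_interval_convex)
  qed
  show "convex_on {s. ereal (exp s) < R0} I"
  proof (rule convex_onI[OF _ cS])
    fix l x y :: real
    assume l: "0 < l" "l < 1" and xy: "x \<in> {s. ereal (exp s) < R0}" "y \<in> {s. ereal (exp s) < R0}"
    show "I ((1 - l) *\<^sub>R x + l *\<^sub>R y) \<le> (1 - l) * I x + l * I y"
    proof (rule I_least)
      show "ereal (exp ((1 - l) *\<^sub>R x + l *\<^sub>R y)) < R0"
        using convexD[OF cS xy, of "1 - l" l] l by simp
      fix t assume t: "0 \<le> t" "0 < f t"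
      have "((1 - l) *\<^sub>R x + l *\<^sub>R y) * t + ln (f t) = (1 - l) * (x * t + ln (f t)) + l * (y * t + ln (f t))"
        by (simp add: algebra_simps)
      also have "\<dots> \<le> (1 - l) * I x + l * I y"
        using ln_f_le_I[of x t] ln_f_le_I[of y t] xy t l by (intro add_mono mult_left_mono) auto
      finally show "((1 - l) *\<^sub>R x + l *\<^sub>R y) * t + ln (f t) \<le> (1 - l) * I x + l * I y" .
    qed
  qed
qed

section \<open>Exponential size of the coefficients\<close>

lemma coefficient_approx:
  assumes "A > 0" "\<epsilon> > 0"
  shows "eventually (\<lambda>n. \<forall>k. real k \<le> A * real n \<longrightarrow> \<bar>norm (F k n) powr (1 / real n) - f (real k / real n)\<bar> < \<epsilon>) sequentially"
proof -
  have "eventually (\<lambda>n. (SUP k\<in>{k::nat. real k \<le> A * real n}.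
             \<bar>norm (F k n) powr (1 / real n) - f (real k / real n)\<bar>) < \<epsilon>) sequentially"
    using A3[OF assms(1)] assms(2) by (rule order_tendstoD)
  then show ?thesis
  proof eventually_elim
    case (elim n)
    show ?case
    proof (intro allI impI)
      fix k :: nat assume k: "real k \<le> A * real n"
      \<comment> \<open>Only over a bounded family is the conditionally complete supremum an upper
        bound; finiteness guarantees this.\<close>
      have "finite {k::nat. real k \<le> A * real n}"
        by (rule finite_subset[of _ "{..nat \<lfloor>A * real n\<rfloor>}"]) (auto simp: le_nat_floor)
      then have "\<bar>norm (F k n) powr (1 / real n) - f (real k / real n)\<bar> \<le> (SUP k\<in>{k::nat. real k \<le> A * real n}.
             \<bar>norm (F k n) powr (1 / real n) - f (real k / real n)\<bar>)"
        using k by (intro cSUP_upper) auto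
      then show "\<bar>norm (F k n) powr (1 / real n) - f (real k / real n)\<bar> < \<epsilon>" using elim by simp
    qed
  qed
qed

lemma powr_inverse_power: "x \<ge> 0 \<Longrightarrow> n > 0 \<Longrightarrow> (x powr (1 / real n)) ^ n = x"
  by (cases "x = 0") (auto simp: powr_realpow[symmetric] powr_powr)

text \<open>For k up to A' n each term is controlled by f, and their linear number is absorbed by
  the exponential tolerance; beyond A' n the terms decay geometrically. Uniformity in s \<le> s1
  rests on the lower bound m of I, against which all errors are measured.\<close>

lemma coefficient_sum_bound:
  assumes s1: "s1 \<in> S" and \<eta>: "\<eta> > 0"
  shows "eventually (\<lambda>n. \<forall>s\<le>s1. summable (\<lambda>k. cmod (F k n) * exp (s * real k)) \<and>
     (\<Sum>k. cmod (F k n) * exp (s * real k)) \<le> exp (real n * (I s + \<eta>))) sequentially"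
proof -
  define m where "m = ln (f 0)"
  obtain c where c: "ereal (exp s1) < ereal c" "ereal c < R0" using s1 ereal_dense2 by blast
  then have c0: "c > 0" "exp s1 < c" using exp_gt_zero[of s1] by (auto intro: less_trans simp del: exp_gt_zero)
  define \<theta> where "\<theta> = exp s1 / c"
  have \<theta>: "0 < \<theta>" "\<theta> < 1" using c0 by (auto simp: \<theta>_def)
  obtain A where A: "A > 0" "\<And>n k. real n \<ge> A \<Longrightarrow> real k \<ge> A * real n \<Longrightarrow> inv_root (real k) (norm (F k n)) \<ge> ereal c"
    using A4[OF c(2)] by blast
  \<comment> \<open>Chosen so that \<open>\<theta>\<close> to the power A' n is at most
    \<open>exp (n * (m - 1))\<close>, making the tail negligible against
    \<open>exp (n * I s)\<close> for every s at once.\<close>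
  obtain A' where A': "A' \<ge> A" "A' \<ge> 1" "A' * ln \<theta> \<le> m - 1"
  proof -
    have l: "ln \<theta> < 0" using \<theta> by simp
    define A' where "A' = max (max A 1) ((m - 1) / ln \<theta>)"
    have "A' * ln \<theta> \<le> (m - 1) / ln \<theta> * ln \<theta>" using l by (intro mult_right_mono_neg) (auto simp: A'_def)
    then show ?thesis using l by (intro that[of A']) (auto simp: A'_def)
  qed
  define E where "E = exp (\<bar>s1\<bar> * A')"
  have E: "E > 0" by (simp add: E_def)
  \<comment> \<open>E bounds \<open>exp (s * t)\<close> for s \<le> s1 and 0 \<le> t \<le> A', so
    the error \<eta>' in the n-th root costs at most \<eta> / 2 times \<open>exp m\<close>, and
    hence at most \<eta> / 2 times \<open>exp (I s)\<close>.\<close>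
  define \<eta>' where "\<eta>' = \<eta> / 2 * exp m / E"
  have \<eta>': "\<eta>' > 0" using \<eta> E by (simp add: \<eta>'_def)
  have ev1: "eventually (\<lambda>n. \<forall>k. real k \<le> A' * real n \<longrightarrow> \<bar>norm (F k n) powr (1 / real n) - f (real k / real n)\<bar> < \<eta>') sequentially"
    using coefficient_approx A' \<eta>' by simp
  have ev2: "eventually (\<lambda>n. exp (- real n) / (1 - \<theta>) \<le> 1 / 2) sequentially"
  proof -
    have "(\<lambda>n. exp (- real n)) \<longlonglongrightarrow> 0" by real_asymp
    from tendsto_mult_left_zero[OF this, of "1 / (1 - \<theta>)"]
    have "(\<lambda>n. exp (- real n) / (1 - \<theta>)) \<longlonglongrightarrow> 0" by simp
    then have "eventually (\<lambda>n. exp (- real n) / (1 - \<theta>) < 1 / 2) sequentially" by (rule order_tendstoD) simp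
    then show ?thesis by eventually_elim simp
  qed
  \<comment> \<open>At most A' n + 1 terms belong to the head; the second 1 accounts for the whole
    tail.\<close>
  have ev3: "eventually (\<lambda>n. A' * real n + 2 \<le> exp (real n * (\<eta> / 2))) sequentially"
    using \<eta> by real_asymp
  have ev4: "eventually (\<lambda>n. real n \<ge> A) sequentially" by real_asymp
  have ev5: "eventually (\<lambda>n. n > 0) sequentially" by (rule eventually_gt_at_top)
  show ?thesis using ev1 ev2 ev3 ev4 ev5
  proof eventually_elim
    case (elim n)
    show ?case
    proof (intro allI impI)
      fix s assume s: "s \<le> s1"
      then have sS: "s \<in> S" using S_down[OF s1] by simp
      have mI: "m \<le> I s" using lower sS by (simp add: m_def)
      define b where "b k = cmod (F k n) * exp (s * real k)" for k
      have b0: "b k \<ge> 0" for k by (simp add: b_def)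
      define K where "K = {k::nat. real k \<le> A' * real n}"
      have Kf: "finite K" "real (card K) \<le> A' * real n + 1"
      proof -
        have sub: "K \<subseteq> {..nat \<lfloor>A' * real n\<rfloor>}" by (auto simp: K_def le_nat_floor)
        then show "finite K" by (rule finite_subset) simp
        have "card K \<le> nat \<lfloor>A' * real n\<rfloor> + 1" using card_mono[OF _ sub] by simp
        then have "real (card K) \<le> real (nat \<lfloor>A' * real n\<rfloor>) + 1" by linarith
        also have "real (nat \<lfloor>A' * real n\<rfloor>) \<le> A' * real n" using A' by (intro of_nat_floor) simp
        finally show "real (card K) \<le> A' * real n + 1" by simp
      qed
      have head: "b k \<le> exp (real n * (I s + \<eta> / 2))" if k: "k \<in> K" for k
      proof -
        define t where "t = real k / real n"
        have t: "0 \<le> t" "t \<le> A'" "real k = t * real n" using k elim(5) by (auto simp: t_def K_def field_simps)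
        have "cmod (F k n) powr (1 / real n) \<le> f t + \<eta>'"
          using elim(1) k unfolding K_def t_def by (smt (verit) mem_Collect_eq)
        then have "cmod (F k n) powr (1 / real n) * exp (s * t) \<le> (f t + \<eta>') * exp (s * t)"
          by (rule mult_right_mono) simp
        also have "\<dots> \<le> exp (I s) + \<eta>' * E"
        proof -
          have "s * t \<le> \<bar>s1\<bar> * A'"
          proof -
            have "s * t \<le> \<bar>s1\<bar> * t" using s t by (intro mult_right_mono) auto
            also have "\<dots> \<le> \<bar>s1\<bar> * A'" using t by (intro mult_left_mono) auto
            finally show ?thesis .
          qed
          then have "\<eta>' * exp (s * t) \<le> \<eta>' * E" using \<eta>' by (simp add: E_def)
          moreover have "f t * exp (s * t) \<le> exp (I s)" using f_le_exp_I sS t by simp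
          ultimately show ?thesis by (simp add: distrib_right)
        qed
        also have "\<dots> \<le> exp (I s) * (1 + \<eta> / 2)"
        proof -
          have "\<eta>' * E = \<eta> / 2 * exp m" using E by (simp add: \<eta>'_def)
          also have "\<dots> \<le> \<eta> / 2 * exp (I s)" using mI \<eta> by simp
          finally show ?thesis by (simp add: algebra_simps)
        qed
        also have "\<dots> \<le> exp (I s) * exp (\<eta> / 2)"
          by (intro mult_left_mono exp_ge_add_one_self) simp
        finally have "cmod (F k n) powr (1 / real n) * exp (s * t) \<le> exp (I s + \<eta> / 2)" by (simp add: exp_add)
        then have "(cmod (F k n) powr (1 / real n) * exp (s * t)) ^ n \<le> exp (I s + \<eta> / 2) ^ n"
          by (intro power_mono) auto
        moreover have "(cmod (F k n) powr (1 / real n) * exp (s * t)) ^ n = b k"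
          using elim(5) by (simp add: power_mult_distrib powr_inverse_power b_def t(3) exp_of_nat_mult[symmetric] mult_ac)
        ultimately show ?thesis by (simp add: exp_of_nat_mult)
      qed
      have tail: "b k \<le> \<theta> ^ k" if k: "k \<notin> K" for k
      proof -
        have k1: "real k \<ge> A' * real n" "A' * real n > 0" using k elim(5) A' by (auto simp: K_def)
        then have kp: "real k > 0" by simp
        have "real k \<ge> A * real n" using k1 A' mult_right_mono[of A A' "real n"] by simp
        then have "cmod (F k n) \<le> c powr (- real k)"
          using A(2)[OF elim(4)] inv_root_ge_iff[OF kp c0(1), of "cmod (F k n)"] by simp
        then have "b k \<le> c powr (- real k) * exp (s1 * real k)"
          unfolding b_def using s by (intro mult_mono) (auto intro: mult_right_mono)
        also have "\<dots> = \<theta> ^ k"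
          using c0 by (simp add: \<theta>_def powr_minus powr_realpow power_divide exp_of_nat2_mult field_simps)
        finally show ?thesis .
      qed
      have bs: "summable b"
      proof (rule summable_comparison_test_ev)
        have "eventually (\<lambda>k. k \<notin> K) sequentially"
          using Kf(1) unfolding finite_nat_set_iff_bounded eventually_sequentially by (meson not_le)
        then show "eventually (\<lambda>k. norm (b k) \<le> \<theta> ^ k) sequentially"
          by eventually_elim (use tail b0 in simp)
        show "summable (\<lambda>k. \<theta> ^ k)" using \<theta> by (intro summable_geometric) simp
      qed
      define k0 where "k0 = nat \<lceil>A' * real n\<rceil>"
      have k0: "real k0 \<ge> A' * real n" unfolding k0_def by (rule real_nat_ceiling_ge)
      have gs: "summable (\<lambda>k. \<theta> ^ (k + k0))" "(\<Sum>k. \<theta> ^ (k + k0)) = \<theta> ^ k0 / (1 - \<theta>)"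
      proof -
        have "(\<lambda>k. \<theta> ^ k0 * \<theta> ^ k) sums (\<theta> ^ k0 * (1 / (1 - \<theta>)))"
          by (intro sums_mult geometric_sums) (use \<theta> in simp)
        then have "(\<lambda>k. \<theta> ^ (k + k0)) sums (\<theta> ^ k0 / (1 - \<theta>))" by (simp add: power_add mult.commute)
        then show "summable (\<lambda>k. \<theta> ^ (k + k0))" "(\<Sum>k. \<theta> ^ (k + k0)) = \<theta> ^ k0 / (1 - \<theta>)" by (auto simp: sums_iff)
      qed
      \<comment> \<open>If A' n is an integer, k0 belongs to both parts; the overlap is harmless for
        an upper bound.\<close>
      have pt: "b k \<le> (if k \<in> K then b k else 0) + (if k < k0 then 0 else \<theta> ^ k)" for k
      proof (cases "k \<in> K")
        case False
        then have "\<not> k < k0" unfolding K_def k0_def by (simp add: not_le) linarith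
        then show ?thesis using False tail by simp
      qed (use \<theta> in auto)
      have s1s: "(\<lambda>k. if k \<in> K then b k else 0) sums (\<Sum>k\<in>K. b k)"
        using sums_If_finite_set[OF Kf(1), of b] by simp
      have s2s: "(\<lambda>k. if k < k0 then 0 else \<theta> ^ k) sums (\<theta> ^ k0 / (1 - \<theta>))"
      proof -
        have "(\<lambda>k. if k + k0 < k0 then 0 else \<theta> ^ (k + k0)) sums (\<theta> ^ k0 / (1 - \<theta>))"
          using gs by (simp add: sums_iff)
        then show ?thesis by (subst (asm) sums_iff_shift) simp
      qed
      have "suminf b \<le> (\<Sum>k\<in>K. b k) + \<theta> ^ k0 / (1 - \<theta>)"
        by (rule sums_le[OF pt summable_sums[OF bs] sums_add[OF s1s s2s]])
      also have "(\<Sum>k\<in>K. b k) \<le> real (card K) * exp (real n * (I s + \<eta> / 2))"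
        using sum_bounded_above[of K b] head by simp
      also have "\<dots> \<le> (A' * real n + 1) * exp (real n * (I s + \<eta> / 2))"
        using Kf by (intro mult_right_mono) auto
      also have "\<theta> ^ k0 / (1 - \<theta>) \<le> exp (real n * I s) / 2"
      proof -
        have "\<theta> ^ k0 = exp (real k0 * ln \<theta>)" using \<theta> by (simp add: exp_of_nat_mult)
        also have "\<dots> \<le> exp (A' * real n * ln \<theta>)" using k0 \<theta> by (simp add: mult_right_mono_neg)
        also have "A' * real n * ln \<theta> \<le> real n * (m - 1)"
          using mult_left_mono[OF A'(3), of "real n"] by (simp add: mult_ac)
        finally have "\<theta> ^ k0 \<le> exp (real n * (m - 1))" by simp
        also have "\<dots> = exp (real n * m) * exp (- real n)" by (simp add: exp_add[symmetric] algebra_simps)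
        finally have "\<theta> ^ k0 / (1 - \<theta>) \<le> exp (real n * m) * (exp (- real n) / (1 - \<theta>))"
          using \<theta> by (simp add: divide_right_mono)
        also have "\<dots> \<le> exp (real n * I s) * (1 / 2)"
          using elim(2) mI \<theta> by (intro mult_mono) (auto intro: mult_left_mono)
        finally show ?thesis by simp
      qed
      also have "exp (real n * I s) / 2 \<le> exp (real n * (I s + \<eta> / 2))"
      proof -
        have "exp (real n * I s) \<le> exp (real n * (I s + \<eta> / 2))" using \<eta> by (simp add: mult_left_mono)
        then show ?thesis using exp_gt_zero[of "real n * I s"] by linarith
      qed
      finally have "suminf b \<le> (A' * real n + 2) * exp (real n * (I s + \<eta> / 2))" by (simp add: algebra_simps)
      also have "\<dots> \<le> exp (real n * (\<eta> / 2)) * exp (real n * (I s + \<eta> / 2))"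
        using elim(3) by (intro mult_right_mono) auto
      also have "\<dots> = exp (real n * (I s + \<eta>))" by (simp add: exp_add[symmetric] algebra_simps)
      finally show "summable (\<lambda>k. cmod (F k n) * exp (s * real k)) \<and>
         (\<Sum>k. cmod (F k n) * exp (s * real k)) \<le> exp (real n * (I s + \<eta>))"
        using bs unfolding b_def by simp
    qed
  qed
qed

text \<open>Near an almost maximal t0 the function \<open>f t * exp (s * t)\<close> stays large on a
  whole interval, to the right of t0 if t0 < T0 and to the left if t0 = T0. Rescaling by n turns
  this interval into a window whose number of indices grows linearly in n.\<close>

lemma coefficient_lower_bound:
  assumes s: "s \<in> S" and \<epsilon>: "\<epsilon> > 0"
  obtains a b where "0 \<le> a" "a < b"
    "eventually (\<lambda>n. \<forall>k. a * real n \<le> real k \<and> real k \<le> b * real n \<longrightarrow>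
       exp (real n * (I s - \<epsilon>)) \<le> cmod (F k n) * exp (s * real k)) sequentially"
proof -
  \<comment> \<open>Half of the margin \<epsilon> is spent on the choice of the interval, the other
    half on replacing f by n-th roots of coefficients.\<close>
  define thr where "thr = exp (I s - \<epsilon> / 2)"
  obtain a b where ab: "0 \<le> a" "a < b" "\<And>t. a \<le> t \<Longrightarrow> t \<le> b \<Longrightarrow> thr < f t * exp (s * t)"
  proof -
    have "thr < exp (I s)" using \<epsilon> by (simp add: thr_def)
    then obtain t0 where t0: "t0 \<ge> 0" "thr < f t0 * exp (s * t0)" using I_approx s by blast
    show ?thesis
    proof (cases "ereal t0 < T0")
      case True
      let ?D = "{t. 0 \<le> t \<and> ereal t < T0}"
      obtain t1 where t1: "ereal t0 < ereal t1" "ereal t1 < T0" using ereal_dense2[OF True] by blast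
      have "continuous_on ?D (\<lambda>t. f t * exp (s * t))" by (intro continuous_intros A2_cont)
      then have "((\<lambda>t. f t * exp (s * t)) \<longlongrightarrow> f t0 * exp (s * t0)) (at t0 within ?D)"
        using t0 True by (auto simp: continuous_on_def)
      then have "eventually (\<lambda>t. thr < f t * exp (s * t)) (at t0 within ?D)"
        using t0(2) by (rule order_tendstoD)
      then obtain d where d: "d > 0" "\<And>t. t \<in> ?D \<Longrightarrow> t \<noteq> t0 \<Longrightarrow> dist t t0 < d \<Longrightarrow> thr < f t * exp (s * t)"
        by (auto simp: eventually_at)
      define b where "b = min t1 (t0 + d / 2)"
      show ?thesis
      proof (rule that[of t0 b])
        show "t0 < b" using t1 d by (simp add: b_def)
        fix t assume t: "t0 \<le> t" "t \<le> b"
        then have "t \<le> t1" by (simp add: b_def)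
        then have "t \<in> ?D" using t t0 ereal_le_less[OF _ t1(2)] by auto
        moreover have "dist t t0 < d" using t d by (auto simp: b_def dist_real_def)
        ultimately show "thr < f t * exp (s * t)" using d t0 by (cases "t = t0") auto
      qed (rule t0)
    next
      case False
      have "f t0 \<noteq> 0" using t0 exp_gt_zero[of "I s - \<epsilon> / 2"] by (auto simp: thr_def simp del: exp_gt_zero)
      then have "\<not> ereal t0 > T0" using A1_zero t0 by blast
      then have T: "T0 = ereal t0" using False by simp
      have T1: "t0 > 0" using T T0_pos by simp
      have "((\<lambda>t. f t * exp (s * t)) \<longlongrightarrow> f t0 * exp (s * t0)) (at_left t0)"
        using A2_left[OF T] by (intro tendsto_intros) (simp_all add: continuous_within)
      then have "eventually (\<lambda>t. thr < f t * exp (s * t)) (at_left t0)"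
        using t0(2) by (rule order_tendstoD)
      then obtain b0 where b0: "b0 < t0" "\<And>t. b0 < t \<Longrightarrow> t < t0 \<Longrightarrow> thr < f t * exp (s * t)"
        by (auto simp: eventually_at_left[of "t0 - 1"])
      define c where "c = max 0 b0"
      have c: "c < t0" "c \<ge> 0" "c \<ge> b0" using b0 T1 by (auto simp: c_def)
      \<comment> \<open>The middle third of (c, t0) is a closed interval strictly inside the region
        where the bound is known.\<close>
      show ?thesis
        by (rule that[of "(2 * c + t0) / 3" "(c + 2 * t0) / 3"]) (use c b0(2) in auto)
    qed
  qed
  define E where "E = exp (\<bar>s\<bar> * b)"
  have E: "E > 0" by (simp add: E_def)
  define \<eta>' where "\<eta>' = (thr - exp (I s - \<epsilon>)) / E"
  have \<eta>': "\<eta>' > 0" using \<epsilon> E by (simp add: \<eta>'_def thr_def)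
  have b: "b > 0" using ab by simp
  show ?thesis
  proof (rule that[OF ab(1,2)])
    show "eventually (\<lambda>n. \<forall>k. a * real n \<le> real k \<and> real k \<le> b * real n \<longrightarrow>
       exp (real n * (I s - \<epsilon>)) \<le> cmod (F k n) * exp (s * real k)) sequentially"
      using coefficient_approx[OF b \<eta>'] eventually_gt_at_top[of 0]
    proof eventually_elim
      case (elim n)
      show ?case
      proof (intro allI impI)
        fix k :: nat assume k: "a * real n \<le> real k \<and> real k \<le> b * real n"
        define t where "t = real k / real n"
        have t: "a \<le> t" "t \<le> b" "real k = t * real n" using k elim by (auto simp: t_def field_simps)
        have "f t - \<eta>' \<le> cmod (F k n) powr (1 / real n)"
          using elim(1) k unfolding t_def by (smt (verit))
        then have "(f t - \<eta>') * exp (s * t) \<le> cmod (F k n) powr (1 / real n) * exp (s * t)"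
          by (rule mult_right_mono) simp
        moreover have "exp (I s - \<epsilon>) \<le> (f t - \<eta>') * exp (s * t)"
        proof -
          have "s * t \<le> \<bar>s\<bar> * b"
            using t ab by (meson abs_ge_self abs_ge_zero mult_mono order_trans)
          then have "\<eta>' * exp (s * t) \<le> \<eta>' * E" using \<eta>' by (simp add: E_def)
          also have "\<dots> = thr - exp (I s - \<epsilon>)" using E by (simp add: \<eta>'_def)
          finally show ?thesis using ab(3)[OF t(1,2)] by (simp add: left_diff_distrib)
        qed
        ultimately have "exp (I s - \<epsilon>) \<le> cmod (F k n) powr (1 / real n) * exp (s * t)" by (rule order_trans[rotated])
        then have "exp (I s - \<epsilon>) ^ n \<le> (cmod (F k n) powr (1 / real n) * exp (s * t)) ^ n"
          by (intro power_mono) auto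
        moreover have "(cmod (F k n) powr (1 / real n) * exp (s * t)) ^ n = cmod (F k n) * exp (s * real k)"
          using elim(2) by (simp add: power_mult_distrib powr_inverse_power t(3) exp_of_nat_mult[symmetric] mult_ac)
        ultimately show "exp (real n * (I s - \<epsilon>)) \<le> cmod (F k n) * exp (s * real k)"
          by (simp add: exp_of_nat_mult)
      qed
    qed
  qed
qed

end

section \<open>Bounds on the random series in probability\<close>

lemma real_nat_ceiling_le:
  assumes "0 \<le> x"
  shows "real (nat \<lceil>x\<rceil>) \<le> x + 1"
proof -
  have "-1 < x" using assms by linarith
  then have "real (nat \<lceil>x\<rceil>) = real_of_int \<lceil>x\<rceil>" by (simp add: of_nat_nat)
  then show ?thesis using of_int_ceiling_le_add_one[of x] by simp
qed

text \<open>The probabilities of \<open>cmod (\<xi> k) > exp (\<delta> * k)\<close> sum to at most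
  the mean of Y + 1 with Y = \<open>ln (1 + cmod (\<xi> 0)) / \<delta>\<close>, so Borel-Cantelli
  leaves finitely many exceptions almost surely. A random constant absorbs them, and continuity from
  below makes it deterministic outside an event of small probability.\<close>

lemma (in prob_space) exponential_growth_bound:
  fixes \<xi> :: "nat \<Rightarrow> 'a \<Rightarrow> complex"
  assumes rv[measurable]: "\<And>k. random_variable borel (\<xi> k)"
    and ident: "\<And>k. distr M borel (\<xi> k) = distr M borel (\<xi> 0)"
    and lm: "integrable M (\<lambda>\<omega>. ln (1 + norm (\<xi> 0 \<omega>)))"
    and \<delta>: "\<delta> > 0" and \<epsilon>: "\<epsilon> > 0"
  obtains C where "C > 0" "prob {\<omega>\<in>space M. \<not> (\<forall>k. cmod (\<xi> k \<omega>) \<le> C * exp (\<delta> * real k))} < \<epsilon>"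
proof -
  define Bad where "Bad k = {\<omega>\<in>space M. cmod (\<xi> k \<omega>) > exp (\<delta> * real k)}" for k
  have Bm[measurable]: "Bad k \<in> events" for k unfolding Bad_def by measurable
  define Y where "Y \<omega> = ln (1 + norm (\<xi> 0 \<omega>)) / \<delta>" for \<omega>
  have pB: "emeasure M (Bad k) \<le> emeasure M {\<omega>\<in>space M. real k < Y \<omega>}" for k
  proof -
    have "emeasure M (Bad k) = emeasure (distr M borel (\<xi> k)) {x. cmod x > exp (\<delta> * real k)}"
      by (subst emeasure_distr) (auto simp: Bad_def intro!: arg_cong[where f="emeasure M"])
    also have "\<dots> = emeasure M {\<omega>\<in>space M. cmod (\<xi> 0 \<omega>) > exp (\<delta> * real k)}"
      unfolding ident[of k] by (subst emeasure_distr) (auto intro!: arg_cong[where f="emeasure M"])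
    also have "\<dots> \<le> emeasure M {\<omega>\<in>space M. real k < Y \<omega>}"
    proof (rule emeasure_mono)
      show "{\<omega>\<in>space M. cmod (\<xi> 0 \<omega>) > exp (\<delta> * real k)} \<subseteq> {\<omega>\<in>space M. real k < Y \<omega>}"
      proof safe
        fix \<omega> assume "exp (\<delta> * real k) < cmod (\<xi> 0 \<omega>)"
        then have "exp (\<delta> * real k) < 1 + cmod (\<xi> 0 \<omega>)" by simp
        then have "ln (exp (\<delta> * real k)) < ln (1 + cmod (\<xi> 0 \<omega>))" by (subst ln_less_cancel_iff) (auto intro: add_pos_nonneg)
        then show "real k < Y \<omega>" using \<delta> by (simp add: Y_def field_simps)
      qed
      show "{\<omega>\<in>space M. real k < Y \<omega>} \<in> events" unfolding Y_def by measurable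
    qed
    finally show ?thesis .
  qed
  have Ynn: "0 \<le> Y \<omega>" for \<omega> using \<delta> by (simp add: Y_def)
  have "(\<Sum>k. emeasure M (Bad k)) \<le> (\<Sum>k. emeasure M {\<omega>\<in>space M. real k < Y \<omega>})"
    by (intro suminf_le pB) auto
  also have "\<dots> = (\<Sum>k. \<integral>\<^sup>+\<omega>. indicator {\<omega>\<in>space M. real k < Y \<omega>} \<omega> \<partial>M)"
    unfolding Y_def by (intro suminf_cong nn_integral_indicator[symmetric]) measurable
  also have "\<dots> = (\<integral>\<^sup>+\<omega>. (\<Sum>k. indicator {\<omega>\<in>space M. real k < Y \<omega>} \<omega>) \<partial>M)"
    unfolding Y_def by (rule nn_integral_suminf[symmetric]) measurable
  also have "\<dots> \<le> (\<integral>\<^sup>+\<omega>. ennreal (Y \<omega> + 1) \<partial>M)"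
  proof (rule nn_integral_mono)
    fix \<omega> assume w: "\<omega> \<in> space M"
    define n where "n = nat \<lceil>Y \<omega>\<rceil>"
    have n: "real k < Y \<omega> \<longleftrightarrow> k < n" for k unfolding n_def using Ynn[of \<omega>] by (simp add: zless_nat_eq_int_zless less_ceiling_iff)
    have nn: "real n \<le> Y \<omega> + 1" unfolding n_def by (rule real_nat_ceiling_le[OF Ynn])
    have "(\<Sum>k. indicator {\<omega>\<in>space M. real k < Y \<omega>} \<omega>) = (\<Sum>k<n. indicator {\<omega>\<in>space M. real k < Y \<omega>} \<omega> :: ennreal)"
      by (rule suminf_finite) (auto simp: n)
    also have "\<dots> = ennreal (real n)" using w by (simp add: n ennreal_of_nat_eq_real_of_nat)
    also have "\<dots> \<le> ennreal (Y \<omega> + 1)" using nn by (rule ennreal_leI)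
    finally show "(\<Sum>k. indicator {\<omega>\<in>space M. real k < Y \<omega>} \<omega>) \<le> ennreal (Y \<omega> + 1)" .
  qed
  also have "\<dots> < \<infinity>"
  proof -
    have "integrable M (\<lambda>\<omega>. Y \<omega> + 1)" unfolding Y_def using lm by auto
    then show ?thesis using Ynn by (subst nn_integral_eq_integral) (auto intro: add_nonneg_nonneg)
  qed
  finally have fin: "(\<Sum>k. emeasure M (Bad k)) < \<infinity>" .
  have "summable (\<lambda>k. measure M (Bad k))"
    using fin by (intro summable_suminf_not_top) (auto simp: emeasure_eq_measure[symmetric] less_top)
  then have bc: "AE \<omega> in M. eventually (\<lambda>k. \<omega> \<in> space M - Bad k) sequentially"
    by (intro borel_cantelli_AE1) (auto simp: emeasure_eq_measure)
  define G where "G n = {\<omega>\<in>space M. \<forall>k. cmod (\<xi> k \<omega>) \<le> real (Suc n) * exp (\<delta> * real k)}" for n :: nat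
  have Gm[measurable]: "G n \<in> events" for n unfolding G_def by measurable
  have inc: "incseq G"
  proof (rule incseq_SucI, rule subsetI)
    fix n \<omega> assume "\<omega> \<in> G n"
    then have "\<omega> \<in> space M" "\<And>k. cmod (\<xi> k \<omega>) \<le> real (Suc n) * exp (\<delta> * real k)" by (auto simp: G_def)
    moreover have "real (Suc n) * exp (\<delta> * real k) \<le> real (Suc (Suc n)) * exp (\<delta> * real k)" for k
      by (intro mult_right_mono) auto
    ultimately show "\<omega> \<in> G (Suc n)" unfolding G_def by (blast intro: order_trans)
  qed
  have "AE \<omega> in M. \<omega> \<in> (\<Union>n. G n)"
    using bc AE_space
  proof eventually_elim
    case (elim \<omega>)
    then obtain k0 where k0: "\<And>k. k \<ge> k0 \<Longrightarrow> cmod (\<xi> k \<omega>) \<le> exp (\<delta> * real k)"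
      by (auto simp: eventually_sequentially Bad_def not_less)
    obtain n :: nat where n: "(\<Sum>k<k0. cmod (\<xi> k \<omega>)) \<le> real n" using real_arch_simple by blast
    have "cmod (\<xi> k \<omega>) \<le> real (Suc n) * exp (\<delta> * real k)" for k
    proof (cases "k < k0")
      case True
      have "cmod (\<xi> k \<omega>) \<le> (\<Sum>k<k0. cmod (\<xi> k \<omega>))" using True by (intro member_le_sum) auto
      also have "\<dots> \<le> real (Suc n) * 1" using n by simp
      also have "\<dots> \<le> real (Suc n) * exp (\<delta> * real k)" using \<delta> by (intro mult_left_mono) auto
      finally show ?thesis .
    next
      case False
      then have "cmod (\<xi> k \<omega>) \<le> 1 * exp (\<delta> * real k)" using k0 by simp
      also have "\<dots> \<le> real (Suc n) * exp (\<delta> * real k)" by (intro mult_right_mono) auto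
      finally show ?thesis .
    qed
    then show ?case using elim by (auto simp: G_def)
  qed
  then have "prob (\<Union>n. G n) = 1" by (intro prob_eq_1[THEN iffD2]) auto
  moreover have "(\<lambda>n. prob (G n)) \<longlonglongrightarrow> prob (\<Union>n. G n)"
    by (rule finite_Lim_measure_incseq[OF _ inc]) auto
  ultimately have "(\<lambda>n. prob (G n)) \<longlonglongrightarrow> 1" by simp
  then have "eventually (\<lambda>n. 1 - \<epsilon> < prob (G n)) sequentially"
    by (rule order_tendstoD) (use \<epsilon> in simp)
  then obtain n where n: "1 - \<epsilon> < prob (G n)" by (auto simp: eventually_sequentially)
  have "{\<omega>\<in>space M. \<not> (\<forall>k. cmod (\<xi> k \<omega>) \<le> real (Suc n) * exp (\<delta> * real k))} = space M - G n"
    by (auto simp: G_def)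
  then have "prob {\<omega>\<in>space M. \<not> (\<forall>k. cmod (\<xi> k \<omega>) \<le> real (Suc n) * exp (\<delta> * real k))} < \<epsilon>"
    using n by (simp add: prob_compl)
  then show ?thesis by (intro that[of "real (Suc n)"]) auto
qed

locale random_taylor = taylor_profile F f T0 R0 + prob_space M
  for F :: "nat \<Rightarrow> nat \<Rightarrow> complex" and f T0 R0 and M :: "'a measure" +
  fixes \<xi> :: "nat \<Rightarrow> 'a \<Rightarrow> complex"
  assumes indep: "indep_vars (\<lambda>_. borel) \<xi> UNIV"
    and ident: "\<And>k. distr M borel (\<xi> k) = distr M borel (\<xi> 0)"
    and nondegenerate: "\<not> (\<exists>c. AE \<omega> in M. \<xi> 0 \<omega> = c)"
    and log_moment: "integrable M (\<lambda>\<omega>. ln (1 + norm (\<xi> 0 \<omega>)))"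
begin

lemma rv [measurable]: "random_variable borel (\<xi> k)"
  using indep by (auto simp: indep_vars_def)

text \<open>On a window of linearly many indices the terms have coefficients at least
  \<open>exp (n * (u z - \<eta> / 2))\<close>, exponentially above the threshold. Eventually the
  window contains 2 N indices for the fixed N at which the survival probability is below
  \<epsilon>.\<close>

lemma small_value_event:
  assumes z: "z \<noteq> 0" "ereal (cmod z) < R0" and \<eta>: "\<eta> > 0" and \<epsilon>: "\<epsilon> > 0"
  shows "eventually (\<lambda>n. \<exists>A\<in>events. prob A < \<epsilon> \<and>
     (\<forall>\<omega>\<in>space M. summable (\<lambda>k. \<xi> k \<omega> * F k n * z ^ k) \<and>
        cmod (\<Sum>k. \<xi> k \<omega> * F k n * z ^ k) \<le> exp (real n * (u z - \<eta>)) \<longrightarrow> \<omega> \<in> A)) sequentially"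
proof -
  define s where "s = ln (cmod z)"
  have s: "s \<in> S" using z by (simp add: s_def)
  have us: "u z = I s" using z by (simp add: u_def s_def)
  obtain g p where g: "g > 0" "0 < p" "p \<le> 1" and
    anti: "\<forall>c J N l s. finite J \<and> 2 * N \<le> card J \<and> (\<forall>k\<in>J. l \<le> cmod (c k)) \<and> 2 * s < l * g \<and> l > 0 \<longrightarrow>
       (\<exists>A\<in>events. (\<exists>m\<ge>N. prob A \<le> walk_bound p m 1) \<and>
         (\<forall>\<omega>\<in>space M. summable (\<lambda>k. \<xi> k \<omega> * c k) \<and> cmod (\<Sum>k. \<xi> k \<omega> * c k) \<le> s \<longrightarrow> \<omega> \<in> A))"
    by (rule anticoncentration[where \<xi>=\<xi>, OF indep ident nondegenerate]; rule that; assumption)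
  have "eventually (\<lambda>N. walk_bound p N 1 < \<epsilon>) sequentially"
    using walk_bound_tendsto_0[OF g(2,3)] \<epsilon> by (rule order_tendstoD)
  then obtain N where N: "\<And>m. m \<ge> N \<Longrightarrow> walk_bound p m 1 < \<epsilon>" by (auto simp: eventually_sequentially)
  obtain a b where ab: "0 \<le> a" "a < b"
    and low: "eventually (\<lambda>n. \<forall>k. a * real n \<le> real k \<and> real k \<le> b * real n \<longrightarrow>
       exp (real n * (I s - \<eta> / 2)) \<le> cmod (F k n) * exp (s * real k)) sequentially"
    using coefficient_lower_bound[OF s, of "\<eta> / 2"] \<eta> by auto
  have e1: "eventually (\<lambda>n. real (2 * N) + 2 \<le> (b - a) * real n) sequentially"
    using ab by real_asymp
  have e2: "eventually (\<lambda>n. 2 * exp (- (real n * (\<eta> / 2))) < g) sequentially"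
  proof -
    have "(\<lambda>n. 2 * exp (- (real n * (\<eta> / 2)))) \<longlonglongrightarrow> 0" using \<eta> by real_asymp
    then show ?thesis using g(1) by (rule order_tendstoD)
  qed
  show ?thesis using low e1 e2
  proof eventually_elim
    case (elim n)
    define J where "J = {k::nat. a * real n \<le> real k \<and> real k \<le> b * real n}"
    have Jf: "finite J"
      by (rule finite_subset[of _ "{..nat \<lfloor>b * real n\<rfloor>}"]) (auto simp: J_def le_nat_floor)
    have Jc: "2 * N \<le> card J"
    proof -
      define k0 where "k0 = nat \<lceil>a * real n\<rceil>"
      have k0: "a * real n \<le> real k0" "real k0 \<le> a * real n + 1"
      proof -
        show "a * real n \<le> real k0" unfolding k0_def by (rule real_nat_ceiling_ge)
        have "0 \<le> a * real n" using ab by simp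
        then show "real k0 \<le> a * real n + 1" unfolding k0_def by (rule real_nat_ceiling_le)
      qed
      have "{k0..<k0 + 2 * N} \<subseteq> J"
      proof
        fix k assume k: "k \<in> {k0..<k0 + 2 * N}"
        then have "real k0 \<le> real k" "real k \<le> real k0 + real (2 * N)" by auto
        then show "k \<in> J" using k0 elim(2) unfolding J_def by (auto simp: left_diff_distrib)
      qed
      from card_mono[OF Jf this] show ?thesis by simp
    qed
    define c where "c k = F k n * z ^ k" for k
    have cl: "exp (real n * (I s - \<eta> / 2)) \<le> cmod (c k)" if "k \<in> J" for k
    proof -
      have "cmod z ^ k = exp (s * real k)" using z by (simp add: s_def exp_of_nat2_mult)
      then show ?thesis using elim(1) that by (auto simp: c_def J_def norm_mult norm_power)
    qed
    have sm: "2 * exp (real n * (I s - \<eta>)) < exp (real n * (I s - \<eta> / 2)) * g"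
    proof -
      have "2 * exp (real n * (I s - \<eta>)) = exp (real n * (I s - \<eta> / 2)) * (2 * exp (- (real n * (\<eta> / 2))))"
        by (simp add: exp_add[symmetric] algebra_simps)
      also have "\<dots> < exp (real n * (I s - \<eta> / 2)) * g" using elim(3) by (intro mult_strict_left_mono) auto
      finally show ?thesis .
    qed
    obtain A m where A: "A \<in> events" "m \<ge> N" "prob A \<le> walk_bound p m 1"
      "\<And>\<omega>. \<omega>\<in>space M \<Longrightarrow> summable (\<lambda>k. \<xi> k \<omega> * c k) \<Longrightarrow> cmod (\<Sum>k. \<xi> k \<omega> * c k) \<le> exp (real n * (I s - \<eta>)) \<Longrightarrow> \<omega> \<in> A"
      proof -
      have "finite J \<and> 2 * N \<le> card J \<and> (\<forall>k\<in>J. exp (real n * (I s - \<eta> / 2)) \<le> cmod (c k)) \<and>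
          2 * exp (real n * (I s - \<eta>)) < exp (real n * (I s - \<eta> / 2)) * g \<and> exp (real n * (I s - \<eta> / 2)) > 0"
        using Jf Jc cl sm by simp
      with anti have "\<exists>A\<in>events. (\<exists>m\<ge>N. prob A \<le> walk_bound p m 1) \<and>
         (\<forall>\<omega>\<in>space M. summable (\<lambda>k. \<xi> k \<omega> * c k) \<and> cmod (\<Sum>k. \<xi> k \<omega> * c k) \<le> exp (real n * (I s - \<eta>)) \<longrightarrow> \<omega> \<in> A)"
        by blast
      then obtain A where AX: "A \<in> events \<and> (\<exists>m\<ge>N. prob A \<le> walk_bound p m 1) \<and>
         (\<forall>\<omega>\<in>space M. summable (\<lambda>k. \<xi> k \<omega> * c k) \<and> cmod (\<Sum>k. \<xi> k \<omega> * c k) \<le> exp (real n * (I s - \<eta>)) \<longrightarrow> \<omega> \<in> A)"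
        unfolding Bex_def ..
      note Ae = conjunct1[OF AX] and X = conjunct2[OF AX]
      from conjunct1[OF X] obtain m where m: "m \<ge> N" "prob A \<le> walk_bound p m 1" by blast
      show ?thesis by (rule that[OF Ae m]) (use X in simp)
    qed
    show ?case
    proof (intro bexI[of _ A] conjI ballI impI)
      show "prob A < \<epsilon>" using A(3) N[OF A(2)] by simp
      fix \<omega> assume "\<omega> \<in> space M" "summable (\<lambda>k. \<xi> k \<omega> * F k n * z ^ k) \<and> cmod (\<Sum>k. \<xi> k \<omega> * F k n * z ^ k) \<le> exp (real n * (u z - \<eta>))"
      then show "\<omega> \<in> A" using A(4)[of \<omega>] by (simp add: c_def us mult.assoc)
    qed (rule A)
  qed
qed

text \<open>The factor \<open>exp (\<delta> * k)\<close> in the bound for \<open>\<xi> k\<close>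
  shifts s to s + \<delta>. Convexity limits the resulting growth of I by
  \<open>D s1 * \<delta>\<close>, uniformly down to s = minus infinity, so one event serves all z in
  the disk.\<close>

lemma random_series_upper_bound:
  assumes r: "0 < r" "ereal r < R0" and \<eta>: "\<eta> > 0" and \<epsilon>: "\<epsilon> > 0"
  shows "eventually (\<lambda>n. \<exists>A\<in>events. prob A < \<epsilon> \<and>
     (\<forall>\<omega>\<in>space M - A. fps_conv_radius (random_series \<xi> F n \<omega>) \<ge> ereal r \<and>
        (\<forall>z. cmod z \<le> r \<longrightarrow> summable (\<lambda>k. \<xi> k \<omega> * F k n * z ^ k) \<and>
           (z \<noteq> 0 \<longrightarrow> cmod (\<Sum>k. \<xi> k \<omega> * F k n * z ^ k) \<le> exp (real n * (u z + \<eta>)))))) sequentially"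
proof -
  have lr: "ln r \<in> S" using r by simp
  obtain s1 where s1: "s1 > ln r" "s1 \<in> S" using S_up[OF lr] by blast
  \<comment> \<open>The shifted argument must stay below s1, and the shift may use a third of
    \<eta>; the other thirds go to the constant C and to the sum of the coefficients. The added 1
    protects against \<open>D s1 = 0\<close>.\<close>
  define \<delta> where "\<delta> = min (s1 - ln r) (\<eta> / (3 * (D s1 + 1)))"
  have D1: "D s1 \<ge> 0" using D_nonneg s1 by simp
  have \<delta>: "\<delta> > 0" "\<delta> \<le> s1 - ln r" "D s1 * \<delta> \<le> \<eta> / 3"
  proof -
    show "\<delta> > 0" using s1 \<eta> D1 by (simp add: \<delta>_def)
    have "D s1 * \<delta> \<le> (D s1 + 1) * (\<eta> / (3 * (D s1 + 1)))" using D1 \<eta> s1 by (intro mult_mono) (auto simp: \<delta>_def)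
    also have "\<dots> = \<eta> / 3" using D1 by (simp add: field_simps)
    finally show "D s1 * \<delta> \<le> \<eta> / 3" .
  qed (simp add: \<delta>_def)
  obtain C where C: "C > 0" "prob {\<omega>\<in>space M. \<not> (\<forall>k. cmod (\<xi> k \<omega>) \<le> C * exp (\<delta> * real k))} < \<epsilon>"
    by (rule exponential_growth_bound[where \<xi>=\<xi>, OF rv ident log_moment \<delta>(1) \<epsilon>]; rule that; assumption)
  let ?A = "{\<omega>\<in>space M. \<not> (\<forall>k. cmod (\<xi> k \<omega>) \<le> C * exp (\<delta> * real k))}"
  have Am: "?A \<in> events" by measurable
  have e1: "eventually (\<lambda>n. C \<le> exp (real n * (\<eta> / 3))) sequentially" using \<eta> by real_asymp
  have e2: "eventually (\<lambda>n. \<forall>s\<le>s1. summable (\<lambda>k. cmod (F k n) * exp (s * real k)) \<and>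
     (\<Sum>k. cmod (F k n) * exp (s * real k)) \<le> exp (real n * (I s + \<eta> / 3))) sequentially"
    using coefficient_sum_bound[OF s1(2), of "\<eta> / 3"] \<eta> by simp
  show ?thesis using e1 e2
  proof eventually_elim
    case (elim n)
    show ?case
    proof (intro bexI[of _ ?A] conjI ballI)
      fix \<omega> assume w: "\<omega> \<in> space M - ?A"
      have xi: "cmod (\<xi> k \<omega>) \<le> C * exp (\<delta> * real k)" for k using w by simp
      have tb: "cmod (\<xi> k \<omega> * F k n * z ^ k) \<le> C * (cmod (F k n) * exp ((s + \<delta>) * real k))"
        if z: "cmod z \<le> exp s" for z s k
      proof -
        have "cmod (\<xi> k \<omega> * F k n * z ^ k) \<le> (C * exp (\<delta> * real k)) * cmod (F k n) * (exp s) ^ k"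
          unfolding norm_mult norm_power using xi z C by (intro mult_mono power_mono) auto
        also have "\<dots> = C * (cmod (F k n) * exp ((s + \<delta>) * real k))"
          by (simp add: exp_of_nat2_mult[symmetric] exp_add[symmetric] algebra_simps)
        finally show ?thesis .
      qed
      have sum: "summable (\<lambda>k. C * (cmod (F k n) * exp ((s + \<delta>) * real k)))" if "s \<le> ln r" for s
        using elim(2) that \<delta> by (intro summable_mult) auto
      have smz: "summable (\<lambda>k. norm (\<xi> k \<omega> * F k n * z ^ k))" if "cmod z \<le> r" for z
        by (rule summable_comparison_test[OF _ sum[of "ln r"]]) (use tb[of z "ln r"] that r in auto)
      show "fps_conv_radius (random_series \<xi> F n \<omega>) \<ge> ereal r"
        unfolding fps_conv_radius_def
        using conv_radius_geI[of "\<lambda>k. fps_nth (random_series \<xi> F n \<omega>) k" "of_real r"] summable_norm_cancel[OF smz[of "of_real r"]] r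
        by (simp add: random_series_def)
      show "\<forall>z. cmod z \<le> r \<longrightarrow> summable (\<lambda>k. \<xi> k \<omega> * F k n * z ^ k) \<and>
           (z \<noteq> 0 \<longrightarrow> cmod (\<Sum>k. \<xi> k \<omega> * F k n * z ^ k) \<le> exp (real n * (u z + \<eta>)))"
      proof (intro allI impI conjI)
        fix z assume z: "cmod z \<le> r"
        show "summable (\<lambda>k. \<xi> k \<omega> * F k n * z ^ k)" using smz[OF z] by (rule summable_norm_cancel)
        assume z0: "z \<noteq> 0"
        define s where "s = ln (cmod z)"
        have s: "s \<le> ln r" "cmod z = exp s" using z z0 r by (auto simp: s_def)
        have sS: "s + \<delta> \<in> S" "s + \<delta> \<le> s1" using s \<delta> S_down[OF s1(2), of "s + \<delta>"] by auto
        have "cmod (\<Sum>k. \<xi> k \<omega> * F k n * z ^ k) \<le> (\<Sum>k. norm (\<xi> k \<omega> * F k n * z ^ k))"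
          by (rule summable_norm[OF smz[OF z]])
        also have "\<dots> \<le> (\<Sum>k. C * (cmod (F k n) * exp ((s + \<delta>) * real k)))"
          by (rule suminf_le[OF _ smz[OF z] sum[OF s(1)]]) (use tb s in auto)
        also have "\<dots> = C * (\<Sum>k. cmod (F k n) * exp ((s + \<delta>) * real k))"
          using elim(2) sS by (intro suminf_mult) auto
        also have "\<dots> \<le> exp (real n * (\<eta> / 3)) * exp (real n * (I (s + \<delta>) + \<eta> / 3))"
          using elim sS C by (intro mult_mono) (auto intro!: suminf_nonneg)
        also have "\<dots> = exp (real n * (I (s + \<delta>) + 2 * \<eta> / 3))"
          by (simp add: exp_add[symmetric] algebra_simps)
        also have "\<dots> \<le> exp (real n * (u z + \<eta>))"
        proof -
          have "I (s + \<delta>) - I s \<le> D (s + \<delta>) * \<delta>" using D_increments(2)[of s "s + \<delta>"] \<delta> sS by simp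
          also have "\<dots> \<le> D s1 * \<delta>" using D_mono[OF s1(2) sS(2)] \<delta> by (intro mult_right_mono) auto
          also have "\<dots> \<le> \<eta> / 3" by (rule \<delta>)
          finally have "I (s + \<delta>) + 2 * \<eta> / 3 \<le> u z + \<eta>" using z0 by (simp add: u_def s_def)
          then show ?thesis by (simp add: mult_left_mono)
        qed
        finally show "cmod (\<Sum>k. \<xi> k \<omega> * F k n * z ^ k) \<le> exp (real n * (u z + \<eta>))" .
      qed
    qed (use C Am in auto)
  qed
qed

end

section \<open>From potentials to zeros\<close>

text \<open>The bound on the number of points times the squared radius is independent of the mesh,
  so that errors summed over the disks do not grow under refinement. With mesh h and disks of radius
  2 h, (2 N + 1)^2 \<le> (3 N)^2 points give the constant 36.\<close>

lemma grid_cover: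
  fixes r h0 :: real
  assumes r: "r \<ge> 0" and h0: "h0 > 0"
  obtains h and P :: "complex set" where "0 < h" "h < h0" "finite P" "\<And>p. p \<in> P \<Longrightarrow> p \<noteq> 0 \<and> cmod p < r + h"
    "cball 0 r \<subseteq> (\<Union>p\<in>P. ball p h)" "real (card P) * h\<^sup>2 \<le> 36 * (r + 1)\<^sup>2"
proof -
  obtain N :: nat where N: "2 * (r + 1) / h0 < real N" using reals_Archimedean2 by blast
  have N0: "real N > 0" using N r h0 by (smt (verit) divide_pos_pos)
  define h where "h = (r + 1) / real N"
  have h: "h > 0" "2 * h < h0" "h * real N = r + 1"
    using N N0 r h0 by (auto simp: h_def field_simps)
  \<comment> \<open>The offset by half a cell keeps every grid point away from the origin.\<close>
  define pt where "pt = (\<lambda>(i::int, j::int). Complex (h * (real_of_int i + 1/2)) (h * (real_of_int j + 1/2)))"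
  define A where "A = {-int N..int N} \<times> {-int N..int N}"
  define P where "P = {p \<in> pt ` A. cmod p < r + 2 * h}"
  have fin: "finite P" by (auto simp: P_def A_def)
  have c1: "card {-int N..int N} = 2 * N + 1" by (simp add: nat_eq_iff)
  have cA: "card A = (2 * N + 1) * (2 * N + 1)" unfolding A_def card_cartesian_product c1 ..
  have "card P \<le> card (pt ` A)" by (rule card_mono) (auto simp: P_def A_def)
  also have "\<dots> \<le> card A" by (rule card_image_le) (simp add: A_def)
  finally have "card P \<le> (2 * N + 1) * (2 * N + 1)" by (simp only: cA)
  then have "real (card P) \<le> real ((2 * N + 1) * (2 * N + 1))" by (simp only: of_nat_le_iff)
  also have "\<dots> \<le> (3 * real N) * (3 * real N)" unfolding of_nat_mult using N0 by (intro mult_mono) auto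
  finally have "real (card P) * (2 * h)\<^sup>2 \<le> (3 * real N) * (3 * real N) * (2 * h)\<^sup>2" by (rule mult_right_mono) simp
  also have "\<dots> = 36 * (h * real N)\<^sup>2" by (simp add: power2_eq_square)
  finally have card: "real (card P) * (2 * h)\<^sup>2 \<le> 36 * (r + 1)\<^sup>2" by (simp only: h)
  show ?thesis
  proof (rule that[of "2 * h" P])
    show "cball 0 r \<subseteq> (\<Union>p\<in>P. ball p (2 * h))"
    proof
      fix z :: complex assume "z \<in> cball 0 r"
      then have z: "cmod z \<le> r" by simp
      define i where "i = \<lfloor>Re z / h\<rfloor>"
      define j where "j = \<lfloor>Im z / h\<rfloor>"
      have ij: "\<bar>x - h * (real_of_int \<lfloor>x / h\<rfloor> + 1/2)\<bar> \<le> h / 2 \<and> \<lfloor>x / h\<rfloor> \<in> {-int N..int N}" if "\<bar>x\<bar> \<le> r" for x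
      proof -
        have f: "real_of_int \<lfloor>x / h\<rfloor> \<le> x / h" "x / h < real_of_int \<lfloor>x / h\<rfloor> + 1" by linarith+
        then have f': "h * real_of_int \<lfloor>x / h\<rfloor> \<le> x" "x < h * real_of_int \<lfloor>x / h\<rfloor> + h"
          using mult_left_mono[OF f(1), of h] mult_strict_left_mono[OF f(2), of h] h(1) by (auto simp: distrib_left)
        have "\<bar>x / h\<bar> \<le> real N"
          using that h N0 by (simp add: field_simps)
        then have "-real N \<le> x / h" "x / h \<le> real N" by linarith+
        then have "\<lfloor>x / h\<rfloor> \<le> int N" "- int N \<le> \<lfloor>x / h\<rfloor>" by linarith+
        moreover have "\<bar>x - h * (real_of_int \<lfloor>x / h\<rfloor> + 1/2)\<bar> \<le> h / 2"
        proof -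
          have "h * (real_of_int \<lfloor>x / h\<rfloor> + 1/2) = h * real_of_int \<lfloor>x / h\<rfloor> + h / 2" by (simp add: distrib_left)
          then show ?thesis unfolding abs_le_iff using f' by linarith
        qed
        ultimately show ?thesis by simp
      qed
      have a: "\<bar>Re z\<bar> \<le> r" "\<bar>Im z\<bar> \<le> r" using z abs_Re_le_cmod[of z] abs_Im_le_cmod[of z] by linarith+
      have "cmod (z - pt (i, j)) \<le> \<bar>Re (z - pt (i, j))\<bar> + \<bar>Im (z - pt (i, j))\<bar>" by (rule cmod_le)
      also have "\<dots> \<le> h / 2 + h / 2"
        using ij[OF a(1)] ij[OF a(2)] by (intro add_mono) (auto simp: pt_def i_def j_def)
      finally have d: "cmod (z - pt (i, j)) < 2 * h" using h by simp
      have "cmod (pt (i, j)) \<le> cmod z + cmod (z - pt (i, j))"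
        using norm_triangle_ineq4[of z "z - pt (i, j)"] by simp
      then have "cmod (pt (i, j)) < r + 2 * h" using z d by simp
      moreover have "pt (i, j) \<in> pt ` A" using ij[OF a(1)] ij[OF a(2)] by (auto simp: A_def i_def j_def)
      ultimately have "pt (i, j) \<in> P" by (simp add: P_def)
      then show "z \<in> (\<Union>p\<in>P. ball p (2 * h))" using d by (auto simp: dist_norm norm_minus_commute)
    qed
    show "p \<noteq> 0 \<and> cmod p < r + 2 * h" if p: "p \<in> P" for p
    proof -
      obtain i j where ij: "p = pt (i, j)" using p by (auto simp: P_def)
      have "2 * i + 1 \<noteq> 0" by presburger
      then have "real_of_int (2 * i + 1) \<noteq> 0" by (simp only: of_int_eq_0_iff not_False_eq_True)
      then have "real_of_int i + 1 / 2 \<noteq> 0" by (simp add: field_simps)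
      then have "Re p \<noteq> 0" using h(1) by (simp add: ij pt_def)
      then show ?thesis using p by (auto simp: P_def)
    qed
  qed (use h fin card in auto)
qed

context convex_profile
begin

text \<open>The pointwise upper bound makes |v - u| at most a constant minus v on each disk; the
  sub-mean value property bounds the integral of -v by its value at the centre, where v is not
  small. Summing over the disks costs only the factor C.\<close>

lemma potential_L1_bound:
  fixes wt :: "complex \<Rightarrow> real" and L :: "complex \<Rightarrow> complex"
  assumes Z: "finite Z" and L: "L holomorphic_on ball 0 R1" and R1: "ereal R1 < R0" and wtnn: "\<And>a. a \<in> Z \<Longrightarrow> wt a \<ge> 0"
    and P: "finite P" "\<And>p. p \<in> P \<Longrightarrow> p \<notin> Z \<and> cball p h \<subseteq> ball 0 R1" and h: "h > 0" and cov: "cball 0 r \<subseteq> (\<Union>p\<in>P. ball p h)"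
    and card: "real (card P) * h\<^sup>2 \<le> C" and \<eta>: "\<eta> \<ge> 0"
    and osc: "\<And>p z. p \<in> P \<Longrightarrow> z \<in> ball p h \<Longrightarrow> \<bar>u z - u p\<bar> \<le> \<eta>"
  defines "v \<equiv> \<lambda>z. (\<Sum>a\<in>Z. wt a * ln (cmod (z - a))) + Re (L z)"
  assumes up: "\<And>z. z \<in> ball 0 R1 \<Longrightarrow> z \<noteq> 0 \<Longrightarrow> z \<notin> Z \<Longrightarrow> v z \<le> u z + \<eta>"
    and low: "\<And>p. p \<in> P \<Longrightarrow> u p - \<eta> \<le> v p"
  shows "integrable lborel (\<lambda>z. indicator (cball 0 r) z * \<bar>v z - u z\<bar>)"
    and "(\<integral>z. indicator (cball 0 r) z * \<bar>v z - u z\<bar> \<partial>lborel) \<le> 5 * \<eta> * pi * C"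
proof -
  have uc: "continuous_on (ball 0 R1) u"
    by (rule continuous_on_subset[OF continuous_on_u]) (use ball_subset_eball_0[OF R1] in auto)
  have nz: "AE z in lborel. z \<noteq> 0 \<and> z \<notin> Z"
  proof -
    have "finite (insert 0 Z)" using Z by simp
    then have "AE z in lborel. z \<notin> insert 0 Z"
      by (intro AE_not_in) (simp add: finite_imp_null_set_lborel)
    then show ?thesis by eventually_elim auto
  qed
  have bi: "integrable lborel (\<lambda>z. indicator (ball p h) z * v z)"
    and bl: "measure lborel (ball (0::complex) h) * v p \<le> (\<integral>z. indicator (ball p h) z * v z \<partial>lborel)"
    and bu: "integrable lborel (\<lambda>z. indicator (ball p h) z * u z)" if p: "p \<in> P" for p
  proof -
    have e: "indicator (ball p h) z * v z = (\<Sum>a\<in>Z. wt a * (indicator (ball p h) z * ln (cmod (z - a)))) + indicator (ball p h) z * Re (L z)" for z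
      by (simp add: v_def algebra_simps sum_distrib_left)
    have pa: "a \<noteq> p" if "a \<in> Z" for a using P(2)[OF p] that by auto
    note H = ball_mean_harmonic[OF L open_ball, of p h]
    have i1: "integrable lborel (\<lambda>z. wt a * (indicator (ball p h) z * ln (cmod (z - a))))" if "a \<in> Z" for a
      using ball_mean_ln(1)[OF pa[OF that]] by simp
    have i2: "integrable lborel (\<lambda>z. indicator (ball p h) z * Re (L z))" using H(1) P(2)[OF p] by simp
    show "integrable lborel (\<lambda>z. indicator (ball p h) z * v z)"
      unfolding e using i1 i2 by (intro Bochner_Integration.integrable_add Bochner_Integration.integrable_sum) auto
    have "measure lborel (ball (0::complex) h) * v p = (\<Sum>a\<in>Z. wt a * (measure lborel (ball (0::complex) h) * ln (cmod (p - a)))) + measure lborel (ball (0::complex) h) * Re (L p)"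
      by (simp add: v_def algebra_simps sum_distrib_left)
    also have "\<dots> \<le> (\<Sum>a\<in>Z. wt a * (\<integral>z. indicator (ball p h) z * ln (cmod (z - a)) \<partial>lborel)) + (\<integral>z. indicator (ball p h) z * Re (L z) \<partial>lborel)"
      using H(2) P(2)[OF p] ball_mean_ln(2)[OF pa] wtnn by (intro add_mono sum_mono mult_left_mono) auto
    also have "\<dots> = (\<integral>z. indicator (ball p h) z * v z \<partial>lborel)"
      unfolding e using i1 i2 by (subst Bochner_Integration.integral_add) (auto intro!: Bochner_Integration.integrable_sum simp: Bochner_Integration.integral_sum)
    finally show "measure lborel (ball (0::complex) h) * v p \<le> (\<integral>z. indicator (ball p h) z * v z \<partial>lborel)" .
    have sub: "cball p h \<subseteq> ball 0 R1" using P(2)[OF p] by simp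
    have "set_integrable lborel (cball p h) u"
      unfolding set_integrable_def
      by (rule borel_integrable_compact[OF compact_cball continuous_on_subset[OF uc sub]])
    then have "set_integrable lborel (ball p h) u"
      by (rule set_integrable_subset) auto
    then show "integrable lborel (\<lambda>z. indicator (ball p h) z * u z)" by (simp add: set_integrable_def)
  qed
  have ball_area: "measure lborel (ball (p::complex) h) = pi * h\<^sup>2" for p
    using h by (simp add: content_ball unit_ball_vol_2)
  have bd: "integrable lborel (\<lambda>z. indicator (ball p h) z * \<bar>v z - u z\<bar>)"
    and bdl: "(\<integral>z. indicator (ball p h) z * \<bar>v z - u z\<bar> \<partial>lborel) \<le> 5 * \<eta> * (pi * h\<^sup>2)" if p: "p \<in> P" for p
  proof -
    have e: "indicator (ball p h) z * \<bar>v z - u z\<bar> = \<bar>indicator (ball p h) z * v z - indicator (ball p h) z * u z\<bar>" for z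
      by (auto split: split_indicator)
    show i: "integrable lborel (\<lambda>z. indicator (ball p h) z * \<bar>v z - u z\<bar>)"
      unfolding e using bi[OF p] bu[OF p] by simp
    \<comment> \<open>Upper bound and oscillation give \<open>v z \<le> u p + 2 * \<eta>\<close>, so
      \<open>?k - v z\<close> dominates the deviation whichever sign it has. The lower bound at the
      centre adds one more \<eta>, hence the factor 5.\<close>
    let ?k = "u p + 4 * \<eta>"
    have "(\<integral>z. indicator (ball p h) z * \<bar>v z - u z\<bar> \<partial>lborel) \<le> (\<integral>z. ?k * indicator (ball p h) z - indicator (ball p h) z * v z \<partial>lborel)"
    proof (rule integral_mono_AE[OF i])
      show "integrable lborel (\<lambda>z. ?k * indicator (ball p h) z - indicator (ball p h) z * v z)"
        by (intro Bochner_Integration.integrable_diff bi[OF p] integrable_mult_right integrable_indicator_balls)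
      show "AE z in lborel. indicator (ball p h) z * \<bar>v z - u z\<bar> \<le> ?k * indicator (ball p h) z - indicator (ball p h) z * v z"
        using nz
      proof eventually_elim
        case (elim z)
        show ?case
        proof (cases "z \<in> ball p h")
          case True
          then have "z \<in> ball 0 R1" using P(2)[OF p] ball_subset_cball by blast
          then have "v z \<le> u z + \<eta>" using up elim by simp
          moreover have "\<bar>u z - u p\<bar> \<le> \<eta>" using osc[OF p True] .
          ultimately have "\<bar>v z - u z\<bar> \<le> ?k - v z" using \<eta> by linarith
          then show ?thesis using True by simp
        qed simp
      qed
    qed
    also have "\<dots> = ?k * measure lborel (ball p h) - (\<integral>z. indicator (ball p h) z * v z \<partial>lborel)"
      using bi[OF p] integrable_indicator_balls(2)[of p h] by (subst Bochner_Integration.integral_diff) auto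
    also have "\<dots> \<le> ?k * (pi * h\<^sup>2) - (pi * h\<^sup>2) * v p" using bl[OF p] by (simp only: ball_area)
    also have "\<dots> = (pi * h\<^sup>2) * (u p + 4 * \<eta> - v p)" by (simp add: algebra_simps)
    also have "\<dots> \<le> (pi * h\<^sup>2) * (5 * \<eta>)" using low[OF p] by (intro mult_left_mono) auto
    finally show "(\<integral>z. indicator (ball p h) z * \<bar>v z - u z\<bar> \<partial>lborel) \<le> 5 * \<eta> * (pi * h\<^sup>2)" by (simp add: mult_ac)
  qed
  have pw: "indicator (cball 0 r) z * \<bar>v z - u z\<bar> \<le> (\<Sum>p\<in>P. indicator (ball p h) z * \<bar>v z - u z\<bar>)" for z
  proof (cases "z \<in> cball 0 r")
    case True
    then obtain p where p: "p \<in> P" "z \<in> ball p h" using cov by blast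
    have "indicator (ball p h) z * \<bar>v z - u z\<bar> \<le> (\<Sum>p\<in>P. indicator (ball p h) z * \<bar>v z - u z\<bar>)"
      by (rule member_le_sum[OF p(1)]) (use P in auto)
    then show ?thesis using True p by simp
  qed (auto intro: sum_nonneg)
  have si: "integrable lborel (\<lambda>z. \<Sum>p\<in>P. indicator (ball p h) z * \<bar>v z - u z\<bar>)"
    using bd by (intro Bochner_Integration.integrable_sum) auto
  have meas: "(\<lambda>z. indicator (cball 0 r) z * \<bar>v z - u z\<bar>) \<in> borel_measurable lborel"
  proof -
    define UP where "UP = (\<Union>p\<in>P. ball p h)"
    have sub: "UP \<subseteq> ball 0 R1" unfolding UP_def using P(2) ball_subset_cball by blast
    have op: "open UP" by (auto simp: UP_def)
    define u' where "u' z = (if z \<in> UP then u z else 0)" for z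
    define l' where "l' z = (if z \<in> UP then Re (L z) else 0)" for z
    have [measurable]: "u' \<in> borel_measurable borel"
      unfolding u'_def by (rule borel_measurable_continuous_on_if) (use op sub in \<open>auto intro!: continuous_on_subset[OF uc] continuous_intros\<close>)
    have [measurable]: "l' \<in> borel_measurable borel"
      unfolding l'_def by (rule borel_measurable_continuous_on_if) (use op sub in \<open>auto intro!: continuous_on_subset[OF holomorphic_on_imp_continuous_on[OF L]] continuous_intros\<close>)
    have eq: "indicator (cball 0 r) z * \<bar>v z - u z\<bar> = indicator (cball 0 r) z * \<bar>(\<Sum>a\<in>Z. wt a * ln (cmod (z - a))) + l' z - u' z\<bar>" for z
      using cov by (auto simp: v_def u'_def l'_def UP_def indicator_def)
    have [measurable]: "cball (0::complex) r \<in> sets borel" by simp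
    show ?thesis unfolding eq by measurable
  qed
  show int: "integrable lborel (\<lambda>z. indicator (cball 0 r) z * \<bar>v z - u z\<bar>)"
  proof (rule Bochner_Integration.integrable_bound[OF si meas])
    show "AE z in lborel. norm (indicator (cball 0 r) z * \<bar>v z - u z\<bar>) \<le> norm (\<Sum>p\<in>P. indicator (ball p h) z * \<bar>v z - u z\<bar>)"
    proof (rule AE_I2)
      fix z
      have "0 \<le> indicator (cball 0 r) z * \<bar>v z - u z\<bar>" by simp
      then show "norm (indicator (cball 0 r) z * \<bar>v z - u z\<bar>) \<le> norm (\<Sum>p\<in>P. indicator (ball p h) z * \<bar>v z - u z\<bar>)"
        using pw[of z] unfolding real_norm_def by linarith
    qed
  qed
  have "(\<integral>z. indicator (cball 0 r) z * \<bar>v z - u z\<bar> \<partial>lborel) \<le> (\<integral>z. (\<Sum>p\<in>P. indicator (ball p h) z * \<bar>v z - u z\<bar>) \<partial>lborel)"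
    by (rule integral_mono[OF int si pw])
  also have "\<dots> = (\<Sum>p\<in>P. \<integral>z. indicator (ball p h) z * \<bar>v z - u z\<bar> \<partial>lborel)"
    using bd by (intro Bochner_Integration.integral_sum) auto
  also have "\<dots> \<le> real (card P) * (5 * \<eta> * (pi * h\<^sup>2))"
    using sum_bounded_above[of P "\<lambda>p. \<integral>z. indicator (ball p h) z * \<bar>v z - u z\<bar> \<partial>lborel" "5 * \<eta> * (pi * h\<^sup>2)"] bdl by simp
  also have "\<dots> = 5 * \<eta> * pi * (real (card P) * h\<^sup>2)" by simp
  also have "\<dots> \<le> 5 * \<eta> * pi * C" using card \<eta> by (intro mult_left_mono) auto
  finally show "(\<integral>z. indicator (cball 0 r) z * \<bar>v z - u z\<bar> \<partial>lborel) \<le> 5 * \<eta> * pi * C" .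
qed

text \<open>All that the probabilistic estimates supply about one realization; what follows about
  zeros is deterministic. The strict inequality excludes zeros at the points of P.\<close>

definition good_function :: "real \<Rightarrow> complex set \<Rightarrow> real \<Rightarrow> nat \<Rightarrow> (complex \<Rightarrow> complex) \<Rightarrow> bool" where
  "good_function R2 P \<eta> n G \<longleftrightarrow> n > 0 \<and> G holomorphic_on ball 0 R2 \<and>
     (\<forall>z\<in>ball 0 R2. z \<noteq> 0 \<longrightarrow> cmod (G z) \<le> exp (real n * (u z + \<eta>))) \<and>
     (\<forall>p\<in>P. exp (real n * (u p - \<eta>)) < cmod (G p))"

definition zero_sum :: "real \<Rightarrow> nat \<Rightarrow> (complex \<Rightarrow> complex) \<Rightarrow> (complex \<Rightarrow> real) \<Rightarrow> real" where
  "zero_sum R1 n G \<phi> = (\<Sum>a\<in>{a\<in>ball 0 R1. G a = 0}. real (nat (zorder G a)) * \<phi> a) / real n"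

lemma good_function_antimono:
  assumes "good_function R2 P' \<eta>' n G" "P \<subseteq> P'" "\<eta>' \<le> \<eta>"
  shows "good_function R2 P \<eta> n G"
proof -
  have "exp (real n * (u z + \<eta>')) \<le> exp (real n * (u z + \<eta>))" "exp (real n * (u z - \<eta>)) \<le> exp (real n * (u z - \<eta>'))" for z
    using assms(3) by (auto intro!: mult_left_mono)
  then show ?thesis using assms(1,2) unfolding good_function_def by (meson order_trans le_less_trans subsetD)
qed

text \<open>Both terms are integrals against \<open>lap \<rho>\<close>, of the normalized
  logarithmic modulus of G and of u, so their difference is at most \<open>2 * B\<close> times the
  L1 distance. P depends only on the radii and \<eta>, not on the test function or \<rho>. The
  constant 360 is 2 * 5 * 36.\<close>

lemma potential_convergence:
  fixes N :: "complex measure"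
  assumes r: "0 \<le> r1" "r1 < R1" "R1 < R2" "ereal R2 < R0"
    and N: "finite_measure N" "rotation_invariant_borel N" "AE a in N. a \<in> ball 0 R1"
      "\<And>r. 0 < r \<Longrightarrow> r \<le> R1 \<Longrightarrow> measure N (ball 0 r) = D (ln r)"
    and \<eta>: "\<eta> > 0"
  obtains P where "finite P" "P \<noteq> {}" "\<And>p. p \<in> P \<Longrightarrow> p \<noteq> 0 \<and> cmod p < R1"
    "\<And>n G \<psi> r B \<rho>. good_function R2 P \<eta> n G \<Longrightarrow> test_function \<psi> r B \<Longrightarrow> \<rho> > 0 \<Longrightarrow> r + \<rho> \<le> r1 \<Longrightarrow>
       \<bar>zero_sum R1 n G (test_function.pot \<psi> \<rho>) - (\<integral>a. test_function.pot \<psi> \<rho> a \<partial>N)\<bar> \<le> B * (360 * pi * (r1 + 1)\<^sup>2) * \<eta>"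
proof -
  have R1: "ereal R1 < R0" "R1 > 0" using r ereal_le_less[of R1 R2 R0] by auto
  have uc: "continuous_on (cball 0 R1) u"
    by (rule continuous_on_subset[OF continuous_on_u]) (use ball_subset_eball_0[OF R1(1)] in auto)
  obtain d where d: "d > 0" "\<And>x y. x \<in> cball 0 R1 \<Longrightarrow> y \<in> cball 0 R1 \<Longrightarrow> dist x y < d \<Longrightarrow> dist (u x) (u y) < \<eta>"
    using compact_uniformly_continuous[OF uc compact_cball] \<eta> unfolding uniformly_continuous_on_def by (metis dist_commute)
  \<comment> \<open>Below d, u varies by less than \<eta> on each disk; below (R1 - r1) / 2, the
    disks about points of modulus less than r1 + h remain inside the disk of radius R1.\<close>
  obtain h and P :: "complex set" where h: "0 < h" "h < min d ((R1 - r1) / 2)" and P: "finite P" "\<And>p. p \<in> P \<Longrightarrow> p \<noteq> 0 \<and> cmod p < r1 + h"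
    and cov: "cball 0 r1 \<subseteq> (\<Union>p\<in>P. ball p h)" and card: "real (card P) * h\<^sup>2 \<le> 36 * (r1 + 1)\<^sup>2"
    using grid_cover[of r1 "min d ((R1 - r1) / 2)"] r d by (metis diff_gt_0_iff_gt half_gt_zero min_less_iff_conj)
  have Pb: "cball p h \<subseteq> ball 0 R1" if "p \<in> P" for p
  proof
    fix x assume "x \<in> cball p h"
    then have "cmod x \<le> cmod p + h" using norm_triangle_ineq2[of x p] by (simp add: dist_norm norm_minus_commute)
    then show "x \<in> ball 0 R1" using P(2)[OF that] h by simp
  qed
  obtain c where c: "\<And>z. z \<noteq> 0 \<Longrightarrow> cmod z \<le> R1 \<Longrightarrow> u z = c + (\<integral>a. ln (max (cmod z) (cmod a)) \<partial>N)"
    using log_potential[OF N(1) _ R1(2,1) N(4,3)] N(2) by (auto simp: rotation_invariant_borel_def)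
  show ?thesis
  proof (rule that[of P])
    show "P \<noteq> {}" using cov r by auto
    show "p \<noteq> 0 \<and> cmod p < R1" if "p \<in> P" for p using P(2)[OF that] h by auto
    fix n G \<psi> and r B \<rho> :: real
    assume G: "good_function R2 P \<eta> n G" and "test_function \<psi> r B" and \<rho>: "\<rho> > 0" "r + \<rho> \<le> r1"
    interpret test_function \<psi> r B by fact
    have n: "real n > 0" and Gh: "G holomorphic_on ball 0 R2" using G by (auto simp: good_function_def)
    obtain p0 where p0: "p0 \<in> P" using \<open>P \<noteq> {}\<close> by blast
    have Gp: "G p \<noteq> 0" if "p \<in> P" for p using G that exp_gt_zero unfolding good_function_def
      by (metis less_asym norm_zero)
    have ex: "\<exists>z\<in>ball 0 R2. G z \<noteq> 0" using Gp[OF p0] Pb[OF p0] h r by (intro bexI[of _ p0]) (auto dest!: subsetD[of _ _ p0])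
    define Z where "Z = {a\<in>ball 0 R1. G a = 0}"
    obtain L where L: "finite Z" "L holomorphic_on ball 0 R1"
      "\<And>z. z \<in> ball 0 R1 \<Longrightarrow> G z \<noteq> 0 \<Longrightarrow> ln (cmod (G z)) = (\<Sum>a\<in>Z. real (nat (zorder G a)) * ln (cmod (z - a))) + Re (L z)"
      using holomorphic_ln_norm_decomposition[OF Gh R1(2) r(3) ex] unfolding Z_def by blast
    define wt where "wt a = real (nat (zorder G a)) / real n" for a
    define L' where "L' z = L z / of_nat n" for z
    define v where "v z = (\<Sum>a\<in>Z. wt a * ln (cmod (z - a))) + Re (L' z)" for z
    have vG: "v z = ln (cmod (G z)) / real n" if "z \<in> ball 0 R1" "G z \<noteq> 0" for z
      using L(3)[OF that] n by (simp add: v_def wt_def L'_def sum_divide_distrib add_divide_distrib Re_divide_of_nat)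
    have L'h: "L' holomorphic_on ball 0 R1" unfolding L'_def using L(2) n by (intro holomorphic_intros) auto
    have up: "v z \<le> u z + \<eta>" if z: "z \<in> ball 0 R1" "z \<noteq> 0" "z \<notin> Z" for z
    proof -
      have g: "G z \<noteq> 0" using z by (auto simp: Z_def)
      have "cmod (G z) \<le> exp (real n * (u z + \<eta>))" using G z r by (auto simp: good_function_def)
      then have "ln (cmod (G z)) \<le> ln (exp (real n * (u z + \<eta>)))" using g by (intro ln_mono) auto
      then show ?thesis using n by (simp add: vG[OF z(1) g] field_simps)
    qed
    have low: "u p - \<eta> \<le> v p" if p: "p \<in> P" for p
    proof -
      have pb: "p \<in> ball 0 R1" using subsetD[OF Pb[OF p], of p] h by simp
      have "exp (real n * (u p - \<eta>)) < cmod (G p)" using G p by (auto simp: good_function_def)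
      then have "ln (exp (real n * (u p - \<eta>))) \<le> ln (cmod (G p))" by (intro ln_mono) auto
      then show ?thesis using n by (simp add: vG[OF pb Gp[OF p]] field_simps)
    qed
    have osc: "\<bar>u z - u p\<bar> \<le> \<eta>" if "p \<in> P" "z \<in> ball p h" for p z
    proof -
      have "z \<in> cball 0 R1" "p \<in> cball 0 R1" using subsetD[OF Pb[OF that(1)], of z] subsetD[OF Pb[OF that(1)], of p] that(2) h(1) by auto
      moreover have "dist z p < d" using that(2) h by (simp add: dist_commute)
      ultimately show ?thesis using d(2)[of z p] by (simp add: dist_real_def)
    qed
    have L1: "integrable lborel (\<lambda>z. indicator (cball 0 r1) z * \<bar>v z - u z\<bar>)"
      "(\<integral>z. indicator (cball 0 r1) z * \<bar>v z - u z\<bar> \<partial>lborel) \<le> 5 * \<eta> * pi * (36 * (r1 + 1)\<^sup>2)"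
    proof -
      have PZ: "p \<notin> Z \<and> cball p h \<subseteq> ball 0 R1" if "p \<in> P" for p using Gp[OF that] Pb[OF that] by (auto simp: Z_def)
      note K = potential_L1_bound[OF L(1) L'h R1(1) _ P(1) PZ h(1) cov card _ osc, of wt]
      show "integrable lborel (\<lambda>z. indicator (cball 0 r1) z * \<bar>v z - u z\<bar>)"
        using K(1) \<eta> up low unfolding v_def by (auto simp: wt_def)
      show "(\<integral>z. indicator (cball 0 r1) z * \<bar>v z - u z\<bar> \<partial>lborel) \<le> 5 * \<eta> * pi * (36 * (r1 + 1)\<^sup>2)"
        using K(2) \<eta> up low unfolding v_def by (auto simp: wt_def)
    qed
    have rR: "r + \<rho> < R1" using \<rho> r by simp
    have lv: "lap \<rho> z * v z = (\<Sum>a\<in>Z. wt a * (lap \<rho> z * ln (cmod (z - a)))) + lap \<rho> z * Re (L' z)" for z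
      by (simp add: v_def algebra_simps sum_distrib_left)
    have iv: "integrable lborel (\<lambda>z. lap \<rho> z * v z)"
      unfolding lv using integral_lap_ln(1)[OF \<rho>(1)] integral_lap_harmonic(1)[OF L'h \<rho>(1) rR]
      by (intro Bochner_Integration.integrable_add Bochner_Integration.integrable_sum) auto
    have Iv: "(\<integral>z. lap \<rho> z * v z \<partial>lborel) = zero_sum R1 n G (pot \<rho>)"
    proof -
      have "(\<integral>z. lap \<rho> z * v z \<partial>lborel) = (\<Sum>a\<in>Z. wt a * (\<integral>z. lap \<rho> z * ln (cmod (z - a)) \<partial>lborel)) + (\<integral>z. lap \<rho> z * Re (L' z) \<partial>lborel)"
        unfolding lv using integral_lap_ln(1)[OF \<rho>(1)] integral_lap_harmonic(1)[OF L'h \<rho>(1) rR]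
        by (subst Bochner_Integration.integral_add) (auto intro!: Bochner_Integration.integrable_sum simp: Bochner_Integration.integral_sum)
      also have "\<dots> = (\<Sum>a\<in>Z. wt a * pot \<rho> a)"
        using integral_lap_ln(3)[OF \<rho>(1)] integral_lap_harmonic(2)[OF L'h \<rho>(1) rR] by simp
      finally show ?thesis by (simp add: zero_sum_def Z_def wt_def sum_divide_distrib)
    qed
    have ui: "integrable lborel (\<lambda>z. indicator (ball 0 R1) z * u z)"
    proof -
      have "set_integrable lborel (cball 0 R1) u"
        unfolding set_integrable_def by (rule borel_integrable_compact[OF compact_cball uc])
      then have "set_integrable lborel (ball 0 R1) u" by (rule set_integrable_subset) auto
      then show ?thesis by (simp add: set_integrable_def)
    qed
    have iu: "integrable lborel (\<lambda>z. lap \<rho> z * u z)"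
      by (rule integral_lap(1)[OF ui rR]) (use \<rho> in simp)
    have Iu: "(\<integral>z. lap \<rho> z * u z \<partial>lborel) = (\<integral>a. pot \<rho> a \<partial>N)"
      by (rule integral_lap_radial_potential[OF N(1,2,3) \<rho>(1) rR R1(2) borel_measurable_integrable[OF iu] c])
    have B: "B \<ge> 0" using bound[of 0] by linarith
    have "\<bar>zero_sum R1 n G (pot \<rho>) - (\<integral>a. pot \<rho> a \<partial>N)\<bar> = \<bar>\<integral>z. lap \<rho> z * v z - lap \<rho> z * u z \<partial>lborel\<bar>"
      using iv iu by (simp add: Iv Iu)
    also have "\<dots> \<le> (\<integral>z. \<bar>lap \<rho> z * v z - lap \<rho> z * u z\<bar> \<partial>lborel)" by (rule integral_abs_bound)
    also have "\<dots> \<le> (\<integral>z. 2 * B * (indicator (cball 0 r1) z * \<bar>v z - u z\<bar>) \<partial>lborel)"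
    proof (rule integral_mono)
      show "integrable lborel (\<lambda>z. 2 * B * (indicator (cball 0 r1) z * \<bar>v z - u z\<bar>))" using L1(1) by simp
      fix z
      show "\<bar>lap \<rho> z * v z - lap \<rho> z * u z\<bar> \<le> 2 * B * (indicator (cball 0 r1) z * \<bar>v z - u z\<bar>)"
      proof (cases "cmod z \<le> r1")
        case True
        have "\<bar>lap \<rho> z * v z - lap \<rho> z * u z\<bar> = \<bar>lap \<rho> z\<bar> * \<bar>v z - u z\<bar>" by (simp add: right_diff_distrib[symmetric] abs_mult)
        also have "\<dots> \<le> 2 * B * \<bar>v z - u z\<bar>" using lap_bound by (intro mult_right_mono) auto
        finally show ?thesis using True by simp
      next
        case False
        then have "lap \<rho> z = 0" using \<rho> by (intro lap_eq_0) auto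
        then show ?thesis using False by simp
      qed
    qed (use iv iu in auto)
    also have "\<dots> \<le> 2 * B * (5 * \<eta> * pi * (36 * (r1 + 1)\<^sup>2))"
      using L1(2) B by (simp only: integral_mult_right_zero) (intro mult_left_mono, auto)
    also have "\<dots> = B * (360 * pi * (r1 + 1)\<^sup>2) * \<eta>" by simp
    finally show "\<bar>zero_sum R1 n G (pot \<rho>) - (\<integral>a. pot \<rho> a \<partial>N)\<bar> \<le> B * (360 * pi * (r1 + 1)\<^sup>2) * \<eta>" .
  qed (use P in auto)
qed

end

section \<open>Counting zeros and removing the smoothing\<close>

context convex_profile
begin

lemma zero_sum_mono:
  assumes "\<And>a. a \<in> ball 0 R1 \<Longrightarrow> G a = 0 \<Longrightarrow> \<phi> a \<le> \<psi> a"
  shows "zero_sum R1 n G \<phi> \<le> zero_sum R1 n G \<psi>"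
  unfolding zero_sum_def using assms by (intro divide_right_mono sum_mono mult_left_mono) auto

lemma zero_sum_linear:
  "zero_sum R1 n G (\<lambda>a. c * \<phi> a) = c * zero_sum R1 n G \<phi>"
  "zero_sum R1 n G (\<lambda>a. \<phi> a - \<psi> a) = zero_sum R1 n G \<phi> - zero_sum R1 n G \<psi>"
proof -
  have "(\<Sum>a\<in>Z. w a * (c * \<phi> a)) = c * (\<Sum>a\<in>Z. w a * \<phi> a)" for w and Z :: "complex set"
    by (simp add: sum_distrib_left mult_ac)
  then show "zero_sum R1 n G (\<lambda>a. c * \<phi> a) = c * zero_sum R1 n G \<phi>" by (simp add: zero_sum_def)
  show "zero_sum R1 n G (\<lambda>a. \<phi> a - \<psi> a) = zero_sum R1 n G \<phi> - zero_sum R1 n G \<psi>"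
    by (simp add: zero_sum_def sum_subtractf right_diff_distrib diff_divide_distrib)
qed

lemma zero_sum_abs_le: "\<bar>zero_sum R1 n G \<phi>\<bar> \<le> zero_sum R1 n G (\<lambda>a. \<bar>\<phi> a\<bar>)"
proof -
  have "\<bar>\<Sum>a\<in>{a\<in>ball 0 R1. G a = 0}. real (nat (zorder G a)) * \<phi> a\<bar> \<le> (\<Sum>a\<in>{a\<in>ball 0 R1. G a = 0}. real (nat (zorder G a)) * \<bar>\<phi> a\<bar>)"
    by (rule order_trans[OF sum_abs]) (simp add: abs_mult)
  then show ?thesis unfolding zero_sum_def by (simp add: abs_divide divide_right_mono)
qed

text \<open>A plateau function equal to 1 on a slightly larger disk has a smoothed version equal to
  the constant c on the disk of radius r0 and nonnegative elsewhere. Convergence up to a fixed error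
  for this one function therefore bounds the number of zeros divided by n.\<close>

lemma zero_count_bounded:
  fixes N :: "complex measure"
  assumes r: "0 \<le> r0" "r0 < R1" "R1 < R2" "ereal R2 < R0"
    and N: "finite_measure N" "rotation_invariant_borel N" "AE a in N. a \<in> ball 0 R1"
      "\<And>r. 0 < r \<Longrightarrow> r \<le> R1 \<Longrightarrow> measure N (ball 0 r) = D (ln r)"
  obtains T P where "finite P" "P \<noteq> {}" "\<And>p. p \<in> P \<Longrightarrow> p \<noteq> 0 \<and> cmod p < R1"
    "\<And>n G. good_function R2 P 1 n G \<Longrightarrow> zero_sum R1 n G (\<lambda>a. if cmod a \<le> r0 then 1 else 0) \<le> T"
proof -
  define d where "d = (R1 - r0) / 4"
  have d: "d > 0" "r0 + 3 * d < R1" using r by (auto simp: d_def field_simps)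
  define \<psi> where "\<psi> z = max 0 (min 1 ((r0 + 2 * d - cmod z) / d))" for z :: complex
  interpret test_function \<psi> "r0 + 2 * d" 1
  proof
    show "continuous_on UNIV \<psi>" unfolding \<psi>_def using d by (intro continuous_intros) auto
    show "\<psi> z = 0" if "cmod z > r0 + 2 * d" for z
    proof -
      have "(r0 + 2 * d - cmod z) / d \<le> 0" using that d by (intro divide_nonpos_pos) auto
      then show ?thesis by (simp add: \<psi>_def)
    qed
    show "\<bar>\<psi> z\<bar> \<le> 1" for z by (simp add: \<psi>_def)
  qed
  define c where "c = (\<integral>z. ln (max d (cmod z)) - ln (cmod z) \<partial>lborel)"
  have c: "c > 0" unfolding c_def by (rule pot_bounds(2)[OF d(1)])
  have one: "\<psi> z = 1" if "cmod z \<le> r0 + d" for z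
    using that d by (simp add: \<psi>_def field_simps)
  have pot1: "pot d a = c" if a: "cmod a \<le> r0" for a
  proof -
    have "\<bar>\<psi> z - \<psi> a\<bar> \<le> 0" if "cmod (z - a) < d" for z
    proof -
      have "cmod z \<le> r0 + d" using that a norm_triangle_ineq2[of z a] by linarith
      then show ?thesis using one a d by simp
    qed
    from pot_bounds(3)[OF d(1) this] have "\<bar>pot d a - c * \<psi> a\<bar> \<le> c * 0" unfolding c_def by blast
    then show ?thesis using one[of a] a d by simp
  qed
  have pot0: "pot d a \<ge> 0" for a
    unfolding pot_def
  proof (rule integral_nonneg_AE)
    show "AE z in lborel. 0 \<le> \<psi> z * (ln (max d (cmod (z - a))) - ln (cmod (z - a)))"
      using AE_lborel_norm_neq[of a 0]
    proof eventually_elim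
      case (elim z)
      then have "ln (cmod (z - a)) \<le> ln (max d (cmod (z - a)))" by (intro ln_mono) auto
      then show ?case by (simp add: \<psi>_def)
    qed
  qed
  obtain P where P: "finite P" "P \<noteq> {}" "\<And>p. p \<in> P \<Longrightarrow> p \<noteq> 0 \<and> cmod p < R1"
    "\<And>n G \<psi> r B \<rho>. good_function R2 P 1 n G \<Longrightarrow> test_function \<psi> r B \<Longrightarrow> \<rho> > 0 \<Longrightarrow> r + \<rho> \<le> r0 + 3 * d \<Longrightarrow>
       \<bar>zero_sum R1 n G (test_function.pot \<psi> \<rho>) - (\<integral>a. test_function.pot \<psi> \<rho> a \<partial>N)\<bar> \<le> B * (360 * pi * (r0 + 3 * d + 1)\<^sup>2) * 1"
    by (rule potential_convergence[of "r0 + 3 * d" R1 R2 N 1]) (use r d N in auto)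
  define T where "T = ((\<integral>a. pot d a \<partial>N) + 360 * pi * (r0 + 3 * d + 1)\<^sup>2) / c"
  show ?thesis
  proof (rule that[OF P(1,2,3)])
    fix n G assume G: "good_function R2 P 1 n G"
    have "zero_sum R1 n G (pot d) \<le> (\<integral>a. pot d a \<partial>N) + 360 * pi * (r0 + 3 * d + 1)\<^sup>2"
      using P(4)[OF G test_function_axioms d(1)] by (simp add: abs_le_iff)
    moreover have "zero_sum R1 n G (\<lambda>a. c * (if cmod a \<le> r0 then 1 else 0)) \<le> zero_sum R1 n G (pot d)"
      by (rule zero_sum_mono) (use pot1 pot0 in auto)
    ultimately show "zero_sum R1 n G (\<lambda>a. if cmod a \<le> r0 then 1 else 0) \<le> T"
      using c unfolding T_def zero_sum_linear(1) by (simp add: field_simps)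
  qed
qed

text \<open>The order of choices matters: the count bound T fixes the accuracy e, uniform continuity
  then fixes \<rho>, and only now is the kernel mass c known, by which the error of the smoothed
  identity is divided; \<eta> is chosen last to compensate.\<close>

lemma zero_sum_convergence:
  fixes N :: "complex measure"
  assumes r: "0 \<le> r0" "r0 < R1" "R1 < R2" "ereal R2 < R0"
    and N: "finite_measure N" "rotation_invariant_borel N" "AE a in N. a \<in> ball 0 R1"
      "\<And>r. 0 < r \<Longrightarrow> r \<le> R1 \<Longrightarrow> measure N (ball 0 r) = D (ln r)"
    and tf: "test_function \<psi> r0 B" and \<epsilon>: "\<epsilon> > 0"
  obtains \<eta> P where "\<eta> > 0" "finite P" "P \<noteq> {}" "\<And>p. p \<in> P \<Longrightarrow> p \<noteq> 0 \<and> cmod p < R1"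
    "\<And>n G. good_function R2 P \<eta> n G \<Longrightarrow> \<bar>zero_sum R1 n G \<psi> - (\<integral>a. \<psi> a \<partial>N)\<bar> \<le> \<epsilon>"
proof -
  interpret test_function \<psi> r0 B by fact
  interpret N: finite_measure N by fact
  have sN[measurable_cong]: "sets N = sets borel" using N by (simp add: rotation_invariant_borel_def)
  define d where "d = (R1 - r0) / 4"
  have d: "d > 0" "r0 + 3 * d < R1" using r by (auto simp: d_def field_simps)
  have B: "B \<ge> 0" using bound[of 0] by linarith
  have rd: "0 \<le> r0 + d" "r0 + d < R1" using r d by auto
  obtain T P0 where P0: "finite P0" "P0 \<noteq> {}" "\<And>p. p \<in> P0 \<Longrightarrow> p \<noteq> 0 \<and> cmod p < R1"
    "\<And>n G. good_function R2 P0 1 n G \<Longrightarrow> zero_sum R1 n G (\<lambda>a. if cmod a \<le> r0 + d then 1 else 0) \<le> T"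
    by (rule zero_count_bounded[of "r0 + d" R1 R2 N]) (use rd r N in auto)
  \<comment> \<open>Bounds the normalized number of zeros and the mass of N together, so that both
    smoothing errors add up to at most \<epsilon> / 2; the 1 keeps it positive.\<close>
  define T' where "T' = \<bar>T\<bar> + measure N UNIV + 1"
  have T': "T' > 0" by (simp add: T'_def add_nonneg_pos)
  define e where "e = \<epsilon> / (2 * T')"
  have e: "e > 0" using \<epsilon> T' by (simp add: e_def)
  obtain \<rho> where \<rho>: "\<rho> > 0" "\<rho> \<le> d" "\<And>z a. cmod (z - a) < \<rho> \<Longrightarrow> \<bar>\<psi> z - \<psi> a\<bar> \<le> e"
  proof -
    have "continuous_on (cball 0 (r0 + 1)) \<psi>" using cont by (rule continuous_on_subset) simp
    then obtain k where k: "k > 0" "\<And>x y. x \<in> cball 0 (r0 + 1) \<Longrightarrow> y \<in> cball 0 (r0 + 1) \<Longrightarrow> dist x y < k \<Longrightarrow> dist (\<psi> x) (\<psi> y) < e"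
      using compact_uniformly_continuous[OF _ compact_cball] e unfolding uniformly_continuous_on_def by (metis dist_commute)
    \<comment> \<open>The bound 1 on the distance handles pairs leaving the larger disk: if one
      point has modulus above r0 + 1, the other has modulus above r0, and \<psi> vanishes at
      both.\<close>
    show ?thesis
    proof (rule that[of "min (min k 1) d"])
      fix z a assume za: "cmod (z - a) < min (min k 1) d"
      show "\<bar>\<psi> z - \<psi> a\<bar> \<le> e"
      proof (cases "z \<in> cball 0 (r0 + 1) \<and> a \<in> cball 0 (r0 + 1)")
        case True
        then show ?thesis using k(2)[of z a] za by (simp add: dist_norm dist_real_def)
      next
        case False
        have "cmod z \<le> cmod a + cmod (z - a)" "cmod a \<le> cmod z + cmod (z - a)"
          using norm_triangle_ineq2[of z a] norm_triangle_ineq2[of a z] by (auto simp: norm_minus_commute)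
        then have "cmod z > r0" "cmod a > r0" using False za by auto
        then show ?thesis using supp e by simp
      qed
    qed (use k d in auto)
  qed
  define c where "c = (\<integral>z. ln (max \<rho> (cmod z)) - ln (cmod z) \<partial>lborel)"
  have c: "c > 0" unfolding c_def by (rule pot_bounds(2)[OF \<rho>(1)])
  have app: "\<bar>pot \<rho> a / c - \<psi> a\<bar> \<le> e * (if cmod a \<le> r0 + d then 1 else 0)" for a
  proof (cases "cmod a \<le> r0 + d")
    case True
    have "\<bar>pot \<rho> a - c * \<psi> a\<bar> \<le> c * e" unfolding c_def by (rule pot_bounds(3)[OF \<rho>(1,3)])
    moreover have "\<bar>pot \<rho> a / c - \<psi> a\<bar> = \<bar>pot \<rho> a - c * \<psi> a\<bar> / c" using c by (simp add: field_simps abs_divide[symmetric])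
    ultimately show ?thesis using True c by (simp add: field_simps)
  next
    case False
    then show ?thesis using pot_eq_0[OF \<rho>(1), of a] supp[of a] \<rho> d by simp
  qed
  define K where "K = B * (360 * pi * (r0 + 3 * d + 1)\<^sup>2) / c"
  have K: "K \<ge> 0" using B c by (simp add: K_def)
  \<comment> \<open>K contains the division by c; the remaining \<epsilon> / 2 is spent here. The
    cap 1 makes the count bound, proved for tolerance 1, applicable.\<close>
  define \<eta> where "\<eta> = min 1 (\<epsilon> / (2 * (K + 1)))"
  have \<eta>: "\<eta> > 0" "\<eta> \<le> 1" "K * \<eta> \<le> \<epsilon> / 2"
  proof -
    show "\<eta> > 0" using \<epsilon> K by (simp add: \<eta>_def)
    have "K * \<eta> \<le> (K + 1) * (\<epsilon> / (2 * (K + 1)))" using K \<epsilon> by (intro mult_mono) (auto simp: \<eta>_def)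
    also have "\<dots> = \<epsilon> / 2" using K by (simp add: field_simps)
    finally show "K * \<eta> \<le> \<epsilon> / 2" .
  qed (simp add: \<eta>_def)
  obtain P where P: "finite P" "P \<noteq> {}" "\<And>p. p \<in> P \<Longrightarrow> p \<noteq> 0 \<and> cmod p < R1"
    "\<And>n G \<psi> r B \<rho>. good_function R2 P \<eta> n G \<Longrightarrow> test_function \<psi> r B \<Longrightarrow> \<rho> > 0 \<Longrightarrow> r + \<rho> \<le> r0 + 3 * d \<Longrightarrow>
       \<bar>zero_sum R1 n G (test_function.pot \<psi> \<rho>) - (\<integral>a. test_function.pot \<psi> \<rho> a \<partial>N)\<bar> \<le> B * (360 * pi * (r0 + 3 * d + 1)\<^sup>2) * \<eta>"
    by (rule potential_convergence[of "r0 + 3 * d" R1 R2 N \<eta>]) (use r d N \<eta> in auto)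
  show ?thesis
  proof (rule that[of \<eta> "P0 \<union> P"])
    fix n G assume G: "good_function R2 (P0 \<union> P) \<eta> n G"
    have G0: "good_function R2 P0 1 n G" by (rule good_function_antimono[OF G]) (use \<eta> in auto)
    have G1: "good_function R2 P \<eta> n G" by (rule good_function_antimono[OF G]) auto
    have "\<bar>zero_sum R1 n G (\<lambda>a. pot \<rho> a / c) - zero_sum R1 n G \<psi>\<bar> \<le> zero_sum R1 n G (\<lambda>a. \<bar>pot \<rho> a / c - \<psi> a\<bar>)"
      unfolding zero_sum_linear(2)[symmetric] by (rule zero_sum_abs_le)
    also have "\<dots> \<le> zero_sum R1 n G (\<lambda>a. e * (if cmod a \<le> r0 + d then 1 else 0))"
      by (rule zero_sum_mono) (rule app)
    also have "\<dots> \<le> e * T" unfolding zero_sum_linear(1) using P0(4)[OF G0] e by (intro mult_left_mono) auto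
    finally have 1: "\<bar>zero_sum R1 n G (\<lambda>a. pot \<rho> a / c) - zero_sum R1 n G \<psi>\<bar> \<le> e * T" .
    have pi: "integrable N (\<lambda>a. pot \<rho> a)"
      by (rule N.integrable_const_bound[where B="B * (\<integral>z. ln (max \<rho> (cmod z)) - ln (cmod z) \<partial>lborel) * 3"])
        (use pot_abs_le[OF \<rho>(1)] in auto)
    have psi: "integrable N \<psi>" by (rule N.integrable_const_bound[where B=B]) (use bound in auto)
    have "\<bar>(\<integral>a. pot \<rho> a / c - \<psi> a \<partial>N)\<bar> \<le> (\<integral>a. \<bar>pot \<rho> a / c - \<psi> a\<bar> \<partial>N)" by (rule integral_abs_bound)
    also have "\<dots> \<le> (\<integral>a. e \<partial>N)"
    proof (rule integral_mono)
      show "\<bar>pot \<rho> a / c - \<psi> a\<bar> \<le> e" for a using app[of a] e by (auto split: if_splits)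
    qed (use pi psi in auto)
    also have "\<dots> = e * measure N UNIV" using sets_eq_imp_space_eq[OF sN] by (simp add: mult.commute)
    finally have 2: "\<bar>(\<integral>a. pot \<rho> a \<partial>N) / c - (\<integral>a. \<psi> a \<partial>N)\<bar> \<le> e * measure N UNIV" using pi psi by simp
    have z: "zero_sum R1 n G (\<lambda>a. pot \<rho> a / c) = zero_sum R1 n G (pot \<rho>) / c"
      using zero_sum_linear(1)[of R1 n G "1 / c" "pot \<rho>"] by simp
    have "\<bar>zero_sum R1 n G (pot \<rho>) - (\<integral>a. pot \<rho> a \<partial>N)\<bar> \<le> B * (360 * pi * (r0 + 3 * d + 1)\<^sup>2) * \<eta>"
      by (rule P(4)[OF G1 tf \<rho>(1)]) (use \<rho> d in simp)
    then have "\<bar>zero_sum R1 n G (pot \<rho>) - (\<integral>a. pot \<rho> a \<partial>N)\<bar> / c \<le> K * \<eta>"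
      using c by (simp add: K_def field_simps)
    moreover have "\<bar>zero_sum R1 n G (\<lambda>a. pot \<rho> a / c) - (\<integral>a. pot \<rho> a \<partial>N) / c\<bar> = \<bar>zero_sum R1 n G (pot \<rho>) - (\<integral>a. pot \<rho> a \<partial>N)\<bar> / c"
    proof -
      have "zero_sum R1 n G (pot \<rho>) / c - (\<integral>a. pot \<rho> a \<partial>N) / c = (zero_sum R1 n G (pot \<rho>) - (\<integral>a. pot \<rho> a \<partial>N)) / c"
        by (simp add: diff_divide_distrib)
      then show ?thesis unfolding z using c by simp
    qed
    ultimately have 3: "\<bar>zero_sum R1 n G (\<lambda>a. pot \<rho> a / c) - (\<integral>a. pot \<rho> a \<partial>N) / c\<bar> \<le> \<epsilon> / 2"
      using \<eta>(3) by linarith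
    have "e * T + e * measure N UNIV \<le> e * T'" using mult_left_mono[of "T + measure N UNIV" T' e] e by (simp add: T'_def distrib_left)
    also have "\<dots> = \<epsilon> / 2" using T' by (simp add: e_def)
    finally show "\<bar>zero_sum R1 n G \<psi> - (\<integral>a. \<psi> a \<partial>N)\<bar> \<le> \<epsilon>" using 1 2 3 by linarith
  qed (use \<eta>(1) P(1-3) P0(1-3) in auto)
qed

end

section \<open>Integrals against zero measures and truncations\<close>

lemma integral_scale_measure:
  fixes f :: "'a \<Rightarrow> real"
  assumes "f \<in> borel_measurable M" "c \<ge> 0"
  shows "(\<integral>x. f x \<partial>scale_measure (ennreal c) M) = c * (\<integral>x. f x \<partial>M)"
proof -
  have "scale_measure (ennreal c) M = density M (\<lambda>_. ennreal c)"
    by (rule measure_eqI) (auto simp: emeasure_density_const)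
  then show ?thesis using assms by (simp add: integral_density)
qed

text \<open>Zeros may accumulate at the boundary of the disk, but \<phi> vanishes from radius R1 on,
  which leaves a finite sum.\<close>

lemma integral_zero_measure:
  fixes \<phi> :: "complex \<Rightarrow> real"
  assumes g: "g \<noteq> 0" and conv: "ereal R2 \<le> fps_conv_radius g" and R: "0 < R1" "R1 < R2" "ereal R2 < R0"
    and \<phi>: "continuous_on (eball 0 R0) \<phi>" "\<And>z. z \<in> eball 0 R0 \<Longrightarrow> cmod z \<ge> R1 \<Longrightarrow> \<phi> z = 0"
    and ex: "\<exists>z\<in>ball 0 R2. eval_fps g z \<noteq> 0"
  shows "(\<integral>x. \<phi> x \<partial>scale_measure (ennreal (1 / real n)) (zero_measure R0 g)) =
    (\<Sum>a\<in>{a\<in>ball 0 R1. eval_fps g a = 0}. real (nat (zorder (eval_fps g) a)) * \<phi> a) / real n"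
proof -
  define W where "W = {z \<in> eball 0 R0 \<inter> eball 0 (fps_conv_radius g). eval_fps g z = 0}"
  define w where "w a = real (nat (zorder (eval_fps g) a))" for a
  define Z where "Z = {a\<in>ball 0 R1. eval_fps g a = 0}"
  have m: "\<phi> \<in> borel_measurable (restrict_space borel (eball 0 R0))"
    by (rule borel_measurable_continuous_on_restrict[OF \<phi>(1)])
  have zm: "zero_measure R0 g = distr (density (count_space W) (\<lambda>a. ennreal (w a))) (restrict_space borel (eball 0 R0)) (\<lambda>z. z)"
    using g by (simp add: zero_measure_def W_def w_def ennreal_of_nat_eq_real_of_nat)
  have idm: "(\<lambda>z. z) \<in> measurable (density (count_space W) (\<lambda>a. ennreal (w a))) (restrict_space borel (eball 0 R0))"
    by (simp add: measurable_density_eq1) (auto simp: W_def space_restrict_space)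
  have sub: "Z \<subseteq> W"
  proof
    fix a assume "a \<in> Z"
    then have a: "cmod a < R1" "eval_fps g a = 0" by (auto simp: Z_def)
    then have "ereal (cmod a) < ereal R2" using R by simp
    then have "ereal (cmod a) < R0" "ereal (cmod a) < fps_conv_radius g"
      using less_trans[OF _ R(3)] less_le_trans[OF _ conv] by blast+
    then show "a \<in> W" using a by (simp add: W_def)
  qed
  have hol: "eval_fps g holomorphic_on ball 0 R2"
    using eball_mono[OF conv, of 0] by (intro holomorphic_on_eval_fps) simp
  have fin: "finite Z"
    using holomorphic_ln_norm_decomposition[OF hol R(1,2) ex] unfolding Z_def by blast
  have supp: "a \<in> Z" if "a \<in> W" "w a * \<phi> a \<noteq> 0" for a
    using that \<phi>(2)[of a] by (force simp: W_def Z_def)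
  have "(\<integral>x. \<phi> x \<partial>zero_measure R0 g) = (\<integral>x. \<phi> x \<partial>density (count_space W) (\<lambda>a. ennreal (w a)))"
    unfolding zm by (rule integral_distr[OF idm m])
  also have "\<dots> = (\<integral>x. w x * \<phi> x \<partial>count_space W)"
    by (subst integral_density) (auto simp: w_def)
  also have "\<dots> = (\<Sum>a | a \<in> W \<and> w a * \<phi> a \<noteq> 0. w a * \<phi> a)"
    by (rule lebesgue_integral_count_space_finite_support) (rule finite_subset[OF _ fin], use supp in auto)
  also have "\<dots> = (\<Sum>a\<in>Z. w a * \<phi> a)"
    by (rule sum.mono_neutral_left[OF fin]) (use supp sub in auto)
  finally have "(\<integral>x. \<phi> x \<partial>zero_measure R0 g) = (\<Sum>a\<in>Z. w a * \<phi> a)" .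
  moreover have "\<phi> \<in> borel_measurable (zero_measure R0 g)" using m unfolding zm by (simp add: measurable_distr_eq1)
  ultimately show ?thesis by (simp add: integral_scale_measure Z_def w_def)
qed

lemma integral_trunc:
  fixes \<phi> \<psi> :: "complex \<Rightarrow> real"
  assumes lf: "locally_finite_borel_on (eball 0 R0) \<mu>" and R: "ereal R1 < R0"
    and m: "\<psi> \<in> borel_measurable borel" and eq: "\<And>z. z \<in> eball 0 R0 \<Longrightarrow> \<phi> z = \<psi> z"
    and supp: "\<And>z. cmod z \<ge> R1 \<Longrightarrow> \<psi> z = 0"
  shows "(\<integral>x. \<phi> x \<partial>\<mu>) = (\<integral>x. \<psi> x \<partial>trunc \<mu> R1)"
proof -
  have "ball 0 R1 \<inter> space \<mu> \<in> sets \<mu>"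
    using lf_set[OF lf R, of UNIV] ball_subset_eball[OF lf R] lf_space[OF lf R] by (simp add: Int_absorb2)
  then have "(\<integral>x. \<psi> x \<partial>trunc \<mu> R1) = (\<integral>x. indicator (ball 0 R1) x *\<^sub>R \<psi> x \<partial>\<mu>)"
    unfolding trunc_def by (subst integral_distr[OF trunc_measurable[OF lf R] m]) (rule integral_restrict_space)
  also have "\<dots> = (\<integral>x. \<phi> x \<partial>\<mu>)"
  proof (rule Bochner_Integration.integral_cong[OF refl])
    fix x assume "x \<in> space \<mu>"
    then have "x \<in> eball 0 R0" using lf_space[OF lf R] by simp
    then show "indicator (ball 0 R1) x *\<^sub>R \<psi> x = \<phi> x" using eq[of x] supp[of x] by (cases "cmod x < R1") auto
  qed
  finally show ?thesis ..
qed

section \<open>Convergence of the zero measures\<close>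

lemma compact_subset_eball_0:
  assumes "compact K" "K \<subseteq> eball (0::complex) R0" "R0 > 0"
  obtains r where "0 \<le> r" "ereal r < R0" "K \<subseteq> cball 0 r"
proof (cases "K = {}")
  case True
  then show ?thesis using assms by (intro that[of 0]) (auto simp: zero_ereal_def)
next
  case False
  obtain z where z: "z \<in> K" "\<And>w. w \<in> K \<Longrightarrow> cmod w \<le> cmod z"
    using continuous_attains_sup[of K cmod] assms False by (auto intro: continuous_intros)
  then show ?thesis using assms by (intro that[of "cmod z"]) auto
qed

text \<open>Continuity is glued from the open disk and the open complement of K, on which the
  extension is 0; together they cover the plane.\<close>

lemma test_function_extension:
  fixes \<phi> :: "complex \<Rightarrow> real"
  assumes c: "continuous_on (eball 0 R0) \<phi>" and K: "compact K" "K \<subseteq> eball 0 R0" "\<And>x. x \<in> eball 0 R0 - K \<Longrightarrow> \<phi> x = 0"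
    and r: "K \<subseteq> cball 0 r"
  obtains B where "test_function (\<lambda>z. if z \<in> eball 0 R0 then \<phi> z else 0) r B"
proof -
  define \<psi> where "\<psi> z = (if z \<in> eball 0 R0 then \<phi> z else 0)" for z
  have c1: "continuous_on (eball 0 R0) \<psi>"
    using c by (rule continuous_on_eq) (simp add: \<psi>_def)
  have c2: "continuous_on (- K) \<psi>"
  proof (rule continuous_on_eq)
    show "continuous_on (- K) (\<lambda>_. 0 :: real)" by simp
  qed (use K in \<open>auto simp: \<psi>_def\<close>)
  have cU: "continuous_on UNIV \<psi>"
  proof -
    have "continuous_on (eball 0 R0 \<union> - K) \<psi>"
      using K by (intro continuous_on_open_Un c1 c2) (auto simp: compact_imp_closed open_Compl)
    moreover have "eball 0 R0 \<union> - K = UNIV" using K by auto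
    ultimately show ?thesis by simp
  qed
  have "bounded (\<psi> ` K)"
    by (intro compact_imp_bounded compact_continuous_image continuous_on_subset[OF cU] K) simp
  then obtain B where B: "\<forall>y\<in>\<psi> ` K. norm y \<le> B" unfolding bounded_iff by blast
  have s: "\<psi> z = 0" if "z \<notin> K" for z using that K(3)[of z] by (simp add: \<psi>_def)
  have "test_function \<psi> r \<bar>B\<bar>"
  proof
    show "\<psi> z = 0" if "cmod z > r" for z using that r by (intro s) auto
    show "\<bar>\<psi> z\<bar> \<le> \<bar>B\<bar>" for z
      using B s[of z] by (cases "z \<in> K") force+
  qed (rule cU)
  then show ?thesis using that unfolding \<psi>_def by blast
qed

lemma outer_measure_of_tendsto_0I:
  assumes "\<And>e. e > 0 \<Longrightarrow> eventually (\<lambda>n. \<exists>A\<in>sets M. emeasure M A \<le> ennreal e \<and> X n \<subseteq> A) sequentially"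
  shows "(\<lambda>n. outer_measure_of M (X n)) \<longlonglongrightarrow> 0"
proof (rule order_tendstoI)
  fix a :: ennreal assume "0 < a"
  then obtain b where b: "0 < b" "b < a" using dense by blast
  then have "b < top" by (auto intro: less_trans simp: less_top[symmetric] order_less_imp_not_less)
  then obtain e where e: "b = ennreal e" "e \<ge> 0" by (cases b) auto
  then have "e > 0" using b by (simp add: less_le)
  from assms[OF this] show "eventually (\<lambda>n. outer_measure_of M (X n) < a) sequentially"
  proof eventually_elim
    case (elim n)
    then obtain A where A: "A \<in> sets M" "emeasure M A \<le> ennreal e" "X n \<subseteq> A" by blast
    have "outer_measure_of M (X n) \<le> emeasure M A"
      using A by (simp add: outer_measure_of_def INF_lower)
    then show ?case using A e b by (meson le_less_trans order_trans)
  qed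
qed simp

section \<open>The limit measure and convergence in probability\<close>

context random_taylor
begin

lemma radial_measure_exists:
  "radial_measure R0 (conjugate f) (radial_profile.\<mu> (\<lambda>r. D (ln r)) R0)"
proof -
  interpret rp: radial_profile "\<lambda>r. D (ln r)" R0 by (rule radial_profile)
  show ?thesis
    unfolding radial_measure_def
  proof (intro conjI allI impI rp.locally_finite_\<mu> rp.rotation_invariant_\<mu>)
    fix r assume r: "0 < r \<and> ereal r < R0"
    then have lr: "ln r \<in> S" by simp
    have "measure rp.\<mu> (ball 0 r) = D (ln r)"
      using rp.emeasure_\<mu>_ball[of r] r D_nonneg[OF lr] by (simp add: measure_def)
    moreover have "((\<lambda>s. real_of_ereal (conjugate f s)) has_real_derivative D (ln r)) (at_left (ln r))"
    proof (subst has_field_derivative_cong_eventually)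
      show "eventually (\<lambda>s. real_of_ereal (conjugate f s) = I s) (at_left (ln r))"
      proof -
        have "eventually (\<lambda>s. s \<in> {ln r - 1<..<ln r}) (at_left (ln r))" by (rule eventually_at_left_real) simp
        then show ?thesis
        proof eventually_elim
          case (elim s)
          then have "s \<in> S" using S_down[OF lr, of s] by simp
          then show ?case by (simp add: conjugate_eq)
        qed
      qed
      show "real_of_ereal (conjugate f (ln r)) = I (ln r)" using lr by (simp add: conjugate_eq del: exp_ln)
    qed (rule D_left_derivative[OF lr])
    ultimately show "((\<lambda>s. real_of_ereal (conjugate f s)) has_real_derivative measure rp.\<mu> (ball 0 r)) (at_left (ln r))"
      by simp
  qed
qed

text \<open>Limits from the left are unique, so both measures give the same mass to every centred
  ball, and such masses determine a radial measure.\<close>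

lemma radial_measure_unique:
  assumes "radial_measure R0 (conjugate f) \<nu>" "radial_measure R0 (conjugate f) \<nu>'"
  shows "\<nu> = \<nu>'"
proof (rule radial_unique[OF R0_pos])
  fix r assume r: "0 < r" "ereal r < R0"
  have "((\<lambda>s. real_of_ereal (conjugate f s)) has_real_derivative measure \<nu> (ball 0 r)) (at_left (ln r))"
    "((\<lambda>s. real_of_ereal (conjugate f s)) has_real_derivative measure \<nu>' (ball 0 r)) (at_left (ln r))"
    using assms r by (auto simp: radial_measure_def)
  then show "measure \<nu> (ball 0 r) = measure \<nu>' (ball 0 r)"
    unfolding has_field_derivative_iff by (rule tendsto_unique[OF trivial_limit_at_left_real])
qed (use assms in \<open>auto simp: radial_measure_def\<close>)

text \<open>Outside a union of finitely many exceptional events the realization is a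
  \<open>good_function\<close>, for which the deterministic estimate leaves a deviation of at most
  \<epsilon>.\<close>

lemma zero_measure_convergence:
  fixes \<phi> :: "complex \<Rightarrow> real"
  assumes \<phi>: "continuous_on (eball 0 R0) \<phi>" and K: "compact K" "K \<subseteq> eball 0 R0" "\<And>x. x \<in> eball 0 R0 - K \<Longrightarrow> \<phi> x = 0"
    and \<mu>: "radial_measure R0 (conjugate f) \<mu>" and \<epsilon>: "\<epsilon> > 0"
  shows "(\<lambda>n. outer_measure_of M {\<omega> \<in> space M. \<bar>(\<integral>x. \<phi> x \<partial>scale_measure (ennreal (1 / real n)) (zero_measure R0 (random_series \<xi> F n \<omega>)))
      - (\<integral>x. \<phi> x \<partial>\<mu>)\<bar> > \<epsilon>}) \<longlonglongrightarrow> 0"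
proof -
  have \<mu>_eq: "\<mu> = radial_profile.\<mu> (\<lambda>r. D (ln r)) R0"
    by (rule radial_measure_unique[OF \<mu> radial_measure_exists])
  interpret rp: radial_profile "\<lambda>r. D (ln r)" R0 by (rule radial_profile)
  have lf: "locally_finite_borel_on (eball 0 R0) \<mu>" and ri: "rotation_invariant \<mu>"
    using \<mu> by (auto simp: radial_measure_def)
  obtain r0 where r0: "0 \<le> r0" "ereal r0 < R0" "K \<subseteq> cball 0 r0"
    using compact_subset_eball_0[OF K(1,2) R0_pos] by blast
  \<comment> \<open>Two radii beyond the support: smoothing and grid need room up to R1, and control
    of the series up to R2 makes its zeros inside R1 finite in number.\<close>
  obtain R1 where R1: "ereal r0 < ereal R1" "ereal R1 < R0" using ereal_dense2[OF r0(2)] by blast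
  obtain R2 where R2: "ereal R1 < ereal R2" "ereal R2 < R0" using ereal_dense2[OF R1(2)] by blast
  have rr: "r0 < R1" "R1 < R2" "0 < R1" "0 < R2" using R1 R2 r0 by auto
  define \<psi> where "\<psi> z = (if z \<in> eball 0 R0 then \<phi> z else 0)" for z
  obtain B where tf: "test_function \<psi> r0 B"
    using test_function_extension[OF \<phi> K r0(3)] unfolding \<psi>_def by blast
  interpret test_function \<psi> r0 B by (rule tf)
  define N where "N = trunc \<mu> R1"
  have N: "finite_measure N" "rotation_invariant_borel N"
    unfolding N_def by (rule finite_measure_trunc[OF lf R1(2)], rule trunc_rotation_invariant[OF lf R1(2) ri])
  have Nball: "measure N (ball 0 r) = D (ln r)" if r: "0 < r" "r \<le> R1" for r
  proof -
    have "ereal r < R0" by (rule ereal_le_less[OF r(2) R1(2)])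
    have b: "ball (0::complex) r \<inter> ball 0 R1 = ball 0 r" using r by auto
    have "emeasure N (ball 0 r) = emeasure \<mu> (ball 0 r \<inter> ball 0 R1)"
      unfolding N_def by (rule emeasure_trunc[OF lf R1(2)]) simp
    also have "\<dots> = ennreal (D (ln r))"
      unfolding b \<mu>_eq by (rule rp.emeasure_\<mu>_ball[OF r(1) \<open>ereal r < R0\<close>])
    finally have "emeasure N (ball 0 r) = ennreal (D (ln r))" .
    moreover have "D (ln r) \<ge> 0" using D_nonneg r \<open>ereal r < R0\<close> by simp
    ultimately show ?thesis by (simp add: measure_def)
  qed
  have Nsupp: "AE a in N. a \<in> ball 0 R1"
  proof (rule AE_I)
    show "- ball 0 R1 \<in> sets N" by (simp add: N_def)
    show "emeasure N (- ball 0 R1) = 0" unfolding N_def by (subst emeasure_trunc[OF lf R1(2)]) auto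
  qed (auto simp: N_def)
  obtain \<eta> P where \<eta>: "\<eta> > 0" and P: "finite P" "P \<noteq> {}" "\<And>p. p \<in> P \<Longrightarrow> p \<noteq> 0 \<and> cmod p < R1"
    and conv: "\<And>n G. good_function R2 P \<eta> n G \<Longrightarrow> \<bar>zero_sum R1 n G \<psi> - (\<integral>a. \<psi> a \<partial>N)\<bar> \<le> \<epsilon>"
    by (rule zero_sum_convergence[OF r0(1) rr(1,2) R2(2) N Nsupp Nball tf \<epsilon>]) auto
  have I\<mu>: "(\<integral>x. \<phi> x \<partial>\<mu>) = (\<integral>a. \<psi> a \<partial>N)"
    unfolding N_def by (rule integral_trunc[OF lf R1(2) meas]) (use supp rr in \<open>auto simp: \<psi>_def\<close>)
  show ?thesis
  proof (rule outer_measure_of_tendsto_0I)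
    fix e :: real assume e: "e > 0"
    \<comment> \<open>Union bound: half of e is spread over the points of P, the other half pays for
      the upper bound.\<close>
    define e' where "e' = e / (2 * real (card P))"
    have cP: "real (card P) > 0" using P by (simp add: card_gt_0_iff)
    have e': "e' > 0" using e cP by (simp add: e'_def)
    have up: "eventually (\<lambda>n. \<exists>A\<in>events. prob A < e / 2 \<and>
       (\<forall>\<omega>\<in>space M - A. fps_conv_radius (random_series \<xi> F n \<omega>) \<ge> ereal R2 \<and>
        (\<forall>z. cmod z \<le> R2 \<longrightarrow> summable (\<lambda>k. \<xi> k \<omega> * F k n * z ^ k) \<and>
           (z \<noteq> 0 \<longrightarrow> cmod (\<Sum>k. \<xi> k \<omega> * F k n * z ^ k) \<le> exp (real n * (u z + \<eta>)))))) sequentially"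
      by (rule random_series_upper_bound[OF rr(4) R2(2) \<eta>]) (use e in simp)
    have lo: "eventually (\<lambda>n. \<forall>p\<in>P. \<exists>A\<in>events. prob A < e' \<and>
       (\<forall>\<omega>\<in>space M. summable (\<lambda>k. \<xi> k \<omega> * F k n * p ^ k) \<and>
        cmod (\<Sum>k. \<xi> k \<omega> * F k n * p ^ k) \<le> exp (real n * (u p - \<eta>)) \<longrightarrow> \<omega> \<in> A)) sequentially"
    proof (rule eventually_ball_finite[OF P(1)], intro ballI)
      fix p assume "p \<in> P"
      then have p: "p \<noteq> 0" "ereal (cmod p) < R0" using P(3)[of p] ereal_le_less[OF _ R1(2), of "cmod p"] by auto
      show "eventually (\<lambda>n. \<exists>A\<in>events. prob A < e' \<and>
       (\<forall>\<omega>\<in>space M. summable (\<lambda>k. \<xi> k \<omega> * F k n * p ^ k) \<and>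
        cmod (\<Sum>k. \<xi> k \<omega> * F k n * p ^ k) \<le> exp (real n * (u p - \<eta>)) \<longrightarrow> \<omega> \<in> A)) sequentially"
        by (rule small_value_event[OF p \<eta> e'])
    qed
    show "eventually (\<lambda>n. \<exists>A\<in>events. emeasure M A \<le> ennreal e \<and>
      {\<omega> \<in> space M. \<bar>(\<integral>x. \<phi> x \<partial>scale_measure (ennreal (1 / real n)) (zero_measure R0 (random_series \<xi> F n \<omega>)))
      - (\<integral>x. \<phi> x \<partial>\<mu>)\<bar> > \<epsilon>} \<subseteq> A) sequentially"
      using up lo eventually_gt_at_top[of 0]
    proof eventually_elim
      case (elim n)
      from elim(1) obtain A0 where "A0 \<in> events \<and> prob A0 < e / 2 \<and>
       (\<forall>\<omega>\<in>space M - A0. fps_conv_radius (random_series \<xi> F n \<omega>) \<ge> ereal R2 \<and>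
        (\<forall>z. cmod z \<le> R2 \<longrightarrow> summable (\<lambda>k. \<xi> k \<omega> * F k n * z ^ k) \<and>
           (z \<noteq> 0 \<longrightarrow> cmod (\<Sum>k. \<xi> k \<omega> * F k n * z ^ k) \<le> exp (real n * (u z + \<eta>)))))"
        unfolding Bex_def ..
      then have A0: "A0 \<in> events" "prob A0 < e / 2"
        and up: "\<forall>\<omega>\<in>space M - A0. fps_conv_radius (random_series \<xi> F n \<omega>) \<ge> ereal R2 \<and>
        (\<forall>z. cmod z \<le> R2 \<longrightarrow> summable (\<lambda>k. \<xi> k \<omega> * F k n * z ^ k) \<and>
           (z \<noteq> 0 \<longrightarrow> cmod (\<Sum>k. \<xi> k \<omega> * F k n * z ^ k) \<le> exp (real n * (u z + \<eta>))))"
        by simp_all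
      from bchoice[OF elim(2)[unfolded Bex_def]] obtain A where "\<forall>p\<in>P. A p \<in> events \<and> prob (A p) < e' \<and>
       (\<forall>\<omega>\<in>space M. summable (\<lambda>k. \<xi> k \<omega> * F k n * p ^ k) \<and>
        cmod (\<Sum>k. \<xi> k \<omega> * F k n * p ^ k) \<le> exp (real n * (u p - \<eta>)) \<longrightarrow> \<omega> \<in> A p)" ..
      then have A: "\<And>p. p \<in> P \<Longrightarrow> A p \<in> events" "\<And>p. p \<in> P \<Longrightarrow> prob (A p) < e'"
        and lo: "\<And>p \<omega>. p \<in> P \<Longrightarrow> \<omega>\<in>space M \<Longrightarrow> summable (\<lambda>k. \<xi> k \<omega> * F k n * p ^ k) \<Longrightarrow>
        cmod (\<Sum>k. \<xi> k \<omega> * F k n * p ^ k) \<le> exp (real n * (u p - \<eta>)) \<Longrightarrow> \<omega> \<in> A p"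
        by simp_all
      define Bad where "Bad = A0 \<union> (\<Union>p\<in>P. A p)"
      have Bad: "Bad \<in> events" using A0 A P(1) unfolding Bad_def by auto
      have "prob Bad \<le> prob A0 + prob (\<Union>p\<in>P. A p)"
        unfolding Bad_def by (rule measure_Un_le) (use A0 A P(1) in auto)
      also have "prob (\<Union>p\<in>P. A p) \<le> (\<Sum>p\<in>P. prob (A p))"
        by (rule finite_measure_subadditive_finite) (use A P(1) in auto)
      also have "\<dots> \<le> real (card P) * e'" by (rule sum_bounded_above) (use A(2) in \<open>auto intro: less_imp_le\<close>)
      also have "\<dots> = e / 2" using cP by (simp add: e'_def)
      finally have pB: "prob Bad \<le> e" using A0 by simp
      have "{\<omega> \<in> space M. \<bar>(\<integral>x. \<phi> x \<partial>scale_measure (ennreal (1 / real n)) (zero_measure R0 (random_series \<xi> F n \<omega>)))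
      - (\<integral>x. \<phi> x \<partial>\<mu>)\<bar> > \<epsilon>} \<subseteq> Bad"
      proof (rule subsetI, rule ccontr)
        fix \<omega> assume w: "\<omega> \<in> {\<omega> \<in> space M. \<bar>(\<integral>x. \<phi> x \<partial>scale_measure (ennreal (1 / real n)) (zero_measure R0 (random_series \<xi> F n \<omega>)))
      - (\<integral>x. \<phi> x \<partial>\<mu>)\<bar> > \<epsilon>}" and nB: "\<omega> \<notin> Bad"
        define g where "g = random_series \<xi> F n \<omega>"
        have ws: "\<omega> \<in> space M" "\<omega> \<in> space M - A0" using w nB by (auto simp: Bad_def)
        have ev: "eval_fps g z = (\<Sum>k. \<xi> k \<omega> * F k n * z ^ k)" for z
          by (simp add: eval_fps_def g_def random_series_def)
        note U = bspec[OF up ws(2), folded g_def]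
        have cr: "ereal R2 \<le> fps_conv_radius g" using U by simp
        have hol: "eval_fps g holomorphic_on ball 0 R2"
          using eball_mono[OF cr, of 0] by (intro holomorphic_on_eval_fps) simp
        have big: "exp (real n * (u p - \<eta>)) < cmod (eval_fps g p)" if p: "p \<in> P" for p
        proof (rule ccontr)
          assume "\<not> exp (real n * (u p - \<eta>)) < cmod (eval_fps g p)"
          then have "cmod (\<Sum>k. \<xi> k \<omega> * F k n * p ^ k) \<le> exp (real n * (u p - \<eta>))" by (simp add: ev)
          moreover have "cmod p \<le> R2" using P(3)[OF p] rr by simp
          then have "summable (\<lambda>k. \<xi> k \<omega> * F k n * p ^ k)" using U by blast
          ultimately have "\<omega> \<in> A p" using lo[OF p ws(1)] by blast
          then show False using nB p by (auto simp: Bad_def)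
        qed
        have good: "good_function R2 P \<eta> n (eval_fps g)"
          unfolding good_function_def
        proof (intro conjI ballI impI)
          fix z :: complex assume z: "z \<in> ball 0 R2" "z \<noteq> 0"
          then have "cmod z \<le> R2" by simp
          then show "cmod (eval_fps g z) \<le> exp (real n * (u z + \<eta>))" using U z unfolding ev by blast
        qed (use elim(3) hol big in auto)
        \<comment> \<open>A single point of P already rules out the zero series, to which
          \<open>zero_measure\<close> assigns the null measure.\<close>
        obtain p where p: "p \<in> P" using P(2) by blast
        have pnz: "eval_fps g p \<noteq> 0" using big[OF p] exp_gt_zero[of "real n * (u p - \<eta>)"] by (auto simp del: exp_gt_zero)
        then have g0: "g \<noteq> 0" by auto
        have ex: "\<exists>z\<in>ball 0 R2. eval_fps g z \<noteq> 0" using pnz P(3)[OF p] rr by (intro bexI[of _ p]) auto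
        have "(\<integral>x. \<phi> x \<partial>scale_measure (ennreal (1 / real n)) (zero_measure R0 g)) =
          (\<Sum>a\<in>{a\<in>ball 0 R1. eval_fps g a = 0}. real (nat (zorder (eval_fps g) a)) * \<phi> a) / real n"
        proof (rule integral_zero_measure[OF g0 cr rr(3,2) R2(2) \<phi> _ ex])
          fix z assume "z \<in> eball 0 R0" "R1 \<le> cmod z"
          then have "z \<in> eball 0 R0 - K" using r0(3) rr by force
          then show "\<phi> z = 0" by (rule K(3))
        qed
        also have "\<dots> = zero_sum R1 n (eval_fps g) \<psi>"
        proof -
          have "\<phi> a = \<psi> a" if "a \<in> ball 0 R1" for a
            using that ball_subset_eball_0(1)[OF R1(2)] by (auto simp: \<psi>_def)
          then show ?thesis unfolding zero_sum_def by (intro arg_cong2[where f="(/)"] sum.cong) auto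
        qed
        finally have "\<bar>(\<integral>x. \<phi> x \<partial>scale_measure (ennreal (1 / real n)) (zero_measure R0 g)) - (\<integral>x. \<phi> x \<partial>\<mu>)\<bar> \<le> \<epsilon>"
          using conv[OF good] by (simp add: I\<mu>)
        then show False using w by (simp add: g_def)
      qed
      moreover have "emeasure M Bad \<le> ennreal e" using pB by (simp add: emeasure_eq_measure ennreal_leI)
      ultimately show ?case using Bad by blast
    qed
  qed
qed

end

theorem theorem2p9:
  fixes M :: "'a measure"
    and \<xi> :: "nat \<Rightarrow> 'a \<Rightarrow> complex"
    and F :: "nat \<Rightarrow> nat \<Rightarrow> complex"
    and f :: "real \<Rightarrow> real"
    and T\<^sub>0 R\<^sub>0 :: ereal
  assumes prob: "prob_space M"
    and indep: "prob_space.indep_vars M (\<lambda>_. borel) \<xi> UNIV"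
    and ident: "\<And>k. distr M borel (\<xi> k) = distr M borel (\<xi> 0)"
    and nondegenerate: "\<not> (\<exists>c. AE \<omega> in M. \<xi> 0 \<omega> = c)"
    and log_moment: "integrable M (\<lambda>\<omega>. ln (1 + norm (\<xi> 0 \<omega>)))"
    and f_nonneg: "\<And>t. t \<ge> 0 \<Longrightarrow> f t \<ge> 0"
    and T0_pos: "T\<^sub>0 > 0"
    and A1_pos: "\<And>t. t \<ge> 0 \<Longrightarrow> ereal t < T\<^sub>0 \<Longrightarrow> f t > 0"
    and A1_zero: "\<And>t. t \<ge> 0 \<Longrightarrow> ereal t > T\<^sub>0 \<Longrightarrow> f t = 0"
    and A2_cont: "continuous_on {t. 0 \<le> t \<and> ereal t < T\<^sub>0} f"
    and A2_left: "\<And>T. T\<^sub>0 = ereal T \<Longrightarrow> continuous (at_left T) f"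
    and A3: "\<And>A::real. A > 0 \<Longrightarrow>
      (\<lambda>n. SUP k\<in>{k::nat. real k \<le> A * real n}.
             \<bar>norm (F k n) powr (1 / real n) - f (real k / real n)\<bar>) \<longlonglongrightarrow> 0"
    and R0_eq: "R\<^sub>0 = Liminf at_top (\<lambda>t::real. inv_root t (f t))"
    and R0_pos: "R\<^sub>0 > 0"
    and A4: "\<And>c::real. ereal c < R\<^sub>0 \<Longrightarrow>
      \<exists>A::real. A > 0 \<and> (\<forall>n k. real n \<ge> A \<and> real k \<ge> A * real n \<longrightarrow>
        inv_root (real k) (norm (F k n)) \<ge> ereal c)"
  shows "(\<forall>s. conjugate f s \<noteq> -\<infinity>) \<and>
    (\<forall>s. ereal (exp s) < R\<^sub>0 \<longrightarrow> conjugate f s \<noteq> \<infinity>) \<and>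
    convex_on {s. ereal (exp s) < R\<^sub>0} (\<lambda>s. real_of_ereal (conjugate f s)) \<and>
    (\<exists>\<mu>. radial_measure R\<^sub>0 (conjugate f) \<mu> \<and>
         (\<forall>\<nu>. radial_measure R\<^sub>0 (conjugate f) \<nu> \<longrightarrow> \<nu> = \<mu>) \<and>
         measures_tendsto_in_prob M (eball 0 R\<^sub>0)
           (\<lambda>n \<omega>. scale_measure (ennreal (1 / real n)) (zero_measure R\<^sub>0 (random_series \<xi> F n \<omega>)))
           \<mu>)"
proof -
  interpret P: prob_space M by (rule prob)
  interpret random_taylor F f "T\<^sub>0" "R\<^sub>0" M \<xi>
    by (unfold_locales, fact f_nonneg, fact T0_pos, fact A1_pos, fact A1_zero, fact A2_cont, fact A2_left, fact A3,
        fact R0_eq, fact R0_pos, fact A4, fact indep, fact ident, fact nondegenerate, fact log_moment)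
  let ?\<mu> = "radial_profile.\<mu> (\<lambda>r. D (ln r)) R\<^sub>0"
  have cv: "convex_on S (\<lambda>s. real_of_ereal (conjugate f s))"
  proof (rule convex_onI)
    show cS: "convex S" using conv by (simp add: convex_on_def)
    fix t x y :: real
    assume t: "0 < t" "t < 1" and xy: "x \<in> S" "y \<in> S"
    have "(1 - t) *\<^sub>R x + t *\<^sub>R y \<in> S" using convexD[OF cS xy, of "1 - t" t] t by simp
    then show "real_of_ereal (conjugate f ((1 - t) *\<^sub>R x + t *\<^sub>R y))
        \<le> (1 - t) * real_of_ereal (conjugate f x) + t * real_of_ereal (conjugate f y)"
      using convex_onD[OF conv _ _ xy, of t] t xy by (simp add: conjugate_eq)
  qed
  have mt: "measures_tendsto_in_prob M (eball 0 R\<^sub>0)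
           (\<lambda>n \<omega>. scale_measure (ennreal (1 / real n)) (zero_measure R\<^sub>0 (random_series \<xi> F n \<omega>))) ?\<mu>"
    unfolding measures_tendsto_in_prob_def tendsto_in_prob_def
  proof (intro allI impI)
    fix \<phi> :: "complex \<Rightarrow> real" and \<epsilon> :: real
    assume \<phi>: "continuous_on (eball 0 R\<^sub>0) \<phi> \<and> (\<exists>K. compact K \<and> K \<subseteq> eball 0 R\<^sub>0 \<and> (\<forall>x\<in>eball 0 R\<^sub>0 - K. \<phi> x = 0))"
      and \<epsilon>: "\<epsilon> > 0"
    then obtain K where K: "compact K" "K \<subseteq> eball 0 R\<^sub>0" "\<And>x. x \<in> eball 0 R\<^sub>0 - K \<Longrightarrow> \<phi> x = 0" by blast
    show "(\<lambda>n. outer_measure_of M {\<omega> \<in> space M. \<bar>(\<integral>x. \<phi> x \<partial>scale_measure (ennreal (1 / real n)) (zero_measure R\<^sub>0 (random_series \<xi> F n \<omega>)))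
      - (\<integral>x. \<phi> x \<partial>?\<mu>)\<bar> > \<epsilon>}) \<longlonglongrightarrow> 0"
      by (rule zero_measure_convergence[OF conjunct1[OF \<phi>] K radial_measure_exists \<epsilon>])
  qed
  show ?thesis
  proof (intro conjI exI[of _ ?\<mu>] allI impI)
    show "conjugate f s \<noteq> -\<infinity>" for s by (rule conjugate_not_MInf)
    show "conjugate f s \<noteq> \<infinity>" if "ereal (exp s) < R\<^sub>0" for s by (simp add: conjugate_eq[OF that])
    show "\<nu> = ?\<mu>" if "radial_measure R\<^sub>0 (conjugate f) \<nu>" for \<nu>
      by (rule radial_measure_unique[OF that radial_measure_exists])
  qed (rule cv radial_measure_exists mt)+
qed

end
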